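(* Let $\xi$ be a random vector in $\mathbb{R}^d$ with probability density $f$ with respect to Lebesgue measure, let $X_1,X_2,\ldots$ be i.i.d. random vectors with the same law as $\xi$, and for $N\ge 2$ let $H_N$ be the Kozachenko–Leonenko estimate built from $X_1,\ldots,X_N$. Assume that, for some positive numbers $\varepsilon_0,\varepsilon_1,\varepsilon_2,R_1,R_2$, one has $K_{f,2}(\varepsilon_0)<\infty$, $Q_f(\varepsilon_1,R_1)<\infty$ and $T_f(\varepsilon_2,R_2)<\infty$. Then the estimates $H_N$ are $L^2$-consistent, i.e. $$\mathsf{E}(H_N-H)^2\to0,\qquad N\to\infty,$$ where $H=H(f)$ is the differential Shannon entropy of $f$.
   Context: All random vectors are defined on a complete probability space. $\rho(x,y)$ is the Euclidean distance in $\mathbb{R}^d$, $B(x,r)=\{y:\rho(x,y)\le r\}$, $V_d=\pi^{d/2}/\Gamma(\tfrac d2+1)$ is the volume of the unit ball, $\log$ is the natural logarithm (and $\log^2 t=(\log t)^2$), and $\gamma=-\int_0^\infty e^{-t}\log t\,dt$ is the Euler constant. Entropy: $H(f)=-\int_{\mathbb{R}^d}f(x)\log f(x)\,dx$, with $0\log 0:=0$. Estimate: for $N\ge2$ and $i=1,\ldots,N$ let $\rho_i=\min\{\rho(X_i,X_j): j\in\{1,\ldots,N\}\setminus\{i\}\}$, $\overline{\rho}=(\rho_1\cdots\rho_N)^{1/N}$, and $$H_N=d\log\overline{\rho}+\log V_d+\gamma+\log(N-1).$$ Functionals: let $G(t)=0$ for $0\le t<1$ and $G(t)=t\log t$ for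 $t\ge1$. For $x\in\mathbb{R}^d$, $r,R>0$ put $$I_f(x,r)=\frac{1}{r^dV_d}\int_{B(x,r)}f(y)\,dy,\quad M_f(x,R)=\sup_{r\in(0,R]}I_f(x,r),\quad m_f(x,R)=\inf_{r\in(0,R]}I_f(x,r).$$ For positive $\varepsilon_0,\varepsilon_1,\varepsilon_2,R_1,R_2$ define (with values in $[0,\infty]$) $$K_{f,2}(\varepsilon_0)=\int_{\mathbb{R}^d}\Big(\int_{\mathbb{R}^d}G\big(\log^2\rho(x,y)\big)f(y)\,dy\Big)^{1+\varepsilon_0}f(x)\,dx,$$ $$Q_f(\varepsilon_1,R_1)=\int_{\mathbb{R}^d}M_f(x,R_1)^{\varepsilon_1}f(x)\,dx,\qquad T_f(\varepsilon_2,R_2)=\int_{\mathbb{R}^d}m_f(x,R_2)^{-\varepsilon_2}f(x)\,dx,$$ with the conventions $\log 0:=-\infty$, $G(\infty):=\infty$, $1/0:=\infty$; the integrals in $x$ may equivalently be taken over $S(f)=\{x:f(x)>0\}$, and do not depend on the version of $f$. *)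

theory Defs
  imports "HOL-Probability.Probability"
begin

text \<open>
  The space \<open>\<real>\<^sup>d\<close> is a type \<open>'a\<close> of class \<open>euclidean_space\<close>, with \<open>d = DIM('a)\<close>.
  The volume \<open>V\<^sub>d\<close> of its unit ball is \<open>unit_ball_vol DIM('a)\<close>. \<open>shannon_entropy\<close> is a Bochner
  integral, which has the value 0 if the integrand is not integrable.
\<close>

definition shannon_entropy :: "('a::euclidean_space \<Rightarrow> real) \<Rightarrow> real" where
  "shannon_entropy f = - (\<integral>x. f x * ln (f x) \<partial>lborel)"

text \<open>Samples are numbered from 1; \<open>x 0\<close> is not used.\<close>

definition nn_dist :: "nat \<Rightarrow> (nat \<Rightarrow> 'a::euclidean_space) \<Rightarrow> nat \<Rightarrow> real" where
  "nn_dist N x i = Min ((\<lambda>j. dist (x i) (x j)) ` ({1..N} - {i}))"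

definition mean_nn_dist :: "nat \<Rightarrow> (nat \<Rightarrow> 'a::euclidean_space) \<Rightarrow> real" where
  "mean_nn_dist N x = root N (\<Prod>i=1..N. nn_dist N x i)"

text \<open>
  Meaningful for \<open>N \<ge> 2\<close>. If two sample points coincide then \<open>ln 0 = 0\<close> applies; for a sample from
  a law with a density this is an event of probability 0.
\<close>

definition KL_estimate :: "nat \<Rightarrow> (nat \<Rightarrow> 'a::euclidean_space) \<Rightarrow> real" where
  "KL_estimate N x =
     real DIM('a) * ln (mean_nn_dist N x) + ln (unit_ball_vol (real DIM('a)))
       + euler_mascheroni + ln (real N - 1)"

text \<open>Real powers on \<open>[0,\<infinity>]\<close>, intended for \<open>a > 0\<close> only, with \<open>\<infinity>\<close> to the power \<open>a\<close> being \<open>\<infinity>\<close>.\<close>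

definition ennreal_powr :: "ennreal \<Rightarrow> real \<Rightarrow> ennreal" where
  "ennreal_powr t a = (if t = \<infinity> then \<infinity> else ennreal (enn2real t powr a))"

definition G_fun :: "ereal \<Rightarrow> ennreal" where
  "G_fun t = (if t < 1 then 0 else if t = \<infinity> then \<infinity>
              else ennreal (real_of_ereal t * ln (real_of_ereal t)))"

definition log_dist :: "'a::euclidean_space \<Rightarrow> 'a \<Rightarrow> ereal" where
  "log_dist x y = (if x = y then - \<infinity> else ereal (ln (dist x y)))"

definition I_fun :: "('a::euclidean_space \<Rightarrow> real) \<Rightarrow> 'a \<Rightarrow> real \<Rightarrow> ennreal" where
  "I_fun f x r =
     (\<integral>\<^sup>+y\<in>cball x r. ennreal (f y) \<partial>lborel) / ennreal (r ^ DIM('a) * unit_ball_vol (real DIM('a)))"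

definition M_fun :: "('a::euclidean_space \<Rightarrow> real) \<Rightarrow> 'a \<Rightarrow> real \<Rightarrow> ennreal" where
  "M_fun f x R = (SUP r\<in>{0<..R}. I_fun f x r)"

definition m_fun :: "('a::euclidean_space \<Rightarrow> real) \<Rightarrow> 'a \<Rightarrow> real \<Rightarrow> ennreal" where
  "m_fun f x R = (INF r\<in>{0<..R}. I_fun f x r)"

text \<open>
  Since \<open>0 * \<infinity> = 0\<close> in \<^typ>\<open>ennreal\<close>, the following integrals in \<open>x\<close> are in effect taken
  over \<open>{x. f x > 0}\<close>. In \<open>T_functional\<close>, \<open>1 / 0 = \<infinity>\<close>.
\<close>

definition K2_functional :: "('a::euclidean_space \<Rightarrow> real) \<Rightarrow> real \<Rightarrow> ennreal" where
  "K2_functional f \<epsilon> =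
     (\<integral>\<^sup>+x. ennreal_powr (\<integral>\<^sup>+y. G_fun ((log_dist x y)\<^sup>2) * ennreal (f y) \<partial>lborel) (1 + \<epsilon>)
            * ennreal (f x) \<partial>lborel)"

definition Q_functional :: "('a::euclidean_space \<Rightarrow> real) \<Rightarrow> real \<Rightarrow> real \<Rightarrow> ennreal" where
  "Q_functional f \<epsilon> R = (\<integral>\<^sup>+x. ennreal_powr (M_fun f x R) \<epsilon> * ennreal (f x) \<partial>lborel)"

definition T_functional :: "('a::euclidean_space \<Rightarrow> real) \<Rightarrow> real \<Rightarrow> real \<Rightarrow> ennreal" where
  "T_functional f \<epsilon> R = (\<integral>\<^sup>+x. 1 / ennreal_powr (m_fun f x R) \<epsilon> * ennreal (f x) \<partial>lborel)"

end

theory Submission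
  imports Defs "HOL-Real_Asymp.Real_Asymp"
begin

text \<open>
  Let \<open>Z\<^sub>i = (N - 1) V\<^sub>d \<rho>\<^sub>i\<^sup>d\<close>, so that \<open>H\<^sub>N = \<gamma> + (1/N) \<Sum> ln Z\<^sub>i\<close>. Writing \<open>ln Z\<close> as the integral over
  real \<open>t\<close> of \<open>1[t < ln Z] - 1[t < 0]\<close> turns the estimate into an integral of the empirical tail
  \<open>(1/N) \<Sum> 1[Z\<^sub>i > e\<^sup>t]\<close>, whose limit in \<open>L\<^sup>2\<close> is the mixture \<open>F(e\<^sup>t)\<close> of exponential tails, where
  \<open>F(u) = \<integral> f(x) exp(- u f(x)) dx\<close>. Since \<open>- \<gamma> - ln a\<close> is the integral of \<open>exp(- a e\<^sup>t) - 1[t < 0]\<close>,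
  the same integral with \<open>F\<close> in place of the empirical tail equals \<open>H - \<gamma>\<close>.

  For fixed \<open>t\<close> the convergence only needs the averages of \<open>f\<close> over shrinking balls to converge to \<open>f\<close>
  in \<open>L\<^sup>1\<close>, which is continuity of translations; no differentiation theorem is used. The conditions
  on \<open>Q\<close> and \<open>T\<close> bound the second moment of the deviation at \<open>t\<close> by a multiple of \<open>exp(- \<delta> |t|)\<close>
  as long as the radius belonging to \<open>t\<close> is below a fixed \<open>R\<close>, so the Cauchy-Schwarz inequality
  with an exponential weight and dominated convergence handle this range. The part of \<open>ln \<rho>\<^sub>i\<close>
  above \<open>ln R\<close> vanishes in \<open>L\<^sup>2\<close> because \<open>ln |X\<^sub>i - X\<^sub>j|\<close> is square integrable there (by the
  condition on \<open>K\<close>) while the ball of radius \<open>R\<close> about \<open>X\<^sub>i\<close> is eventually occupied.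
\<close>

section \<open>The Gumbel integral and elementary estimates\<close>

text \<open>The obstacle is that \<open>Q_functional\<close> and \<open>T_functional\<close> control
  ball averages only at small radii. A level t belongs to the ball of volume
  \<open>exp t / (N - 1)\<close>, whose radius is below \<open>R\<close> exactly for t <
  \<open>log_ball_count N R\<close>. This cutoff grows like ln N; beyond it the sample distances are
  controlled through \<open>K2_functional\<close>. Left of the cutoff, let w be the expected number
  of points in a ball. It is occupied with chance at most min(1, w) \<le> w^\<delta> and vacant with
  chance at most exp(- w) \<le> w^(-\<delta>), where 0 < \<delta> \<le> 1. So moments of small order
  of the ball averages suffice. The events that different sample points are isolated are dependent.
  Expanding the square of (empirical tail - F) requires the exact mean but only an upper bound for
  pairs: if two points are more than 2r apart, their balls are disjoint and 1 - p - q \<le> exp(- p)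
  exp(- q) factorises, while closer pairs have vanishing probability. Decay of F is obtained by
  letting the sample size tend to infinity in the finite-sample bounds. It makes the double integral
  behind the entropy absolutely convergent, so integrability of f ln f is a conclusion.\<close>

lemma has_bochner_integral_exp_minus_abs:
  fixes a :: real
  assumes "a > 0"
  shows "has_bochner_integral lborel (\<lambda>t. exp (- (a * \<bar>t\<bar>))) (2 / a)"
proof -
  let ?h = "\<lambda>t::real. indicator {0..} t * exp (- (a * t))"
  have "(\<integral>\<^sup>+t. ennreal (exp (- (a * t))) * indicator {0..} t \<partial>lborel) = ennreal (0 - (- exp (- (a * 0)) / a))"
  proof (rule nn_integral_FTC_atLeast)
    show "((\<lambda>t. - exp (- (a * t)) / a) \<longlongrightarrow> 0) at_top"
      using assms by real_asymp
  qed (use assms in \<open>auto intro!: derivative_eq_intros\<close>)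
  then have h: "has_bochner_integral lborel ?h (1 / a)"
    using assms by (intro has_bochner_integral_nn_integral)
      (auto simp: ennreal_mult ennreal_indicator mult.commute)
  have h': "has_bochner_integral lborel (\<lambda>t. ?h (0 + (-1) * t)) (1 / a)"
    using h by (subst (asm) lborel_has_bochner_integral_real_affine_iff[where c = "-1" and t = 0]) auto
  have "has_bochner_integral lborel (\<lambda>t. ?h t + ?h (0 + (-1) * t)) (1 / a + 1 / a)"
    using h h' by (rule has_bochner_integral_add)
  \<comment> \<open>At t = 0 both closed half-lines count and the sum is 2, hence only almost
    everywhere.\<close>
  moreover have "AE t in lborel. ?h t + ?h (0 + (-1) * t) = exp (- (a * \<bar>t\<bar>))"
    using AE_lborel_singleton[of "0::real"]
    by eventually_elim (auto simp: indicator_def)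
  ultimately show ?thesis
    by (subst has_bochner_integral_cong_AE[symmetric, where f = "\<lambda>t. ?h t + ?h (0 + (-1) * t)"]) auto
qed

text \<open>This is the mean of the maximum of n standard exponentials. A finite geometric sum
  splits the integrand into \<open>exp (- x) * (1 - exp (- x)) ^ k\<close>, k < n, each with
  antiderivative \<open>(1 - exp (- x)) ^ Suc k / (k + 1)\<close>.\<close>

lemma has_bochner_integral_one_minus_power_harm:
  "has_bochner_integral lborel (\<lambda>x::real. indicator {0..} x * (1 - (1 - exp (- x)) ^ n)) (harm n)"
proof -
  have "has_bochner_integral lborel (\<lambda>x::real. indicator {0..} x * (exp (- x) * (1 - exp (- x)) ^ k))
      (1 / (real k + 1))" for k
  proof -
    have "(\<integral>\<^sup>+x. ennreal (exp (- x) * (1 - exp (- x)) ^ k) * indicator {0..} x \<partial>lborel)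
        = ennreal (1 / (real k + 1) - (1 - exp (- 0)) ^ Suc k / (real k + 1))"
    proof (rule nn_integral_FTC_atLeast)
      fix x :: real assume "0 \<le> x"
      have "((\<lambda>x. (1 - exp (- x)) ^ Suc k) has_real_derivative
          (exp (- x) * (1 - exp (- x)) ^ k) * (real k + 1)) (at x)"
        by (auto intro!: derivative_eq_intros simp del: power_Suc simp: algebra_simps)
      from DERIV_cdivide[OF this, of "real k + 1"]
      show "((\<lambda>x. (1 - exp (- x)) ^ Suc k / (real k + 1)) has_real_derivative
          exp (- x) * (1 - exp (- x)) ^ k) (at x)"
        by simp
      show "0 \<le> exp (- x) * (1 - exp (- x)) ^ k"
        using \<open>0 \<le> x\<close> by auto
    next
      have "((\<lambda>x::real. 1 - exp (- x)) \<longlongrightarrow> 1) at_top" by real_asymp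
      then have "((\<lambda>x::real. (1 - exp (- x)) ^ Suc k / (real k + 1)) \<longlongrightarrow> 1 ^ Suc k / (real k + 1)) at_top"
        by (intro tendsto_intros) auto
      then show "((\<lambda>x::real. (1 - exp (- x)) ^ Suc k / (real k + 1)) \<longlongrightarrow> 1 / (real k + 1)) at_top"
        by simp
    qed auto
    also have "(\<integral>\<^sup>+x. ennreal (exp (- x) * (1 - exp (- x)) ^ k) * indicator {0..} x \<partial>lborel)
        = (\<integral>\<^sup>+x. ennreal (indicator {0..} x * (exp (- x) * (1 - exp (- x)) ^ k)) \<partial>lborel)"
      by (intro nn_integral_cong) (auto simp: indicator_def)
    finally show ?thesis
      by (intro has_bochner_integral_nn_integral) (auto simp: indicator_def)
  qed
  then have "has_bochner_integral lborel
      (\<lambda>x::real. \<Sum>k<n. indicator {0..} x * (exp (- x) * (1 - exp (- x)) ^ k)) (\<Sum>k<n. 1 / (real k + 1))"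
    by (intro has_bochner_integral_sum)
  moreover have "(\<Sum>k<n. indicator {0..} x * (exp (- x) * (1 - exp (- x)) ^ k))
      = indicator {0..} x * (1 - (1 - exp (- x)) ^ n)" for x :: real
    using one_diff_power_eq[of "1 - exp (- x)" n]
    by (simp add: sum_distrib_left)
  moreover have "(\<Sum>k<n. 1 / (real k + 1)) = harm n"
    unfolding harm_def by (rule sum.reindex_bij_witness[of _ "\<lambda>k. k - 1" Suc]) (auto simp: inverse_eq_divide)
  ultimately show ?thesis by simp
qed

text \<open>The cutoff \<open>T\<close> removes only levels above it; since
  \<open>0 \<le> T\<close>, the whole negative half-line survives and a negative \<open>c\<close> is
  still recovered. The decomposition of the estimate uses it with
  \<open>T = log_ball_count N R\<close>.\<close>

lemma has_bochner_integral_layer: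
  fixes c T :: real
  assumes "0 \<le> T"
  shows "has_bochner_integral lborel
    (\<lambda>t. indicator {..<T} t * (indicator {..<c} t - indicator {..<0} t)) (min c T)"
proof (cases "0 \<le> min c T")
  case True
  have "has_bochner_integral lborel (indicator {0..<min c T} :: real \<Rightarrow> real) (measure lborel {0..<min c T})"
    by (intro has_bochner_integral_real_indicator emeasure_bounded_finite) auto
  then show ?thesis
    using True by (elim has_bochner_integral_cong[THEN iffD1, rotated -1]) (auto simp: indicator_def)
next
  case False
  have "has_bochner_integral lborel (\<lambda>t. - (indicator {c..<0} t :: real)) (- measure lborel {c..<0})"
    by (intro has_bochner_integral_minus has_bochner_integral_real_indicator emeasure_bounded_finite) auto
  then show ?thesis
    using False assms by (elim has_bochner_integral_cong[THEN iffD1, rotated -1]) (auto simp: indicator_def)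
qed

lemma has_bochner_integral_layer_UNIV:
  fixes c :: real
  shows "has_bochner_integral lborel (\<lambda>t. indicator {..<c} t - indicator {..<0} t) c"
proof -
  have "(\<lambda>t. indicator {..<\<bar>c\<bar>} t * (indicator {..<c} t - indicator {..<0} t)) =
      (\<lambda>t. indicator {..<c} t - indicator {..<0} t :: real)"
    by (auto simp: indicator_def fun_eq_iff)
  then show ?thesis
    using has_bochner_integral_layer[of "\<bar>c\<bar>" c] by simp
qed

text \<open>Substituting x = ln n - t in the integral for \<open>harm n\<close> turns the power into
  (1 - exp t / n)^n, which tends to exp(- exp t), while \<open>harm n - ln n\<close> tends to
  \<gamma>. Dominated convergence joins the two limits.\<close>

lemma has_bochner_integral_gumbel_standard:
  "has_bochner_integral lborel (\<lambda>t::real. exp (- exp t) - indicator {..<0} t) (- euler_mascheroni)"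
proof -
  \<comment> \<open>The value 0 beyond \<open>ln n\<close> is the part x < 0 cut off by
    \<open>indicator {0..}\<close> before the substitution.\<close>
  define h where "h n t = (if t \<le> ln (real n) then (1 - exp t / real n) ^ n else 0) - indicator {..<0} t"
    for n and t :: real
  have h_int: "has_bochner_integral lborel (h n) (ln (real n) - harm n)" if "n \<ge> 1" for n
  proof -
    let ?g = "\<lambda>x::real. indicator {0..} x * (1 - (1 - exp (- x)) ^ n)"
    have "has_bochner_integral lborel (\<lambda>t. ?g (ln (real n) + (-1) * t)) (harm n)"
      using has_bochner_integral_one_minus_power_harm[of n]
      by (subst (asm) lborel_has_bochner_integral_real_affine_iff[where c = "-1" and t = "ln (real n)"]) auto
    moreover have "has_bochner_integral lborel (indicator {0..ln (real n)} :: real \<Rightarrow> real)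
        (measure lborel {0..ln (real n)})"
      by (intro has_bochner_integral_real_indicator emeasure_bounded_finite) auto
    ultimately have "has_bochner_integral lborel
        (\<lambda>t. indicator {0..ln (real n)} t - ?g (ln (real n) + (-1) * t))
        (measure lborel {0..ln (real n)} - harm n)"
      by (intro has_bochner_integral_diff) auto
    moreover have "indicator {0..ln (real n)} t - ?g (ln (real n) + (-1) * t) = h n t" for t
    proof -
      have "0 \<le> ln (real n)"
        using that by simp
      moreover have "exp (- (ln (real n) + (-1) * t)) = exp t / real n"
        using that by (simp add: exp_diff)
      ultimately show ?thesis
        unfolding h_def by (cases "t \<le> ln (real n)"; cases "t < 0") (simp_all add: indicator_def)
    qed
    ultimately show ?thesis
      using that by simp
  qed
  \<comment> \<open>For t < 0 Bernoulli's inequality bounds the gap to 1 by \<open>exp t\<close>;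
    for t \<ge> 0 the power is at most exp(- exp t) \<le> exp(- t).\<close>
  have bound: "\<bar>h n t\<bar> \<le> exp (- (1 * \<bar>t\<bar>))" if "n \<ge> 1" for n and t :: real
  proof (cases "t \<le> ln (real n)")
    case True
    then have le: "exp t \<le> real n"
      using that by (simp add: ln_ge_iff)
    have nn: "0 \<le> (1 - exp t / real n) ^ n"
      using le that by (intro zero_le_power) (auto simp: field_simps)
    have up: "(1 - exp t / real n) ^ n \<le> exp (- exp t)"
      using exp_ge_one_minus_x_over_n_power_n[of "exp t" n] le that by auto
    show ?thesis
    proof (cases "t < 0")
      case True
      have "1 + real n * (- exp t / real n) \<le> (1 + (- exp t / real n)) ^ n"
        using le that by (intro Bernoulli_inequality) (auto simp: field_simps)
      moreover have "(1 - exp t / real n) ^ n \<le> 1"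
        using up by (smt (verit) exp_le_one_iff exp_ge_zero)
      ultimately show ?thesis
        using True that nn \<open>t \<le> ln _\<close> by (auto simp: h_def)
    next
      case False
      have "exp (- exp t) \<le> exp (- t)"
        using exp_ge_add_one_self[of t] by (simp del: exp_ge_add_one_self)
      then have "(1 - exp t / real n) ^ n \<le> exp (- t)"
        by (rule order_trans[OF up])
      then show ?thesis
        using False nn \<open>t \<le> ln _\<close> by (simp add: h_def)
    qed
  next
    case False
    moreover have "0 \<le> ln (real n)"
      using that by simp
    ultimately show ?thesis
      by (simp add: h_def indicator_def)
  qed
  have lim: "(\<lambda>n. h n t) \<longlonglongrightarrow> exp (- exp t) - indicator {..<0} t" for t
  proof -
    have "(\<lambda>n. (1 + (- exp t) / real n) ^ n) \<longlonglongrightarrow> exp (- exp t)"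
      by (rule tendsto_exp_limit_sequentially)
    moreover have "eventually (\<lambda>n. t \<le> ln (real n)) sequentially"
      by real_asymp
    then have "eventually (\<lambda>n. (1 + (- exp t) / real n) ^ n
        = (if t \<le> ln (real n) then (1 - exp t / real n) ^ n else 0)) sequentially"
      by eventually_elim auto
    ultimately show ?thesis
      unfolding h_def by (intro tendsto_intros) (rule Lim_transform_eventually)
  qed
  have h_meas [measurable]: "h n \<in> borel_measurable lborel" for n
    unfolding h_def by measurable
  have w: "integrable lborel (\<lambda>t::real. exp (- (1 * \<bar>t\<bar>)))"
    using has_bochner_integral_exp_minus_abs[of 1] by (auto simp: has_bochner_integral_iff)
  have lim': "AE t in lborel. (\<lambda>n. h (Suc n) t) \<longlonglongrightarrow> exp (- exp t) - indicator {..<0} t"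
    using lim by (intro AE_I2 LIMSEQ_Suc) auto
  have bound': "AE t in lborel. norm (h (Suc n) t) \<le> exp (- (1 * \<bar>t\<bar>))" for n
    using bound[of "Suc n"] by auto
  have meas: "(\<lambda>t::real. exp (- exp t) - indicator {..<0} t) \<in> borel_measurable lborel"
    by measurable
  have "(\<lambda>n. \<integral>t. h (Suc n) t \<partial>lborel) \<longlonglongrightarrow> (\<integral>t. exp (- exp t) - indicator {..<0} t \<partial>lborel)"
    by (rule integral_dominated_convergence[OF meas h_meas w lim' bound'])
  moreover have "(\<lambda>n. \<integral>t. h (Suc n) t \<partial>lborel) = (\<lambda>n. - (harm (Suc n) - ln (real (Suc n))))"
    using h_int by (auto simp: has_bochner_integral_iff fun_eq_iff)
  moreover have "(\<lambda>n. - (harm (Suc n) - ln (real (Suc n)))) \<longlonglongrightarrow> - (euler_mascheroni :: real)"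
    using LIMSEQ_Suc[OF euler_mascheroni_LIMSEQ] by (intro tendsto_minus) auto
  ultimately have "(\<integral>t. exp (- exp t) - indicator {..<0} t \<partial>lborel) = - (euler_mascheroni :: real)"
    using LIMSEQ_unique by auto
  moreover have "integrable lborel (\<lambda>t::real. exp (- exp t) - indicator {..<0} t)"
    by (rule integrable_dominated_convergence[OF meas h_meas w lim' bound'])
  ultimately show ?thesis
    by (simp add: has_bochner_integral_iff)
qed

text \<open>Translating the case a = 1 by \<open>ln a\<close> keeps the integral but moves the jump
  of the indicator to \<open>- ln a\<close>. Moving it back to 0 costs one layer integral, the term
  \<open>- ln a\<close>.\<close>

lemma has_bochner_integral_gumbel:
  fixes a :: real
  assumes "a > 0"
  shows "has_bochner_integral lborel (\<lambda>t. exp (- (a * exp t)) - indicator {..<0} t) (- euler_mascheroni - ln a)"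
proof -
  have "has_bochner_integral lborel
      (\<lambda>t. (\<lambda>t. exp (- exp t) - indicator {..<0} t) (ln a + 1 * t)) (- euler_mascheroni :: real)"
    using has_bochner_integral_gumbel_standard
    by (subst (asm) lborel_has_bochner_integral_real_affine_iff[where c = 1 and t = "ln a"]) auto
  moreover have "has_bochner_integral lborel (\<lambda>t. indicator {..<- ln a} t - indicator {..<0} t) (- ln a)"
    by (rule has_bochner_integral_layer_UNIV)
  ultimately have "has_bochner_integral lborel
      (\<lambda>t. (exp (- exp (ln a + 1 * t)) - indicator {..<0} (ln a + 1 * t))
         + (indicator {..<- ln a} t - indicator {..<0} t)) (- euler_mascheroni + - ln a)"
    by (intro has_bochner_integral_add) auto
  then show ?thesis
    using assms by (elim has_bochner_integral_cong[THEN iffD1, rotated -1]) (auto simp: indicator_def exp_add)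
qed

text \<open>The error is of order 1/n uniformly in p, so it survives integration over p =
  \<open>ball_prob x r\<close> whatever the law. Factoring the difference of n-th powers gives n
  summands, each at most \<open>e ^ m\<close> times e - (1 - p) \<le> p^2.\<close>

lemma exp_minus_power_diff_bound:
  fixes p :: real
  assumes "0 \<le> p" "p \<le> 1" "n \<ge> 2"
  shows "exp (- (real n * p)) - 2 * real n / (real n - 1)\<^sup>2 \<le> (1 - p) ^ n"
proof -
  obtain m where m: "n = Suc m" "m \<ge> 1"
    using assms by (cases n) auto
  define e where "e = exp (- p)"
  have e: "1 - p \<le> e" "0 \<le> e"
    using exp_ge_add_one_self[of "-p"] by (auto simp: e_def)
  \<comment> \<open>Multiplying the goal e \<le> 1 - p + p^2 by 1 + p makes its right side collapse
    to 1 + p^3.\<close>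
  have "e * (1 + p) \<le> e * exp p"
    using e by (intro mult_left_mono) (auto simp: exp_ge_add_one_self)
  also have "\<dots> = 1"
    by (simp add: e_def flip: exp_add)
  also have "1 \<le> 1 + p ^ 3"
    using assms by simp
  also have "\<dots> = (1 - p + p\<^sup>2) * (1 + p)"
    by (simp add: algebra_simps power2_eq_square power3_eq_cube)
  finally have "e \<le> 1 - p + p\<^sup>2"
    using assms by (subst (asm) mult_le_cancel_right_pos) auto
  then have e2: "e - (1 - p) \<le> p\<^sup>2"
    by simp
  have "e ^ n - (1 - p) ^ n = (e - (1 - p)) * (\<Sum>k<Suc m. e ^ k * (1 - p) ^ (m - k))"
    using power_diff_sumr2[of e n "1 - p"] m by (simp add: lessThan_Suc_atMost mult.commute)
  also have "\<dots> \<le> (e - (1 - p)) * (\<Sum>k<Suc m. e ^ m)"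
  proof (intro mult_left_mono sum_mono)
    fix k assume "k \<in> {..<Suc m}"
    then have "e ^ k * (1 - p) ^ (m - k) \<le> e ^ k * e ^ (m - k)"
      using e assms by (intro mult_left_mono power_mono) auto
    also have "\<dots> = e ^ m"
      using \<open>k \<in> _\<close> by (simp flip: power_add)
    finally show "e ^ k * (1 - p) ^ (m - k) \<le> e ^ m" .
  qed (use e in auto)
  also have "\<dots> \<le> p\<^sup>2 * (real n * e ^ m)"
    using e2 e m by (simp add: mult_right_mono)
  finally have *: "e ^ n - (1 - p) ^ n \<le> real n * (p\<^sup>2 * e ^ m)"
    by (simp add: mult_ac)
  \<comment> \<open>The estimate y^2 / 2 \<le> exp y at y = m p absorbs the factor p^2 into
    \<open>e ^ m\<close> and leaves 2 / m^2.\<close>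
  have "(real m * p)\<^sup>2 / 2 \<le> exp (real m * p)"
    using exp_lower_Taylor_quadratic[of "real m * p"] assms by (smt (verit) mult_nonneg_nonneg of_nat_0_le_iff)
  then have "(real m * p)\<^sup>2 / 2 * exp (- (real m * p)) \<le> exp (real m * p) * exp (- (real m * p))"
    by (intro mult_right_mono) auto
  then have "(real m * p)\<^sup>2 / 2 * exp (- (real m * p)) \<le> 1"
    by (simp flip: exp_add)
  then have "p\<^sup>2 * e ^ m \<le> 2 / (real m)\<^sup>2"
    using m by (simp add: e_def power_mult_distrib field_simps flip: exp_of_nat_mult)
  then have "real n * (p\<^sup>2 * e ^ m) \<le> real n * (2 / (real m)\<^sup>2)"
    by (intro mult_left_mono) auto
  moreover have "real n * (2 / (real m)\<^sup>2) = 2 * real n / (real n - 1)\<^sup>2"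
    using m by simp
  moreover have "e ^ n = exp (- (real n * p))"
    by (simp add: e_def flip: exp_of_nat_mult)
  ultimately show ?thesis
    using * by linarith
qed

section \<open>Local averages of a probability density\<close>

lemma
  fixes f :: "'a::euclidean_space \<Rightarrow> real"
  assumes "integrable lborel f"
  shows integrable_lborel_translate: "integrable lborel (\<lambda>x. f (x + z))"
    and integral_lborel_translate: "(\<integral>x. f (x + z) \<partial>lborel) = (\<integral>x. f x \<partial>lborel)"
proof -
  have [measurable]: "f \<in> borel_measurable borel"
    using assms by auto
  have *: "distr lborel borel (\<lambda>x. x + z) = (lborel :: 'a measure)"
    using lborel_distr_plus[of z] by (simp add: add.commute[of _ z])
  have "integrable (distr lborel borel (\<lambda>x. x + z)) f"
    using assms * by simp
  then show "integrable lborel (\<lambda>x. f (x + z))"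
    by (subst (asm) integrable_distr_eq) auto
  have "(\<integral>x. f (x + z) \<partial>lborel) = (\<integral>x. f x \<partial>distr lborel borel (\<lambda>x. x + z))"
    by (subst integral_distr) auto
  then show "(\<integral>x. f (x + z) \<partial>lborel) = (\<integral>x. f x \<partial>lborel)"
    using * by simp
qed

section \<open>Continuity of translations in L1\<close>

text \<open>Compactness of \<open>K\<close>, not just closedness, gives it a positive distance from
  the complement of \<open>U\<close>. It is reached by intersecting a closed inner approximation
  with a large ball; the three errors take \<open>e / 3\<close> each.\<close>

lemma sets_lborel_compact_open_approx:
  fixes A :: "'a::euclidean_space set"
  assumes A: "A \<in> sets borel" "emeasure lborel A < \<infinity>" and "e > 0"
  obtains K U where "compact K" "open U" "K \<subseteq> A" "A \<subseteq> U"
    "emeasure lborel (U - K) < \<infinity>" "measure lborel (U - K) < e"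
proof -
  have A': "A \<in> sets lebesgue" "0 < e / 3"
    using A \<open>e > 0\<close> by auto
  obtain U where U: "open U" "A \<subseteq> U" "emeasure lebesgue (U - A) < ennreal (e / 3)"
    by (rule sets_lebesgue_outer_open[OF A']) (use that in blast)
  obtain C where C: "closed C" "C \<subseteq> A" "emeasure lebesgue (A - C) < ennreal (e / 3)"
    by (rule sets_lebesgue_inner_closed[OF A']) (use that in blast)
  have [measurable]: "A \<in> sets borel" "U \<in> sets borel" "C \<in> sets borel"
    using A U C by auto
  have fin: "emeasure lborel (A - B) \<noteq> \<infinity>" for B
    using emeasure_mono[of "A - B" A lborel] A by auto
  have "(\<lambda>n. emeasure lborel (C - cball 0 (real n))) \<longlonglongrightarrow> emeasure lborel (\<Inter>n. C - cball 0 (real n))"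
  proof (rule Lim_emeasure_decseq)
    show "decseq (\<lambda>n. C - cball 0 (real n))"
      by (auto simp: decseq_def)
    show "emeasure lborel (C - cball 0 (real n)) \<noteq> \<infinity>" for n
    proof -
      have "emeasure lborel (C - cball 0 (real n)) \<le> emeasure lborel A"
        using C by (intro emeasure_mono) auto
      then show ?thesis
        using A by (auto simp: top_unique)
    qed
  qed auto
  moreover have "(\<Inter>n. C - cball 0 (real n)) = {}"
  proof (rule equals0I)
    fix x assume x: "x \<in> (\<Inter>n. C - cball 0 (real n))"
    obtain n where "norm x \<le> real n"
      using real_arch_simple by blast
    then show False
      using x by auto
  qed
  ultimately have "(\<lambda>n. emeasure lborel (C - cball 0 (real n))) \<longlonglongrightarrow> 0"
    by (metis emeasure_empty)
  then have "eventually (\<lambda>n. emeasure lborel (C - cball 0 (real n)) < ennreal (e / 3)) sequentially"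
    using \<open>e > 0\<close> by (intro order_tendstoD) auto
  then obtain n where n: "emeasure lborel (C - cball 0 (real n)) < ennreal (e / 3)"
    by (auto simp: eventually_sequentially)
  define K where "K = C \<inter> cball 0 (real n)"
  have [measurable]: "K \<in> sets borel"
    by (auto simp: K_def)
  have "emeasure lborel (U - K) \<le> emeasure lborel ((U - A) \<union> (A - C) \<union> (C - cball 0 (real n)))"
    by (intro emeasure_mono) (auto simp: K_def)
  also have "\<dots> \<le> emeasure lborel (U - A) + emeasure lborel (A - C) + emeasure lborel (C - cball 0 (real n))"
    by (intro order_trans[OF emeasure_subadditive] add_mono order_refl) auto
  also have "\<dots> < ennreal (e / 3) + ennreal (e / 3) + ennreal (e / 3)"
    using U C n by (intro add_strict_mono) (auto simp: emeasure_completion)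
  also have "\<dots> = ennreal e"
    using \<open>e > 0\<close> by (simp flip: ennreal_plus)
  finally have *: "emeasure lborel (U - K) < ennreal e" .
  show ?thesis
  proof
    show "emeasure lborel (U - K) < \<infinity>"
      using * ennreal_less_top[of e] by (auto intro: less_trans)
    then have "emeasure lborel (U - K) = ennreal (measure lborel (U - K))"
      by (intro emeasure_eq_ennreal_measure) auto
    then show "measure lborel (U - K) < e"
      using * by (simp add: ennreal_less_iff)
  qed (use U C in \<open>auto simp: K_def\<close>)
qed

lemma L1_translation_continuous:
  fixes f :: "'a::euclidean_space \<Rightarrow> real"
  assumes "integrable lborel f" "e > 0"
  shows "\<exists>\<delta>>0. \<forall>z. norm z < \<delta> \<longrightarrow> (\<integral>x. \<bar>f (x + z) - f x\<bar> \<partial>lborel) < e"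
  using assms
proof (induction arbitrary: e rule: integrable_induct)
  case (base A c)
  have [measurable]: "A \<in> sets borel"
    using base by simp
  \<comment> \<open>The set \<open>U - K\<close> and its translate each contribute once, hence the
    2; the + 1 covers c = 0.\<close>
  define e' where "e' = e / (2 * (\<bar>c\<bar> + 1))"
  have "e' > 0"
    using base by (simp add: e'_def)
  obtain K U where KU: "compact K" "open U" "K \<subseteq> A" "A \<subseteq> U"
    "emeasure lborel (U - K) < \<infinity>" "measure lborel (U - K) < e'"
    by (rule sets_lborel_compact_open_approx[OF _ _ \<open>e' > 0\<close>, of A]) (use base that in auto)
  have [measurable]: "K \<in> sets borel" "U \<in> sets borel"
    using KU by (auto intro: borel_compact)
  obtain \<delta> where \<delta>: "\<delta> > 0" "\<And>x y. x \<in> K \<Longrightarrow> y \<in> - U \<Longrightarrow> \<delta> \<le> dist x y"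
    using separate_compact_closed[of K "- U"] KU by blast
  let ?g = "indicator (U - K) :: 'a \<Rightarrow> real"
  have int: "integrable lborel ?g"
    using KU by (intro integrable_real_indicator) auto
  have "(\<integral>x. \<bar>indicator A (x + z) *\<^sub>R c - indicator A x *\<^sub>R c\<bar> \<partial>lborel) < e" if z: "norm z < \<delta>" for z
  proof -
    \<comment> \<open>If exactly one of x and x + z lies in \<open>A\<close>, then for |z| <
      \<delta> at least one of them lies in \<open>U - K\<close>: a point of \<open>K\<close> cannot
      be moved out of \<open>U\<close>.\<close>
    have le: "\<bar>indicator A (x + z) *\<^sub>R c - indicator A x *\<^sub>R c\<bar> \<le> \<bar>c\<bar> * (?g (x + z) + ?g x)" for x
    proof (cases "x + z \<in> A \<longleftrightarrow> x \<in> A")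
      case False
      have "x \<in> K \<Longrightarrow> x + z \<in> U" "x + z \<in> K \<Longrightarrow> x \<in> U"
        using \<delta>(2)[of x "x + z"] \<delta>(2)[of "x + z" x] z by (auto simp: dist_norm)
      then have "x \<in> U - K \<or> x + z \<in> U - K"
        using False KU by blast
      then have "1 \<le> ?g (x + z) + ?g x"
        by (auto simp: indicator_def)
      then have "\<bar>c\<bar> * 1 \<le> \<bar>c\<bar> * (?g (x + z) + ?g x)"
        by (intro mult_left_mono) auto
      then show ?thesis
        using False by (auto simp: indicator_def)
    qed (auto simp: indicator_def)
    have "(\<integral>x. \<bar>indicator A (x + z) *\<^sub>R c - indicator A x *\<^sub>R c\<bar> \<partial>lborel)
        \<le> (\<integral>x. \<bar>c\<bar> * (?g (x + z) + ?g x) \<partial>lborel)"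
    proof (intro integral_mono le)
      show "integrable lborel (\<lambda>x. \<bar>c\<bar> * (?g (x + z) + ?g x))"
        using int by (intro integrable_mult_right Bochner_Integration.integrable_add integrable_lborel_translate)
      then show "integrable lborel (\<lambda>x. \<bar>indicator A (x + z) *\<^sub>R c - indicator A x *\<^sub>R c\<bar>)"
        by (rule Bochner_Integration.integrable_bound) (use le in \<open>auto intro!: order_trans[OF le]\<close>)
    qed
    also have "\<dots> = 2 * \<bar>c\<bar> * measure lborel (U - K)"
      using int by (simp add: Bochner_Integration.integral_add integrable_lborel_translate integral_lborel_translate)
    also have "\<dots> \<le> 2 * \<bar>c\<bar> * e'"
      using KU by (intro mult_left_mono) auto
    also have "\<dots> < e"
      using base by (simp add: e'_def field_simps)
    finally show ?thesis .
  qed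
  then show ?case
    using \<delta> by blast
next
  case (add f g)
  obtain a where a: "a > 0" "\<And>z. norm z < a \<Longrightarrow> (\<integral>x. \<bar>f (x + z) - f x\<bar> \<partial>lborel) < e / 2"
    using add.IH(1)[of "e / 2"] add.prems by auto
  obtain b where b: "b > 0" "\<And>z. norm z < b \<Longrightarrow> (\<integral>x. \<bar>g (x + z) - g x\<bar> \<partial>lborel) < e / 2"
    using add.IH(2)[of "e / 2"] add.prems by auto
  have "(\<integral>x. \<bar>f (x + z) + g (x + z) - (f x + g x)\<bar> \<partial>lborel) < e" if "norm z < min a b" for z
  proof -
    have i: "integrable lborel (\<lambda>x. \<bar>f (x + z) - f x\<bar>)" "integrable lborel (\<lambda>x. \<bar>g (x + z) - g x\<bar>)"
      "integrable lborel (\<lambda>x. \<bar>f (x + z) + g (x + z) - (f x + g x)\<bar>)"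
      using add.hyps by (intro integrable_abs Bochner_Integration.integrable_diff
        Bochner_Integration.integrable_add integrable_lborel_translate; simp)+
    have "(\<integral>x. \<bar>f (x + z) + g (x + z) - (f x + g x)\<bar> \<partial>lborel)
        \<le> (\<integral>x. \<bar>f (x + z) - f x\<bar> + \<bar>g (x + z) - g x\<bar> \<partial>lborel)"
      using i by (intro integral_mono Bochner_Integration.integrable_add) auto
    also have "\<dots> = (\<integral>x. \<bar>f (x + z) - f x\<bar> \<partial>lborel) + (\<integral>x. \<bar>g (x + z) - g x\<bar> \<partial>lborel)"
      using i by simp
    also have "\<dots> < e"
      using a(2)[of z] b(2)[of z] that by auto
    finally show ?thesis .
  qed
  moreover have "min a b > 0"
    using a b by simp
  ultimately show ?case
    by blast
next
  case (lim f s)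
  note int = lim.hyps(1) lim.hyps(4)
  have [measurable]: "f \<in> borel_measurable borel" "s i \<in> borel_measurable borel" for i
    using int by auto
  have "(\<lambda>i. \<integral>x. \<bar>s i x - f x\<bar> \<partial>lborel) \<longlonglongrightarrow> (\<integral>x. 0 \<partial>(lborel :: 'a measure))"
  proof (rule integral_dominated_convergence[where w = "\<lambda>x. 3 * \<bar>f x\<bar>"])
    show "AE x in lborel. (\<lambda>i. \<bar>s i x - f x\<bar>) \<longlonglongrightarrow> 0"
    proof (intro AE_I2)
      fix x :: 'a
      show "(\<lambda>i. \<bar>s i x - f x\<bar>) \<longlonglongrightarrow> 0"
        using lim.hyps(2)[of x] by (subst tendsto_rabs_zero_iff) (simp add: LIM_zero)
    qed
    \<comment> \<open>The approximating functions satisfy |s i| \<le> 2 |f|, which gives the factor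
      3.\<close>
    show "AE x in lborel. norm \<bar>s i x - f x\<bar> \<le> 3 * \<bar>f x\<bar>" for i
      using lim.hyps(3)[of _ i] by (intro AE_I2) (smt (verit) real_norm_def space_lborel space_borel UNIV_I)
  qed (use int in auto)
  then have "eventually (\<lambda>i. (\<integral>x. \<bar>s i x - f x\<bar> \<partial>lborel) < e / 3) sequentially"
    using lim.prems by (intro order_tendstoD) auto
  then obtain i where i: "(\<integral>x. \<bar>s i x - f x\<bar> \<partial>lborel) < e / 3"
    by (auto simp: eventually_sequentially)
  obtain a where a: "a > 0" "\<And>z. norm z < a \<Longrightarrow> (\<integral>x. \<bar>s i (x + z) - s i x\<bar> \<partial>lborel) < e / 3"
    using lim.IH[of "e / 3" i] lim.prems by auto
  have "(\<integral>x. \<bar>f (x + z) - f x\<bar> \<partial>lborel) < e" if "norm z < a" for z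
  proof -
    let ?d = "\<lambda>x. \<bar>s i x - f x\<bar>"
    have d: "integrable lborel ?d" "integrable lborel (\<lambda>x. ?d (x + z))"
      using int by (auto intro!: integrable_lborel_translate[of ?d])
    have j: "integrable lborel (\<lambda>x. \<bar>s i (x + z) - s i x\<bar>)" "integrable lborel (\<lambda>x. \<bar>f (x + z) - f x\<bar>)"
      using int by (intro integrable_abs Bochner_Integration.integrable_diff integrable_lborel_translate; simp)+
    have "(\<integral>x. \<bar>f (x + z) - f x\<bar> \<partial>lborel)
        \<le> (\<integral>x. (?d (x + z) + ?d x) + \<bar>s i (x + z) - s i x\<bar> \<partial>lborel)"
      using d j by (intro integral_mono Bochner_Integration.integrable_add) auto
    also have "\<dots> = 2 * (\<integral>x. ?d x \<partial>lborel) + (\<integral>x. \<bar>s i (x + z) - s i x\<bar> \<partial>lborel)"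
      using d j integral_lborel_translate[OF d(1), of z] by simp
    also have "\<dots> < e"
      using i a(2)[OF that] by simp
    finally show ?thesis .
  qed
  then show ?case
    using a by blast
qed

section \<open>Averages of the density over small balls\<close>

locale lebesgue_prob_density =
  fixes f :: "'a::euclidean_space \<Rightarrow> real"
  assumes f_measurable [measurable]: "f \<in> borel_measurable borel"
    and f_nonneg: "\<And>x. 0 \<le> f x"
    and nn_integral_f: "(\<integral>\<^sup>+x. ennreal (f x) \<partial>lborel) = 1"
begin

definition law :: "'a measure" where
  "law = density lborel (\<lambda>x. ennreal (f x))"

definition ball_prob :: "'a \<Rightarrow> real \<Rightarrow> real" where
  "ball_prob x r = measure law (cball x r)"

definition ball_vol :: "real \<Rightarrow> real" where
  "ball_vol r = unit_ball_vol DIM('a) * r ^ DIM('a)"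

definition ball_avg :: "'a \<Rightarrow> real \<Rightarrow> real" where
  "ball_avg x r = ball_prob x r / ball_vol r"

lemma sets_law [simp, measurable_cong]: "sets law = sets borel"
  and space_law [simp]: "space law = UNIV"
  by (auto simp: law_def)

sublocale law: prob_space law
  by (rule prob_spaceI) (simp add: law_def emeasure_density nn_integral_f)

lemma integrable_f: "integrable lborel f"
  by (rule integrableI_nonneg) (auto simp: f_nonneg nn_integral_f)

lemma integral_law: "g \<in> borel_measurable borel \<Longrightarrow> (\<integral>x. g x \<partial>law) = (\<integral>x. f x * g x \<partial>lborel)"
  for g :: "'a \<Rightarrow> real"
  unfolding law_def by (subst integral_density) (auto simp: f_nonneg)

lemma nn_integral_law:
  "g \<in> borel_measurable borel \<Longrightarrow> (\<integral>\<^sup>+x. g x \<partial>law) = (\<integral>\<^sup>+x. g x * ennreal (f x) \<partial>lborel)"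
  unfolding law_def by (subst nn_integral_density) (auto simp: f_nonneg mult.commute)

lemma ball_prob_bounds: "0 \<le> ball_prob x r" "ball_prob x r \<le> 1"
  by (auto simp: ball_prob_def)

lemma emeasure_law_cball: "emeasure law (cball x r) = (\<integral>\<^sup>+y\<in>cball x r. ennreal (f y) \<partial>lborel)"
  unfolding law_def by (subst emeasure_density) auto

lemma ball_prob_eq: "ball_prob x r = (\<integral>y. (if dist x y \<le> r then f y else 0) \<partial>lborel)"
proof -
  have "ball_prob x r = (\<integral>y. indicator (cball x r) y \<partial>law)"
    by (simp add: ball_prob_def)
  also have "\<dots> = (\<integral>y. f y * indicator (cball x r) y \<partial>lborel)"
    by (intro integral_law borel_measurable_indicator) simp
  also have "\<dots> = (\<integral>y. (if dist x y \<le> r then f y else 0) \<partial>lborel)"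
    by (intro Bochner_Integration.integral_cong) (auto simp: indicator_def)
  finally show ?thesis .
qed

lemma ball_prob_measurable [measurable]: "(\<lambda>x. ball_prob x r) \<in> borel_measurable borel"
  unfolding ball_prob_eq by measurable

lemma ball_avg_measurable [measurable]: "(\<lambda>x. ball_avg x r) \<in> borel_measurable borel"
  unfolding ball_avg_def by measurable

lemma ball_vol_pos [simp]: "r > 0 \<Longrightarrow> ball_vol r > 0"
  by (simp add: ball_vol_def)

lemma ball_avg_nonneg: "r > 0 \<Longrightarrow> 0 \<le> ball_avg x r"
  by (simp add: ball_avg_def ball_prob_bounds less_imp_le)

text \<open>Both terms are averages over shifts z in the fixed ball about 0. The dependence on x
  then sits only in the translate of \<open>f\<close>, so integrating over x and exchanging
  integrals produces the L1 modulus of continuity of translations.\<close>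

lemma ball_avg_diff_le:
  assumes "r > 0"
  shows "ennreal \<bar>ball_avg x r - f x\<bar> \<le>
    (\<integral>\<^sup>+z. ennreal (indicator (cball 0 r) z / ball_vol r * \<bar>f (x + z) - f x\<bar>) \<partial>lborel)"
proof -
  let ?g = "\<lambda>z. indicator (cball 0 r) z / ball_vol r * f (z + x)"
  let ?c = "\<lambda>z::'a. indicator (cball 0 r) z / ball_vol r * f x"
  have v: "ball_vol r > 0"
    using assms by simp
  have "measure lborel (cball (0::'a) r) = ball_vol r"
    using assms by (simp add: content_cball ball_vol_def)
  then have 2: "f x = (\<integral>z. ?c z \<partial>lborel)"
    using v by simp
  have int_c: "integrable lborel (\<lambda>z::'a. indicator (cball 0 r) z :: real)"
    by (intro integrable_real_indicator emeasure_bounded_finite) auto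
  have int1: "integrable lborel ?g"
    by (rule Bochner_Integration.integrable_bound[OF integrable_mult_right[OF integrable_lborel_translate[OF integrable_f, of x], of "1 / ball_vol r"]])
       (use assms in \<open>auto simp: indicator_def f_nonneg\<close>)
  have int2: "integrable lborel ?c"
    using int_c by (intro integrable_mult_left integrable_divide_zero) auto
  have "ball_prob x r = (\<integral>z. (if dist x (z + x) \<le> r then f (z + x) else 0) \<partial>lborel)"
    unfolding ball_prob_eq
    by (intro integral_lborel_translate[symmetric] Bochner_Integration.integrable_bound[OF integrable_f])
       (auto simp: f_nonneg)
  also have "\<dots> = (\<integral>z. ball_vol r * ?g z \<partial>lborel)"
    using v by (intro Bochner_Integration.integral_cong) (auto simp: indicator_def dist_norm)
  also have "\<dots> = ball_vol r * (\<integral>z. ?g z \<partial>lborel)"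
    by simp
  finally have 1: "ball_avg x r = (\<integral>z. ?g z \<partial>lborel)"
    using assms ball_vol_pos[of r] by (simp add: ball_avg_def)
  have "ball_avg x r - f x = (\<integral>z. ?g z \<partial>lborel) - (\<integral>z. ?c z \<partial>lborel)"
    using 1 2 by linarith
  also have "\<dots> = (\<integral>z. ?g z - ?c z \<partial>lborel)"
    by (rule Bochner_Integration.integral_diff[symmetric, OF int1 int2])
  finally have "ennreal \<bar>ball_avg x r - f x\<bar> = ennreal (norm (\<integral>z. ?g z - ?c z \<partial>lborel))"
    by simp
  also have "\<dots> \<le> (\<integral>\<^sup>+z. norm (?g z - ?c z) \<partial>lborel)"
    using int1 int2 by (intro integral_norm_bound_ennreal) auto
  also have "\<dots> = (\<integral>\<^sup>+z. ennreal (indicator (cball 0 r) z / ball_vol r * \<bar>f (x + z) - f x\<bar>) \<partial>lborel)"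
    using v by (intro nn_integral_cong) (auto simp: indicator_def add.commute simp flip: diff_divide_distrib)
  finally show ?thesis .
qed

lemma ball_avg_L1_tendsto:
  assumes r: "r \<longlonglongrightarrow> 0" "\<And>n. r n > 0"
  shows "(\<lambda>n. \<integral>\<^sup>+x. ennreal \<bar>ball_avg x (r n) - f x\<bar> \<partial>lborel) \<longlonglongrightarrow> 0"
proof (rule order_tendstoI)
  \<comment> \<open>Here \<open>e\<close> may be \<infinity>, while continuity of translations
    speaks of reals; a positive real \<open>e'\<close> below \<open>e\<close> replaces it.\<close>
  fix e :: ennreal assume "e > 0"
  obtain y where y: "0 < y" "y < e"
    using dense[OF \<open>e > 0\<close>] by auto
  obtain e' where e'_def: "y = ennreal e'" "0 \<le> e'"
    using y by (cases y) auto
  have e': "e' > 0" "ennreal e' < e"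
    using y e'_def by auto
  obtain \<delta> where \<delta>: "\<delta> > 0" "\<And>z. norm z < \<delta> \<Longrightarrow> (\<integral>x. \<bar>f (x + z) - f x\<bar> \<partial>lborel) < e'"
    using L1_translation_continuous[OF integrable_f e'(1)] by blast
  have "eventually (\<lambda>n. r n < \<delta>) sequentially"
    using r \<delta> by (intro order_tendstoD) auto
  then show "eventually (\<lambda>n. (\<integral>\<^sup>+x. ennreal \<bar>ball_avg x (r n) - f x\<bar> \<partial>lborel) < e) sequentially"
  proof eventually_elim
    case (elim n)
    let ?v = "ball_vol (r n)"
    have "?v > 0"
      using r(2) by simp
    have [measurable]: "cball (0::'a) (r n) \<in> sets borel"
      by simp
    have "(\<integral>\<^sup>+x. ennreal \<bar>ball_avg x (r n) - f x\<bar> \<partial>lborel)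
        \<le> (\<integral>\<^sup>+x. (\<integral>\<^sup>+z. ennreal (indicator (cball 0 (r n)) z / ?v * \<bar>f (x + z) - f x\<bar>) \<partial>lborel) \<partial>lborel)"
      using r(2) by (intro nn_integral_mono ball_avg_diff_le)
    also have "\<dots> = (\<integral>\<^sup>+z. (\<integral>\<^sup>+x. ennreal (indicator (cball 0 (r n)) z / ?v * \<bar>f (x + z) - f x\<bar>) \<partial>lborel) \<partial>lborel)"
      by (rule lborel_pair.Fubini') measurable
    also have "\<dots> \<le> (\<integral>\<^sup>+z. ennreal (e' / ?v) * indicator (cball (0::'a) (r n)) z \<partial>lborel)"
    proof (intro nn_integral_mono)
      fix z :: 'a
      show "(\<integral>\<^sup>+x. ennreal (indicator (cball 0 (r n)) z / ?v * \<bar>f (x + z) - f x\<bar>) \<partial>lborel)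
          \<le> ennreal (e' / ?v) * indicator (cball 0 (r n)) z"
      proof (cases "z \<in> cball 0 (r n)")
        case True
        have i: "integrable lborel (\<lambda>x. \<bar>f (x + z) - f x\<bar>)"
          using integrable_f by (intro integrable_abs Bochner_Integration.integrable_diff integrable_lborel_translate)
        have "(\<integral>\<^sup>+x. ennreal (1 / ?v * \<bar>f (x + z) - f x\<bar>) \<partial>lborel) = ennreal (\<integral>x. 1 / ?v * \<bar>f (x + z) - f x\<bar> \<partial>lborel)"
          using i \<open>?v > 0\<close> by (intro nn_integral_eq_integral integrable_mult_right) auto
        also have "\<dots> \<le> ennreal (e' / ?v)"
          using \<delta>(2)[of z] True elim \<open>?v > 0\<close> by (intro ennreal_leI) (auto simp: divide_simps)
        finally show ?thesis
          using True by (simp add: indicator_def)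
      qed auto
    qed
    also have "\<dots> = ennreal (e' / ?v) * ennreal ?v"
      using r(2)[of n] by (subst nn_integral_cmult_indicator) (auto simp: emeasure_cball ball_vol_def)
    also have "\<dots> = ennreal e'"
      using \<open>?v > 0\<close> e' by (simp flip: ennreal_mult)
    also have "\<dots> < e" by fact
    finally show ?case .
  qed
qed auto

end

section \<open>Elementary inequalities for exponentials, fractional powers and logarithms\<close>

text \<open>The bound 1 serves where the density is large, the Lipschitz bound where it is
  not.\<close>

lemma abs_exp_minus_diff_le:
  fixes a b :: real
  assumes "0 \<le> a" "0 \<le> b"
  shows "\<bar>exp (- a) - exp (- b)\<bar> \<le> min 1 \<bar>a - b\<bar>"
proof -
  have *: "exp (- a) - exp (- b) \<le> min 1 (b - a)" if "0 \<le> a" "a \<le> b" for a b :: real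
  proof -
    have "1 + (a - b) \<le> exp (a - b)" by (rule exp_ge_add_one_self)
    then have "exp (- a) * (1 - exp (a - b)) \<le> 1 * (b - a)"
      using that by (intro mult_mono) (simp, linarith, simp_all)
    moreover have "exp (- a) * (1 - exp (a - b)) = exp (- a) - exp (- b)"
      by (simp add: right_diff_distrib flip: exp_add)
    moreover have "exp (- a) - exp (- b) \<le> 1"
      using that exp_gt_zero[of "- b"] exp_le_one_iff[of "- a"] by linarith
    ultimately show ?thesis by auto
  qed
  show ?thesis
    using *[of a b] *[of b a] assms by (cases "a \<le> b") (auto simp: min_def abs_if split: if_splits)
qed

text \<open>Weakens the Bernoulli bound on an occupation probability to a fractional power, whose
  integral \<open>Q_functional\<close> controls; \<open>exp_minus_le_powr\<close> is the counterpart
  for vacancies and \<open>T_functional\<close>.\<close>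

lemma min_one_le_powr:
  fixes w \<delta> :: real
  assumes "0 \<le> w" "0 < \<delta>" "\<delta> \<le> 1"
  shows "min 1 w \<le> w powr \<delta>"
proof (cases "w = 0")
  case False
  then have "w powr 1 \<le> w powr \<delta>" if "w \<le> 1"
    using that assms by (intro powr_mono') auto
  moreover have "w powr 0 \<le> w powr \<delta>" if "1 \<le> w"
    using that assms by (intro powr_mono) auto
  ultimately show ?thesis
    using assms False by (cases "w \<le> 1") auto
qed auto

lemma exp_minus_le_powr:
  fixes w \<delta> :: real
  assumes "0 < w" "0 < \<delta>" "\<delta> \<le> 1"
  shows "exp (- w) \<le> w powr - \<delta>"
proof (cases "w \<le> 1")
  case True
  have "exp (- w) \<le> 1"
    using assms by simp
  also have "1 = w powr 0"
    using assms by simp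
  also have "\<dots> \<le> w powr - \<delta>"
    using assms True by (intro powr_mono') auto
  finally show ?thesis .
next
  case False
  have "w \<le> exp w"
    using exp_ge_add_one_self[of w] by linarith
  then have "exp (- w) \<le> w powr - 1"
    using assms by (simp add: exp_minus powr_minus le_imp_inverse_le)
  also have "\<dots> \<le> w powr - \<delta>"
    using assms False by (intro powr_mono) auto
  finally show ?thesis .
qed

text \<open>Allows one common small exponent in place of the two given ones. At a = 0 both powers
  are 0 by the convention of \<open>powr\<close>.\<close>

lemma powr_le_one_plus_powr:
  fixes a :: real
  assumes "0 \<le> a" "0 \<le> s" "s \<le> t"
  shows "a powr s \<le> 1 + a powr t" and "a powr - s \<le> 1 + a powr - t"
proof -
  have "a powr s \<le> a powr 0 \<or> a powr s \<le> a powr t" if "a > 0"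
    using that assms powr_mono[of s t a] powr_mono'[of 0 s a] by (cases "a \<le> 1") auto
  moreover have "a powr - s \<le> a powr 0 \<or> a powr - s \<le> a powr - t" if "a > 0"
    using that assms powr_mono[of "-s" 0 a] powr_mono'[of "-t" "-s" a] by (cases "a \<le> 1") auto
  ultimately show "a powr s \<le> 1 + a powr t" "a powr - s \<le> 1 + a powr - t"
    using assms by (cases "a = 0"; force intro: order_trans)+
qed

lemma ennreal_powr_mono: "s \<le> t \<Longrightarrow> 0 \<le> a \<Longrightarrow> ennreal_powr s a \<le> ennreal_powr t a"
  by (cases s; cases t) (auto simp: ennreal_powr_def top_unique intro!: powr_mono2 ennreal_leI)

lemma ennreal_powr_ennreal: "0 \<le> s \<Longrightarrow> ennreal_powr (ennreal s) a = ennreal (s powr a)"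
  by (auto simp: ennreal_powr_def)

lemma ennreal_le_powr: "1 \<le> w \<Longrightarrow> 1 \<le> a \<Longrightarrow> w \<le> ennreal_powr w a"
proof (cases w)
  case (real r)
  assume *: "1 \<le> w" "1 \<le> a"
  then have "1 \<le> r"
    using real by (simp flip: ennreal_1)
  then have "r powr 1 \<le> r powr a"
    using * by (intro powr_mono) auto
  then show ?thesis
    using real \<open>1 \<le> r\<close> by (simp add: ennreal_powr_ennreal ennreal_leI)
qed (simp add: ennreal_powr_def)

text \<open>t ln t dominates t as soon as t \<ge> e, which is the origin of the threshold
  \<open>exp 1\<close>. For x = y the convention \<open>ln 0 = 0\<close> makes the left side 0,
  although \<open>log_dist\<close> is infinite there.\<close>

lemma log_square_le_G_fun:
  "ennreal (if exp 1 \<le> (ln (dist x y))\<^sup>2 then (ln (dist x y))\<^sup>2 else 0) \<le> G_fun ((log_dist x y)\<^sup>2)"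
proof (cases "x = y")
  case True
  then show ?thesis
    by (simp add: G_fun_def log_dist_def power2_eq_square)
next
  case False
  let ?q = "(ln (dist x y))\<^sup>2"
  have sq: "(log_dist x y)\<^sup>2 = ereal ?q"
    using False by (simp add: log_dist_def power2_eq_square)
  show ?thesis
  proof (cases "exp 1 \<le> ?q")
    case True
    have "1 \<le> exp (1::real)"
      by simp
    then have "1 \<le> ?q"
      using True by linarith
    moreover have "1 \<le> ln ?q"
      using True \<open>1 \<le> ?q\<close> by (subst ln_ge_iff) auto
    then have "?q * 1 \<le> ?q * ln ?q"
      by (intro mult_left_mono) auto
    ultimately show ?thesis
      using True by (auto simp: sq G_fun_def intro!: ennreal_leI)
  qed auto
qed

lemma power2_max_ln_divide_le:
  fixes s R :: real
  assumes "0 \<le> s" "0 < R"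
  shows "(max 0 (ln (s / R)))\<^sup>2 \<le> 2 * (ln s)\<^sup>2 + 2 * (ln R)\<^sup>2"
proof (cases "s = 0")
  case False
  have "(max 0 (ln (s / R)))\<^sup>2 \<le> (ln s - ln R)\<^sup>2"
    using assms False by (auto simp: max_def ln_div)
  also have "\<dots> \<le> 2 * (ln s)\<^sup>2 + 2 * (ln R)\<^sup>2"
    using zero_le_power2[of "ln s + ln R"] by (simp add: power2_sum power2_diff)
  finally show ?thesis .
qed auto

section \<open>The Laplace transform of the density as a limit of vacancy probabilities\<close>

context lebesgue_prob_density
begin

lemma I_fun_eq: "r > 0 \<Longrightarrow> I_fun f x r = ennreal (ball_avg x r)"
  using ball_vol_pos[of r]
  by (simp add: I_fun_def ball_avg_def ball_prob_def law.emeasure_eq_measure divide_ennreal ball_vol_def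
      mult.commute flip: emeasure_law_cball)

lemma integrable_law_bounded:
  fixes g :: "'a \<Rightarrow> real"
  assumes "g \<in> borel_measurable borel" "\<And>x. \<bar>g x\<bar> \<le> B"
  shows "integrable law g"
  using assms by (intro law.integrable_const_bound[of _ B]) auto

text \<open>The F of the overview: the Laplace transform of the random variable f(X), where X has
  distribution \<open>law\<close>.\<close>

definition exp_transform :: "real \<Rightarrow> real" where
  "exp_transform u = (\<integral>x. exp (- (u * f x)) \<partial>law)"

lemma integrable_exp_transform: "0 \<le> u \<Longrightarrow> integrable law (\<lambda>x. exp (- (u * f x)))"
  by (rule integrable_law_bounded[of _ 1]) (auto simp: f_nonneg)

lemma exp_transform_bounds:
  assumes "0 \<le> u"
  shows "0 \<le> exp_transform u" "exp_transform u \<le> 1"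
proof -
  show "0 \<le> exp_transform u"
    unfolding exp_transform_def by (intro integral_nonneg_AE) auto
  show "exp_transform u \<le> 1"
    unfolding exp_transform_def using assms integrable_exp_transform[of u]
    by (intro law.integral_le_const) (auto simp: f_nonneg)
qed

lemma exp_transform_measurable [measurable]: "exp_transform \<in> borel_measurable borel"
  unfolding exp_transform_def by measurable

text \<open>The averages converge in L1 for Lebesgue measure, but the integral carries the possibly
  unbounded weight f. The set where f > k has small mass for large k and the difference of
  exponentials is at most 1 there; elsewhere the weight is at most k and the Lipschitz bound
  applies. The coefficient \<open>c n\<close> varies because N - 2 points meet a volume scaled by N
  - 1.\<close>

lemma exp_ball_avg_tendsto:
  fixes c :: "nat \<Rightarrow> real"
  assumes r: "r \<longlonglongrightarrow> 0" "\<And>n. r n > 0"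
    and c: "c \<longlonglongrightarrow> u" "\<And>n. 0 \<le> c n" and "0 \<le> u"
  shows "(\<lambda>n. \<integral>x. exp (- (c n * ball_avg x (r n))) \<partial>law) \<longlonglongrightarrow> exp_transform u"
proof (rule LIMSEQ_I)
  fix e :: real assume "e > 0"
  have "(\<lambda>k. \<integral>x. f x * indicator {x. f x > real k} x \<partial>lborel) \<longlonglongrightarrow> (\<integral>x. 0 \<partial>(lborel :: 'a measure))"
  proof (rule integral_dominated_convergence[where w = f])
    show "AE x in lborel. (\<lambda>k. f x * indicator {x. f x > real k} x) \<longlonglongrightarrow> 0"
    proof (intro AE_I2 tendsto_eventually)
      fix x
      obtain m where "f x \<le> real m"
        using real_arch_simple by blast
      then show "eventually (\<lambda>k. f x * indicator {x. f x > real k} x = 0) sequentially"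
        by (intro eventually_sequentiallyI[of m]) (auto simp: indicator_def)
    qed
  qed (use integrable_f in \<open>auto simp: indicator_def f_nonneg\<close>)
  then have "eventually (\<lambda>k. (\<integral>x. f x * indicator {x. f x > real k} x \<partial>lborel) < e / 2) sequentially"
    using \<open>e > 0\<close> by (intro order_tendstoD) auto
  then obtain k where k: "(\<integral>x. f x * indicator {x. f x > real k} x \<partial>lborel) < e / 2"
    by (auto simp: eventually_sequentially)
  let ?E = "\<lambda>n. \<integral>\<^sup>+x. ennreal \<bar>ball_avg x (r n) - f x\<bar> \<partial>lborel"
  have E: "?E \<longlonglongrightarrow> 0"
    using r by (rule ball_avg_L1_tendsto)
  \<comment> \<open>Only finiteness matters here: it makes \<open>enn2real\<close> faithful and the
    difference integrable.\<close>
  have E': "eventually (\<lambda>n. ?E n < 1) sequentially"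
    using E by (rule order_tendstoD) simp
  have "(\<lambda>n. enn2real (?E n)) \<longlonglongrightarrow> 0"
    using E by (intro tendsto_enn2real) simp_all
  then have "(\<lambda>n. real k * (c n * enn2real (?E n) + \<bar>c n - u\<bar>)) \<longlonglongrightarrow> real k * (u * 0 + \<bar>u - u\<bar>)"
    using c(1) by (intro tendsto_mult tendsto_add tendsto_const tendsto_rabs tendsto_diff)
  then have "eventually (\<lambda>n. real k * (c n * enn2real (?E n) + \<bar>c n - u\<bar>) < e / 2) sequentially"
    using \<open>e > 0\<close> by (intro order_tendstoD) auto
  with E' have "eventually (\<lambda>n. norm ((\<integral>x. exp (- (c n * ball_avg x (r n))) \<partial>law) - exp_transform u) < e) sequentially"
  proof eventually_elim
    case (elim n)
    let ?D = "\<lambda>x. \<bar>ball_avg x (r n) - f x\<bar>"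
    let ?h = "\<lambda>x. exp (- (c n * ball_avg x (r n))) - exp (- (u * f x))"
    let ?t = "\<lambda>x. f x * indicator {x. f x > real k} x"
    have D: "integrable lborel ?D"
      using elim by (intro integrableI_bounded) (auto intro: less_trans)
    have D': "enn2real (?E n) = (\<integral>x. ?D x \<partial>lborel)"
      using D by (simp add: nn_integral_eq_integral)
    have t: "integrable lborel ?t"
      by (rule Bochner_Integration.integrable_bound[OF integrable_f]) (auto simp: f_nonneg indicator_def)
    have nn: "0 \<le> c n * ball_avg x (r n)" "0 \<le> u * f x" for x
      using c(2) r(2) \<open>0 \<le> u\<close> by (auto intro!: mult_nonneg_nonneg simp: ball_avg_nonneg f_nonneg)
    have i1: "integrable law (\<lambda>x. exp (- (c n * ball_avg x (r n))))"
      using nn by (intro integrable_law_bounded[of _ 1]) auto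
    have i2: "integrable law (\<lambda>x. exp (- (u * f x)))"
      using \<open>0 \<le> u\<close> by (rule integrable_exp_transform)
    have le: "f x * \<bar>?h x\<bar> \<le> real k * (c n * ?D x + \<bar>c n - u\<bar> * f x) + ?t x" for x
    proof -
      have "\<bar>c n * ball_avg x (r n) - u * f x\<bar> = \<bar>c n * (ball_avg x (r n) - f x) + (c n - u) * f x\<bar>"
        by (simp add: algebra_simps)
      also have "\<dots> \<le> c n * ?D x + \<bar>c n - u\<bar> * f x"
        using c(2)[of n] f_nonneg[of x] by (intro order_trans[OF abs_triangle_ineq]) (simp add: abs_mult)
      finally have h: "\<bar>?h x\<bar> \<le> 1" "\<bar>?h x\<bar> \<le> c n * ?D x + \<bar>c n - u\<bar> * f x"
        using abs_exp_minus_diff_le[OF nn(1)[of x] nn(2)[of x]] by auto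
      have nn': "0 \<le> c n * ?D x + \<bar>c n - u\<bar> * f x"
        using h by linarith
      show ?thesis
      proof (cases "f x > real k")
        case True
        then have "f x * \<bar>?h x\<bar> \<le> ?t x"
          using h(1) f_nonneg[of x] by (simp add: mult_left_le)
        then show ?thesis
          using nn' by (simp add: add_increasing)
      next
        case False
        then have "f x * \<bar>?h x\<bar> \<le> real k * (c n * ?D x + \<bar>c n - u\<bar> * f x)"
          using h(2) f_nonneg[of x] by (intro mult_mono) auto
        then show ?thesis
          using False by simp
      qed
    qed
    have "(\<integral>x. exp (- (c n * ball_avg x (r n))) \<partial>law) - exp_transform u = (\<integral>x. ?h x \<partial>law)"
      unfolding exp_transform_def using i1 i2 by simp
    also have "norm \<dots> \<le> (\<integral>x. \<bar>?h x\<bar> \<partial>law)"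
      using integral_norm_bound[of law ?h] by simp
    also have "\<dots> = (\<integral>x. f x * \<bar>?h x\<bar> \<partial>lborel)"
      by (rule integral_law) measurable
    also have "\<dots> \<le> (\<integral>x. real k * (c n * ?D x + \<bar>c n - u\<bar> * f x) + ?t x \<partial>lborel)"
    proof (rule integral_mono[OF _ _ le])
      show i: "integrable lborel (\<lambda>x. real k * (c n * ?D x + \<bar>c n - u\<bar> * f x) + ?t x)"
        using D t integrable_f by (intro Bochner_Integration.integrable_add integrable_mult_right)
      show "integrable lborel (\<lambda>x. f x * \<bar>?h x\<bar>)"
        by (rule Bochner_Integration.integrable_bound[OF i]) (use le f_nonneg in \<open>auto intro!: order_trans[OF le]\<close>)
    qed
    also have "\<dots> = real k * (c n * (\<integral>x. ?D x \<partial>lborel) + \<bar>c n - u\<bar> * (\<integral>x. f x \<partial>lborel)) + (\<integral>x. ?t x \<partial>lborel)"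
      using D t integrable_f by simp
    also have "(\<integral>x. f x \<partial>lborel) = 1"
      by (subst integral_eq_nn_integral) (auto simp: f_nonneg nn_integral_f)
    finally show ?case
      using elim k D' by simp
  qed
  then show "\<exists>n0. \<forall>n\<ge>n0. norm ((\<integral>x. exp (- (c n * ball_avg x (r n))) \<partial>law) - exp_transform u) < e"
    by (simp add: eventually_sequentially)
qed

definition ball_radius :: "real \<Rightarrow> real" where
  "ball_radius v = (v / unit_ball_vol DIM('a)) powr (1 / DIM('a))"

lemma ball_radius_pos: "v > 0 \<Longrightarrow> ball_radius v > 0"
  by (simp add: ball_radius_def less_imp_neq[symmetric])

lemma ball_vol_ball_radius:
  assumes "v > 0"
  shows "ball_vol (ball_radius v) = v"
proof -
  have "ball_radius v ^ DIM('a) = v / unit_ball_vol DIM('a)"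
    using assms ball_radius_pos[OF assms] unfolding ball_radius_def
    by (subst powr_realpow[symmetric]) (auto simp: powr_powr)
  then show ?thesis
    by (simp add: ball_vol_def less_imp_neq[symmetric])
qed

lemma ball_radius_measurable [measurable]: "ball_radius \<in> borel_measurable borel"
  unfolding ball_radius_def by measurable

lemma ball_vol_less_iff:
  assumes "0 < r" "0 < s"
  shows "ball_vol r < ball_vol s \<longleftrightarrow> r < s"
proof -
  have "s ^ DIM('a) \<le> r ^ DIM('a) \<longleftrightarrow> s \<le> r"
    using assms by (intro power_mono_iff) auto
  moreover have "ball_vol r < ball_vol s \<longleftrightarrow> r ^ DIM('a) < s ^ DIM('a)"
    unfolding ball_vol_def by (rule mult_less_cancel_left_pos) simp
  ultimately show ?thesis
    by linarith
qed

lemma ball_radius_tendsto_0: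
  assumes "v \<longlonglongrightarrow> 0" "\<And>n. 0 \<le> v n"
  shows "(\<lambda>n. ball_radius (v n)) \<longlonglongrightarrow> 0"
proof -
  have "(\<lambda>n. (v n / unit_ball_vol DIM('a)) powr (1 / DIM('a))) \<longlonglongrightarrow> 0 powr (1 / DIM('a))"
    using assms by (intro tendsto_powr' tendsto_divide_zero) auto
  then show ?thesis
    by (simp add: ball_radius_def)
qed

lemma ball_prob_ball_radius: "v > 0 \<Longrightarrow> ball_prob x (ball_radius v) = v * ball_avg x (ball_radius v)"
  by (simp add: ball_avg_def ball_vol_ball_radius)

text \<open>\<open>n\<close> plays the role of \<open>N - 1\<close>, the number of sample points other than \<open>x\<close>.\<close>

lemma vacancy_exp_tendsto:
  assumes "u > 0"
  shows "(\<lambda>n. \<integral>x. exp (- ((real n - 1) * ball_prob x (ball_radius (u / real n)))) \<partial>law) \<longlonglongrightarrow> exp_transform u"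
    and "(\<lambda>n. \<integral>x. (1 - ball_prob x (ball_radius (u / real n))) ^ n \<partial>law) \<longlonglongrightarrow> exp_transform u"
proof -
  \<comment> \<open>The index shift keeps every radius positive; at n = 0 the quotient
    \<open>u / 0 = 0\<close> would give radius 0.\<close>
  define r where "r n = ball_radius (u / real (Suc n))" for n
  have r: "r \<longlonglongrightarrow> 0" "\<And>n. r n > 0"
  proof -
    have "(\<lambda>n. u / real (Suc n)) \<longlonglongrightarrow> 0"
      by real_asymp
    then show "r \<longlonglongrightarrow> 0"
      unfolding r_def using assms by (intro ball_radius_tendsto_0) auto
  qed (use assms in \<open>simp add: r_def ball_radius_pos\<close>)
  have p: "ball_prob x (r n) = u / real (Suc n) * ball_avg x (r n)" for x n
    unfolding r_def using assms by (intro ball_prob_ball_radius) auto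
  \<comment> \<open>After the shift, n points against volume u / (n + 1) give the coefficient u n /
    (n + 1), which still tends to u.\<close>
  have "(\<lambda>n. \<integral>x. exp (- (u * real n / real (Suc n) * ball_avg x (r n))) \<partial>law) \<longlonglongrightarrow> exp_transform u"
  proof (rule exp_ball_avg_tendsto[OF r])
    show "(\<lambda>n. u * real n / real (Suc n)) \<longlonglongrightarrow> u"
      using assms by real_asymp
  qed (use assms in auto)
  moreover have "u * real n / real (Suc n) * ball_avg x (r n) = (real (Suc n) - 1) * ball_prob x (r n)" for n x
    by (simp add: p)
  ultimately show "(\<lambda>n. \<integral>x. exp (- ((real n - 1) * ball_prob x (ball_radius (u / real n)))) \<partial>law) \<longlonglongrightarrow> exp_transform u"
    by (subst filterlim_sequentially_Suc[symmetric]) (simp add: r_def)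
  have lim: "(\<lambda>n. \<integral>x. exp (- (u * ball_avg x (r n))) \<partial>law) \<longlonglongrightarrow> exp_transform u"
    using assms by (intro exp_ball_avg_tendsto[OF r]) auto
  have "(\<lambda>n. \<integral>x. (1 - ball_prob x (r n)) ^ Suc n \<partial>law) \<longlonglongrightarrow> exp_transform u"
  proof (rule tendsto_sandwich)
    have e: "real (Suc n) * ball_prob x (r n) = u * ball_avg x (r n)" for n x
      by (simp add: p)
    have int1: "integrable law (\<lambda>x. exp (- (u * ball_avg x (r n))))" for n
      using assms r by (intro integrable_law_bounded[of _ 1]) (auto simp: ball_avg_nonneg)
    have int2: "integrable law (\<lambda>x. (1 - ball_prob x (r n)) ^ Suc n)" for n
      by (intro integrable_law_bounded[of _ 1])
        (auto simp: ball_prob_bounds power_abs simp del: power_Suc intro!: power_le_one)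
    show "eventually (\<lambda>n. (\<integral>x. (1 - ball_prob x (r n)) ^ Suc n \<partial>law) \<le> (\<integral>x. exp (- (u * ball_avg x (r n))) \<partial>law)) sequentially"
    proof (intro always_eventually allI integral_mono int1 int2)
      fix n x
      have "(1 - ball_prob x (r n)) ^ Suc n \<le> exp (- ball_prob x (r n)) ^ Suc n"
        using exp_ge_add_one_self[of "- ball_prob x (r n)"] ball_prob_bounds[of x "r n"]
        by (intro power_mono) auto
      also have "\<dots> = exp (- (real (Suc n) * ball_prob x (r n)))"
        by (subst exp_of_nat_mult[symmetric]) simp
      finally show "(1 - ball_prob x (r n)) ^ Suc n \<le> exp (- (u * ball_avg x (r n)))"
        by (simp only: e)
    qed
    \<comment> \<open>The error term does not depend on x and \<open>law\<close> has mass one, so it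
      can be taken out of the integral.\<close>
    show "eventually (\<lambda>n. (\<integral>x. exp (- (u * ball_avg x (r n))) \<partial>law) - 2 * real (Suc n) / (real (Suc n) - 1)\<^sup>2
        \<le> (\<integral>x. (1 - ball_prob x (r n)) ^ Suc n \<partial>law)) sequentially"
    proof (intro eventually_sequentiallyI[of 1])
      fix n :: nat assume "1 \<le> n"
      have "(\<integral>x. exp (- (u * ball_avg x (r n))) \<partial>law) - 2 * real (Suc n) / (real (Suc n) - 1)\<^sup>2
          = (\<integral>x. exp (- (u * ball_avg x (r n))) - 2 * real (Suc n) / (real (Suc n) - 1)\<^sup>2 \<partial>law)"
        using int1 by (simp add: law.prob_space[simplified])
      also have "\<dots> \<le> (\<integral>x. (1 - ball_prob x (r n)) ^ Suc n \<partial>law)"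
      proof (intro integral_mono int2)
        fix x
        show "exp (- (u * ball_avg x (r n))) - 2 * real (Suc n) / (real (Suc n) - 1)\<^sup>2 \<le> (1 - ball_prob x (r n)) ^ Suc n"
          using exp_minus_power_diff_bound[of "ball_prob x (r n)" "Suc n"] ball_prob_bounds[of x "r n"] \<open>1 \<le> n\<close>
          by (simp only: e)
      qed (use int1 in auto)
      finally show "(\<integral>x. exp (- (u * ball_avg x (r n))) \<partial>law) - 2 * real (Suc n) / (real (Suc n) - 1)\<^sup>2
        \<le> (\<integral>x. (1 - ball_prob x (r n)) ^ Suc n \<partial>law)" .
    qed
    have "(\<lambda>n. 2 * real (Suc n) / (real (Suc n) - 1)\<^sup>2) \<longlonglongrightarrow> 0"
      by real_asymp
    from tendsto_diff[OF lim this]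
    show "(\<lambda>n. (\<integral>x. exp (- (u * ball_avg x (r n))) \<partial>law) - 2 * real (Suc n) / (real (Suc n) - 1)\<^sup>2) \<longlonglongrightarrow> exp_transform u"
      by simp
  qed (rule lim)
  then show "(\<lambda>n. \<integral>x. (1 - ball_prob x (ball_radius (u / real n))) ^ n \<partial>law) \<longlonglongrightarrow> exp_transform u"
    by (subst filterlim_sequentially_Suc[symmetric]) (simp add: r_def)
qed


section \<open>Tail bounds and the entropy\<close>

lemma nn_integral_ball_avg_powr_le:
  assumes "0 < r" "r \<le> R" "0 < \<epsilon>"
  shows "(\<integral>\<^sup>+x. ennreal (ball_avg x r powr \<epsilon>) \<partial>law) \<le> Q_functional f \<epsilon> R"
proof -
  have "ennreal (ball_avg x r powr \<epsilon>) \<le> ennreal_powr (M_fun f x R) \<epsilon>" for x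
  proof -
    have "ennreal (ball_avg x r) \<le> M_fun f x R"
      unfolding M_fun_def using assms by (intro SUP_upper2[of r]) (auto simp: I_fun_eq)
    then have "ennreal_powr (ennreal (ball_avg x r)) \<epsilon> \<le> ennreal_powr (M_fun f x R) \<epsilon>"
      using assms by (intro ennreal_powr_mono) auto
    then show ?thesis
      using assms by (simp add: ennreal_powr_ennreal ball_avg_nonneg)
  qed
  then show ?thesis
    unfolding Q_functional_def by (subst nn_integral_law) (auto intro!: nn_integral_mono mult_right_mono)
qed

text \<open>Real \<open>powr\<close> sends 0 to 0 even for a negative exponent, so the convention 1
  / 0 = \<infinity> is written out. That infinite value is what later forces ball averages to be
  positive almost everywhere.\<close>

lemma inverse_ball_avg_powr_le:
  assumes "0 < r" "r \<le> R" "0 < \<epsilon>"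
  shows "(if ball_avg x r = 0 then \<infinity> else ennreal (ball_avg x r powr - \<epsilon>)) \<le> 1 / ennreal_powr (m_fun f x R) \<epsilon>"
proof -
  have "m_fun f x R \<le> ennreal (ball_avg x r)"
    unfolding m_fun_def using assms by (intro INF_lower2[of r]) (auto simp: I_fun_eq)
  then have "ennreal_powr (m_fun f x R) \<epsilon> \<le> ennreal_powr (ennreal (ball_avg x r)) \<epsilon>"
    using assms by (intro ennreal_powr_mono) auto
  then have le: "ennreal_powr (m_fun f x R) \<epsilon> \<le> ennreal (ball_avg x r powr \<epsilon>)"
    using assms by (simp add: ennreal_powr_ennreal ball_avg_nonneg)
  have "1 / ennreal (ball_avg x r powr \<epsilon>) \<le> 1 / ennreal_powr (m_fun f x R) \<epsilon>"
  proof (cases "ennreal_powr (m_fun f x R) \<epsilon> = 0")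
    case False
    then obtain b where b: "ennreal_powr (m_fun f x R) \<epsilon> = ennreal b" "0 < b"
      using le by (cases "ennreal_powr (m_fun f x R) \<epsilon>") (auto simp: top_unique less_le)
    then have "0 < b" "b \<le> ball_avg x r powr \<epsilon>"
      using le by auto
    then have "0 < ball_avg x r powr \<epsilon>"
      by linarith
    with \<open>0 < b\<close> \<open>b \<le> _\<close> have "1 / ball_avg x r powr \<epsilon> \<le> 1 / b"
      by (intro divide_left_mono mult_pos_pos) auto
    then show ?thesis
      using b \<open>0 < ball_avg x r powr \<epsilon>\<close> by (simp add: divide_ennreal ennreal_leI flip: ennreal_1)
  qed simp
  moreover have "1 / ennreal (ball_avg x r powr \<epsilon>) = (if ball_avg x r = 0 then \<infinity> else ennreal (ball_avg x r powr - \<epsilon>))"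
    using assms ball_avg_nonneg[of r x]
    by (auto simp: divide_ennreal_def inverse_ennreal powr_minus)
  ultimately show ?thesis
    by simp
qed

lemma nn_integral_ball_avg_powr_minus_le:
  assumes "0 < r" "r \<le> R" "0 < \<epsilon>"
  shows "(\<integral>\<^sup>+x. (if ball_avg x r = 0 then \<infinity> else ennreal (ball_avg x r powr - \<epsilon>)) \<partial>law) \<le> T_functional f \<epsilon> R"
  unfolding T_functional_def using inverse_ball_avg_powr_le[OF assms]
  by (subst nn_integral_law) (auto intro!: nn_integral_mono mult_right_mono)

text \<open>Finiteness of the integral excludes the value \<infinity> almost everywhere, and this
  value is taken exactly where the average vanishes.\<close>

lemma AE_ball_avg_pos:
  assumes "T_functional f \<epsilon> R < \<infinity>" "0 < r" "r \<le> R" "0 < \<epsilon>"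
  shows "AE x in law. 0 < ball_avg x r"
proof -
  have "(\<integral>\<^sup>+x. (if ball_avg x r = 0 then \<infinity> else ennreal (ball_avg x r powr - \<epsilon>)) \<partial>law) \<noteq> \<infinity>"
    using nn_integral_ball_avg_powr_minus_le[OF assms(2-4)] assms(1) by (auto simp: top_unique)
  then have "AE x in law. (if ball_avg x r = 0 then \<infinity> else ennreal (ball_avg x r powr - \<epsilon>)) \<noteq> \<infinity>"
    by (intro nn_integral_noteq_infinite) auto
  then show ?thesis
  proof eventually_elim
    case (elim x)
    then show ?case
      using ball_avg_nonneg[OF assms(2), of x] by (auto simp: less_le split: if_splits)
  qed
qed

lemma integrable_law_one_minus_power: "integrable law (\<lambda>x. (1 - ball_prob x r) ^ n)"
  by (intro integrable_law_bounded[of _ 1])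
    (auto simp: ball_prob_bounds power_abs intro!: power_le_one)

text \<open>Pointwise, 1 - (1 - p)^n \<le> min(1, n p) \<le> (n p)^\<delta>, and n p factors as
  \<open>n * ball_vol r\<close> times \<open>ball_avg x r\<close>. The first factor is deterministic
  and the second is integrated by means of \<open>Q_functional\<close>.\<close>

lemma occupied_prob_le:
  assumes Q: "Q_functional f \<epsilon> R < \<infinity>" and "0 < \<epsilon>" "0 < \<delta>" "\<delta> \<le> 1" "\<delta> \<le> \<epsilon>"
    and r: "0 < r" "r \<le> R"
  shows "1 - (\<integral>x. (1 - ball_prob x r) ^ n \<partial>law)
    \<le> (1 + enn2real (Q_functional f \<epsilon> R)) * (real n * ball_vol r) powr \<delta>"
proof -
  have v: "ball_vol r > 0"
    using r by simp
  have i: "integrable law (\<lambda>x. ball_avg x r powr \<epsilon>)"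
    using nn_integral_ball_avg_powr_le[OF r \<open>0 < \<epsilon>\<close>] Q
    by (intro integrableI_bounded) (auto intro: le_less_trans)
  have *: "(\<integral>x. ball_avg x r powr \<epsilon> \<partial>law) \<le> enn2real (Q_functional f \<epsilon> R)"
    using nn_integral_ball_avg_powr_le[OF r \<open>0 < \<epsilon>\<close>] Q
    by (subst integral_eq_nn_integral) (auto intro!: enn2real_mono)
  have le: "1 - (1 - ball_prob x r) ^ n \<le> (real n * ball_vol r) powr \<delta> * (1 + ball_avg x r powr \<epsilon>)" for x
  proof -
    have "1 + real n * (- ball_prob x r) \<le> (1 + (- ball_prob x r)) ^ n"
      using ball_prob_bounds[of x r] by (intro Bernoulli_inequality) auto
    then have "1 - (1 - ball_prob x r) ^ n \<le> min 1 (real n * ball_prob x r)"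
      using ball_prob_bounds[of x r] by auto
    also have "\<dots> \<le> (real n * ball_prob x r) powr \<delta>"
      using assms ball_prob_bounds[of x r] by (intro min_one_le_powr) auto
    also have "real n * ball_prob x r = (real n * ball_vol r) * ball_avg x r"
      using v by (simp add: ball_avg_def)
    also have "\<dots> powr \<delta> = (real n * ball_vol r) powr \<delta> * ball_avg x r powr \<delta>"
      by (rule powr_mult)
    also have "\<dots> \<le> (real n * ball_vol r) powr \<delta> * (1 + ball_avg x r powr \<epsilon>)"
      using assms ball_avg_nonneg[OF r(1)] by (intro mult_left_mono powr_le_one_plus_powr) auto
    finally show ?thesis .
  qed
  have "1 - (\<integral>x. (1 - ball_prob x r) ^ n \<partial>law) = (\<integral>x. 1 - (1 - ball_prob x r) ^ n \<partial>law)"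
    using integrable_law_one_minus_power[of r n] by (simp add: law.prob_space[simplified])
  also have "\<dots> \<le> (\<integral>x. (real n * ball_vol r) powr \<delta> * (1 + ball_avg x r powr \<epsilon>) \<partial>law)"
    using i integrable_law_one_minus_power by (intro integral_mono le) auto
  also have "\<dots> = (real n * ball_vol r) powr \<delta> * (1 + (\<integral>x. ball_avg x r powr \<epsilon> \<partial>law))"
    using i by (simp add: law.prob_space[simplified])
  also have "\<dots> \<le> (real n * ball_vol r) powr \<delta> * (1 + enn2real (Q_functional f \<epsilon> R))"
    using * by (intro mult_left_mono) auto
  finally show ?thesis
    by (simp add: mult.commute)
qed

text \<open>Here (1 - p)^n \<le> exp(- n p) \<le> (n p)^(-\<delta>), with the same factorisation.
  The pointwise bound can fail where the average is 0, since its \<open>powr\<close> is then 0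
  instead of infinite; hence the comparison almost everywhere.\<close>

lemma vacancy_prob_le:
  assumes T: "T_functional f \<epsilon> R < \<infinity>" and "0 < \<epsilon>" "0 < \<delta>" "\<delta> \<le> 1" "\<delta> \<le> \<epsilon>"
    and r: "0 < r" "r \<le> R" and "n \<ge> 1"
  shows "(\<integral>x. (1 - ball_prob x r) ^ n \<partial>law)
    \<le> (1 + enn2real (T_functional f \<epsilon> R)) * (real n * ball_vol r) powr - \<delta>"
proof -
  have v: "ball_vol r > 0"
    using r by simp
  have "(\<integral>\<^sup>+x. ennreal (ball_avg x r powr - \<epsilon>) \<partial>law)
      \<le> (\<integral>\<^sup>+x. (if ball_avg x r = 0 then \<infinity> else ennreal (ball_avg x r powr - \<epsilon>)) \<partial>law)"
    by (intro nn_integral_mono) auto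
  also have "\<dots> \<le> T_functional f \<epsilon> R"
    by (rule nn_integral_ball_avg_powr_minus_le[OF r \<open>0 < \<epsilon>\<close>])
  finally have nn: "(\<integral>\<^sup>+x. ennreal (ball_avg x r powr - \<epsilon>) \<partial>law) \<le> T_functional f \<epsilon> R" .
  have i: "integrable law (\<lambda>x. ball_avg x r powr - \<epsilon>)"
    using nn T by (intro integrableI_bounded) (auto intro: le_less_trans)
  have *: "(\<integral>x. ball_avg x r powr - \<epsilon> \<partial>law) \<le> enn2real (T_functional f \<epsilon> R)"
    using nn T by (subst integral_eq_nn_integral) (auto intro!: enn2real_mono)
  have le: "(1 - ball_prob x r) ^ n \<le> (real n * ball_vol r) powr - \<delta> * (1 + ball_avg x r powr - \<epsilon>)"
    if pos: "0 < ball_avg x r" for x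
  proof -
    have e: "real n * ball_prob x r = (real n * ball_vol r) * ball_avg x r"
      using v by (simp add: ball_avg_def)
    have "(1 - ball_prob x r) ^ n \<le> exp (- ball_prob x r) ^ n"
      using exp_ge_add_one_self[of "- ball_prob x r"] ball_prob_bounds[of x r]
      by (intro power_mono) auto
    also have "\<dots> = exp (- (real n * ball_prob x r))"
      by (subst exp_of_nat_mult[symmetric]) simp
    also have "\<dots> \<le> (real n * ball_prob x r) powr - \<delta>"
      unfolding e using assms pos v by (intro exp_minus_le_powr) auto
    also have "\<dots> = (real n * ball_vol r) powr - \<delta> * ball_avg x r powr - \<delta>"
      unfolding e by (rule powr_mult)
    also have "\<dots> \<le> (real n * ball_vol r) powr - \<delta> * (1 + ball_avg x r powr - \<epsilon>)"
      using assms ball_avg_nonneg[OF r(1)] by (intro mult_left_mono powr_le_one_plus_powr) auto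
    finally show ?thesis .
  qed
  have "(\<integral>x. (1 - ball_prob x r) ^ n \<partial>law) \<le> (\<integral>x. (real n * ball_vol r) powr - \<delta> * (1 + ball_avg x r powr - \<epsilon>) \<partial>law)"
    using i integrable_law_one_minus_power AE_ball_avg_pos[OF T r \<open>0 < \<epsilon>\<close>] le by (intro integral_mono_AE) auto
  also have "\<dots> = (real n * ball_vol r) powr - \<delta> * (1 + (\<integral>x. ball_avg x r powr - \<epsilon> \<partial>law))"
    using i by (simp add: law.prob_space[simplified])
  also have "\<dots> \<le> (real n * ball_vol r) powr - \<delta> * (1 + enn2real (T_functional f \<epsilon> R))"
    using * by (intro mult_left_mono) auto
  finally show ?thesis
    by (simp add: mult.commute)
qed

text \<open>With radius \<open>ball_radius (u / n)\<close> the quantity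
  \<open>n * ball_vol r\<close> is constantly u, so the finite-sample bounds do not change with n
  and pass to the limit once the radius is below \<open>R\<^sub>1\<close> and
  \<open>R\<^sub>2\<close>.\<close>

lemma exp_transform_tail_bounds:
  assumes Q: "Q_functional f \<epsilon>\<^sub>1 R\<^sub>1 < \<infinity>" "0 < \<epsilon>\<^sub>1" "0 < R\<^sub>1" "\<delta> \<le> \<epsilon>\<^sub>1"
    and T: "T_functional f \<epsilon>\<^sub>2 R\<^sub>2 < \<infinity>" "0 < \<epsilon>\<^sub>2" "0 < R\<^sub>2" "\<delta> \<le> \<epsilon>\<^sub>2"
    and \<delta>: "0 < \<delta>" "\<delta> \<le> 1" and "u > 0"
  shows "1 - exp_transform u \<le> (1 + enn2real (Q_functional f \<epsilon>\<^sub>1 R\<^sub>1)) * u powr \<delta>"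
    and "exp_transform u \<le> (1 + enn2real (T_functional f \<epsilon>\<^sub>2 R\<^sub>2)) * u powr - \<delta>"
proof -
  define r where "r n = ball_radius (u / real n)" for n
  have "(\<lambda>n. u / real n) \<longlonglongrightarrow> 0"
    by real_asymp
  then have r0: "r \<longlonglongrightarrow> 0"
    unfolding r_def using \<open>u > 0\<close> by (intro ball_radius_tendsto_0) auto
  have lim: "(\<lambda>n. \<integral>x. (1 - ball_prob x (r n)) ^ n \<partial>law) \<longlonglongrightarrow> exp_transform u"
    unfolding r_def using \<open>u > 0\<close> by (rule vacancy_exp_tendsto)
  have u: "real n * ball_vol (r n) = u" "r n > 0" if "n \<ge> 1" for n
    using that \<open>u > 0\<close> by (simp_all add: r_def ball_vol_ball_radius ball_radius_pos)
  have ev: "eventually (\<lambda>n. n \<ge> 1 \<and> r n < R\<^sub>1 \<and> r n < R\<^sub>2) sequentially"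
    using order_tendstoD(2)[OF r0, of R\<^sub>1] order_tendstoD(2)[OF r0, of R\<^sub>2] Q T eventually_ge_at_top[of 1]
    by (auto simp: eventually_conj_iff)
  show "1 - exp_transform u \<le> (1 + enn2real (Q_functional f \<epsilon>\<^sub>1 R\<^sub>1)) * u powr \<delta>"
  proof (rule tendsto_upperbound[OF tendsto_diff[OF tendsto_const lim]])
    show "eventually (\<lambda>n. 1 - (\<integral>x. (1 - ball_prob x (r n)) ^ n \<partial>law) \<le> (1 + enn2real (Q_functional f \<epsilon>\<^sub>1 R\<^sub>1)) * u powr \<delta>) sequentially"
      using ev
    proof eventually_elim
      case (elim n)
      show ?case
        using occupied_prob_le[OF Q(1,2) \<delta> Q(4), of "r n" n] elim u[of n] by simp
    qed
  qed simp
  show "exp_transform u \<le> (1 + enn2real (T_functional f \<epsilon>\<^sub>2 R\<^sub>2)) * u powr - \<delta>"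
  proof (rule tendsto_upperbound[OF lim])
    show "eventually (\<lambda>n. (\<integral>x. (1 - ball_prob x (r n)) ^ n \<partial>law) \<le> (1 + enn2real (T_functional f \<epsilon>\<^sub>2 R\<^sub>2)) * u powr - \<delta>) sequentially"
      using ev
    proof eventually_elim
      case (elim n)
      show ?case
        using vacancy_prob_le[OF T(1,2) \<delta> T(4), of "r n" n] elim u[of n] by simp
    qed
  qed simp
qed

text \<open>Fubini for f(x) (exp(- f(x) exp t) - 1[t < 0]): the t-integral is a Gumbel integral with
  a = f(x), and the x-integral is F(exp t) - 1[t < 0]. The assumed decay gives absolute
  convergence.\<close>

lemma shannon_entropy_exp_transform:
  assumes "0 < \<delta>"
    and C: "\<And>t. 0 \<le> t \<Longrightarrow> exp_transform (exp t) \<le> C * exp (- (\<delta> * \<bar>t\<bar>))"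
      "\<And>t. t \<le> 0 \<Longrightarrow> 1 - exp_transform (exp t) \<le> C * exp (- (\<delta> * \<bar>t\<bar>))"
  shows "integrable lborel (\<lambda>x. f x * ln (f x))"
    and "has_bochner_integral lborel (\<lambda>t. exp_transform (exp t) - indicator {..<0} t)
      (shannon_entropy f - euler_mascheroni)"
proof -
  let ?e = "\<lambda>x t::real. exp (- (f x * exp t)) - indicator {..<0} t"
  let ?h = "\<lambda>(x, t). f x * ?e x t"
  have F: "has_bochner_integral lborel (\<lambda>x. f x * exp (- (f x * exp t))) (exp_transform (exp t))" for t
  proof -
    have "integrable lborel (\<lambda>x. f x * exp (- (f x * exp t)))"
      by (rule Bochner_Integration.integrable_bound[OF integrable_f]) (auto simp: f_nonneg mult_left_le)
    moreover have "exp_transform (exp t) = (\<integral>x. f x * exp (- (f x * exp t)) \<partial>lborel)"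
      unfolding exp_transform_def by (subst integral_law) (auto simp: mult.commute)
    ultimately show ?thesis
      by (simp add: has_bochner_integral_iff)
  qed
  have f1: "has_bochner_integral lborel f 1"
    using integrable_f by (simp add: has_bochner_integral_iff)
      (subst integral_eq_nn_integral; simp add: f_nonneg nn_integral_f)
  have G: "has_bochner_integral lborel (\<lambda>x. f x * ?e x t) (exp_transform (exp t) - indicator {..<0} t)" for t
    using has_bochner_integral_diff[OF F[of t] has_bochner_integral_mult_left[OF f1, of "indicator {..<0} t"]]
    by (simp add: right_diff_distrib)
  have meas: "?h \<in> borel_measurable (lborel \<Otimes>\<^sub>M lborel)"
    by measurable
  \<comment> \<open>For fixed t the integrand has the same sign for all x, so the integral of its
    absolute value is exactly 1 - F or F.\<close>
  have hle: "(\<integral>\<^sup>+x. ennreal (norm (?h (x, t))) \<partial>lborel) \<le> ennreal (C * exp (- (\<delta> * \<bar>t\<bar>)))" for t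
  proof (cases "t < 0")
    case True
    have "(\<integral>\<^sup>+x. ennreal (norm (?h (x, t))) \<partial>lborel) = (\<integral>\<^sup>+x. ennreal (- (f x * ?e x t)) \<partial>lborel)"
      using True by (intro nn_integral_cong arg_cong[of _ _ ennreal])
        (simp add: abs_of_nonpos f_nonneg mult_nonneg_nonpos)
    also have "\<dots> = ennreal (1 - exp_transform (exp t))"
      using has_bochner_integral_minus[OF G[of t]] True
      by (subst nn_integral_eq_integral) (auto simp: has_bochner_integral_iff f_nonneg mult_nonneg_nonpos)
    finally show ?thesis
      using C(2)[of t] True by (auto intro!: ennreal_leI)
  next
    case False
    have "(\<integral>\<^sup>+x. ennreal (norm (?h (x, t))) \<partial>lborel) = (\<integral>\<^sup>+x. ennreal (f x * ?e x t) \<partial>lborel)"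
      using False by (intro nn_integral_cong) (auto simp: f_nonneg abs_mult)
    also have "\<dots> = ennreal (exp_transform (exp t))"
      using G[of t] False
      by (subst nn_integral_eq_integral) (auto simp: has_bochner_integral_iff f_nonneg)
    finally show ?thesis
      using C(1)[of t] False by (auto intro!: ennreal_leI)
  qed
  have "(\<integral>\<^sup>+z. ennreal (norm (?h z)) \<partial>(lborel \<Otimes>\<^sub>M lborel))
      = (\<integral>\<^sup>+t. (\<integral>\<^sup>+x. ennreal (norm (?h (x, t))) \<partial>lborel) \<partial>lborel)"
    using meas by (subst lborel_pair.nn_integral_snd[symmetric]) auto
  also have "\<dots> \<le> (\<integral>\<^sup>+t. ennreal (C * exp (- (\<delta> * \<bar>t\<bar>))) \<partial>lborel)"
    by (intro nn_integral_mono hle)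
  also have "\<dots> < \<infinity>"
    using has_bochner_integral_exp_minus_abs[OF \<open>0 < \<delta>\<close>]
    by (subst nn_integral_eq_integral)
      (auto simp: has_bochner_integral_iff intro!: mult_nonneg_nonneg order_trans[OF exp_transform_bounds(1) C(1)[of 0], simplified])
  finally have int: "integrable (lborel \<Otimes>\<^sub>M lborel) ?h"
    using meas by (intro integrableI_bounded) auto
  \<comment> \<open>Where f x = 0 both sides are 0, the right one through
    \<open>0 * ln 0 = 0\<close>; the Gumbel integral is needed only for positive f x.\<close>
  have inner: "(\<integral>t. ?h (x, t) \<partial>lborel) = - euler_mascheroni * f x - f x * ln (f x)" for x
  proof (cases "f x = 0")
    case False
    then have "has_bochner_integral lborel (\<lambda>t. f x * ?e x t) (f x * (- euler_mascheroni - ln (f x)))"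
      using f_nonneg[of x] by (intro has_bochner_integral_mult_right has_bochner_integral_gumbel) auto
    then show ?thesis
      by (simp add: has_bochner_integral_iff algebra_simps)
  qed simp
  have "integrable lborel (\<lambda>x. \<integral>t. ?h (x, t) \<partial>lborel)"
    using int by (rule lborel_pair.integrable_fst')
  then have i1: "integrable lborel (\<lambda>x. - euler_mascheroni * f x - f x * ln (f x))"
    by (simp only: inner)
  from Bochner_Integration.integrable_diff[OF integrable_mult_right[OF integrable_f, of "- euler_mascheroni"] i1]
  show i2: "integrable lborel (\<lambda>x. f x * ln (f x))"
    by (rule back_subst[of "integrable lborel"]) (simp add: fun_eq_iff)
  have "integrable lborel (\<lambda>t. \<integral>x. ?h (x, t) \<partial>lborel)"
    using int lborel_pair.integrable_snd[of "\<lambda>x t. ?h (x, t)"] by simp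
  then have i3: "integrable lborel (\<lambda>t. exp_transform (exp t) - indicator {..<0} t)"
    using G by (simp add: has_bochner_integral_iff)
  have "(\<integral>t. exp_transform (exp t) - indicator {..<0} t \<partial>lborel) = (\<integral>t. (\<integral>x. ?h (x, t) \<partial>lborel) \<partial>lborel)"
    using G by (simp add: has_bochner_integral_iff)
  also have "\<dots> = (\<integral>x. (\<integral>t. ?h (x, t) \<partial>lborel) \<partial>lborel)"
    using int lborel_pair.Fubini_integral[of "\<lambda>x t. ?h (x, t)"] by simp
  also have "\<dots> = (\<integral>x. - euler_mascheroni * f x - f x * ln (f x) \<partial>lborel)"
    by (simp only: inner)
  also have "\<dots> = shannon_entropy f - euler_mascheroni"
    using i2 integrable_f f1 by (simp add: shannon_entropy_def has_bochner_integral_iff)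
  finally show "has_bochner_integral lborel (\<lambda>t. exp_transform (exp t) - indicator {..<0} t)
      (shannon_entropy f - euler_mascheroni)"
    using i3 by (simp add: has_bochner_integral_iff)
qed

end

section \<open>Nearest neighbours in an i.i.d. sample\<close>

context lebesgue_prob_density
begin

lemma law_singleton: "emeasure law {x} = 0"
  unfolding law_def by (subst emeasure_density) (auto simp: nn_integral_0_iff_AE intro!: AE_I'[of "{x}"] split: split_indicator)

lemma ball_prob_tendsto_0:
  assumes "s \<longlonglongrightarrow> 0"
  shows "(\<lambda>n. ball_prob x (s n)) \<longlonglongrightarrow> 0"
proof -
  have "(\<lambda>n. \<integral>y. (indicator (cball x (s n)) y :: real) \<partial>law) \<longlonglongrightarrow> (\<integral>y. 0 \<partial>law)"
  proof (rule integral_dominated_convergence[where w = "\<lambda>_. 1"])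
    have "AE y in law. y \<noteq> x"
      by (rule AE_I'[of "{x}"]) (auto simp: null_sets_def law_singleton)
    then show "AE y in law. (\<lambda>n. indicator (cball x (s n)) y :: real) \<longlonglongrightarrow> 0"
    proof eventually_elim
      case (elim y)
      then have "eventually (\<lambda>n. s n < dist x y) sequentially"
        using assms by (intro order_tendstoD) auto
      then have "eventually (\<lambda>n. (indicator (cball x (s n)) y :: real) = 0) sequentially"
        by eventually_elim auto
      then show ?case
        by (rule tendsto_eventually)
    qed
  qed (auto simp: indicator_def)
  then show ?thesis
    by (simp add: ball_prob_def)
qed

text \<open>The probability that two independent points of this law are within distance s: the price
  of treating the balls about two sample points as disjoint. It vanishes as s tends to 0 because the
  law has no atoms.\<close>

definition close_prob :: "real \<Rightarrow> real" where
  "close_prob s = (\<integral>x. ball_prob x s \<partial>law)"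

lemma close_prob_nonneg: "0 \<le> close_prob s"
  unfolding close_prob_def by (intro integral_nonneg_AE) (auto simp: ball_prob_bounds)

lemma close_prob_tendsto_0:
  assumes "s \<longlonglongrightarrow> 0"
  shows "(\<lambda>n. close_prob (s n)) \<longlonglongrightarrow> 0"
proof -
  have "(\<lambda>n. \<integral>x. ball_prob x (s n) \<partial>law) \<longlonglongrightarrow> (\<integral>x. 0 \<partial>law)"
    by (rule integral_dominated_convergence[where w = "\<lambda>_. 1"])
      (use ball_prob_tendsto_0[OF assms] in \<open>auto simp: ball_prob_bounds\<close>)
  then show ?thesis
    by (simp add: close_prob_def)
qed

lemma nn_integral_outside_cball:
  "(\<integral>\<^sup>+z. (if r < dist x z then 1 else 0) \<partial>law) = ennreal (1 - ball_prob x r)"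
proof -
  have "(\<integral>\<^sup>+z. (if r < dist x z then 1 else 0) \<partial>law) = (\<integral>\<^sup>+z. indicator (UNIV - cball x r) z \<partial>law)"
    by (intro nn_integral_cong) (auto simp: indicator_def)
  also have "\<dots> = emeasure law (space law - cball x r)"
    by (subst nn_integral_indicator) auto
  also have "\<dots> = ennreal (1 - ball_prob x r)"
    unfolding law.emeasure_eq_measure ball_prob_def by (subst law.prob_compl) auto
  finally show ?thesis .
qed

text \<open>Beyond distance 2r the two balls are disjoint, so their masses add and 1 - (p + q) \<le>
  exp(- p) exp(- q). The product form lets the integrals over x and y separate afterwards.\<close>

lemma nn_integral_outside_two_cballs:
  "(\<integral>\<^sup>+z. (if r < dist x z \<and> r < dist y z then 1 else 0) \<partial>law)
    \<le> (if dist x y \<le> 2 * r then 1 else ennreal (exp (- ball_prob x r) * exp (- ball_prob y r)))"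
proof (cases "dist x y \<le> 2 * r")
  case True
  have "(\<integral>\<^sup>+z. (if r < dist x z \<and> r < dist y z then 1 else 0) \<partial>law) \<le> (\<integral>\<^sup>+z. 1 \<partial>law)"
    by (intro nn_integral_mono) auto
  then show ?thesis
    using True by (simp add: law.emeasure_space_1[simplified])
next
  case False
  have disj: "cball x r \<inter> cball y r = {}"
  proof (rule equals0I)
    fix z assume "z \<in> cball x r \<inter> cball y r"
    then show False
      using dist_triangle[of x y z] False by (simp add: dist_commute)
  qed
  have "(\<integral>\<^sup>+z. (if r < dist x z \<and> r < dist y z then 1 else 0) \<partial>law)
      = (\<integral>\<^sup>+z. indicator (UNIV - (cball x r \<union> cball y r)) z \<partial>law)"
    by (intro nn_integral_cong) (auto simp: indicator_def)
  also have "\<dots> = emeasure law (space law - (cball x r \<union> cball y r))"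
    by (subst nn_integral_indicator) auto
  also have "\<dots> = ennreal (1 - measure law (cball x r \<union> cball y r))"
    unfolding law.emeasure_eq_measure by (subst law.prob_compl) auto
  also have "measure law (cball x r \<union> cball y r) = ball_prob x r + ball_prob y r"
    unfolding ball_prob_def using disj by (intro law.finite_measure_Union) auto
  also have "1 - (ball_prob x r + ball_prob y r) \<le> exp (- ball_prob x r) * exp (- ball_prob y r)"
    using exp_ge_add_one_self[of "- (ball_prob x r + ball_prob y r)"]
    by (simp only: exp_add[symmetric] minus_add_distrib)
  finally show ?thesis
    using False by (simp add: ennreal_leI)
qed

end

lemma prod_indicator_eq: "finite J \<Longrightarrow> (\<Prod>k\<in>J. (if P k then 1 else 0 :: ennreal)) = (if \<forall>k\<in>J. P k then 1 else 0)"
  by (induction J rule: finite_induct) auto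

lemma others_nonempty:
  assumes "N \<ge> 2"
  shows "{1..N} - {i} \<noteq> ({} :: nat set)"
proof -
  have "(if i = 1 then 2 else 1) \<in> {1..N} - {i}"
    using assms by auto
  then show ?thesis
    by blast
qed

section \<open>Moments of the fraction of isolated sample points\<close>

locale iid_sample = lebesgue_prob_density f + prob_space M
  for f :: "'a::euclidean_space \<Rightarrow> real" and M :: "'w measure" +
  fixes X :: "nat \<Rightarrow> 'w \<Rightarrow> 'a"
  assumes indep: "indep_vars (\<lambda>_. borel) X {1..}"
    and distr_X: "\<And>i. i \<ge> 1 \<Longrightarrow> distr M borel (X i) = law"
begin

lemma X_measurable [measurable]: "i \<ge> 1 \<Longrightarrow> X i \<in> borel_measurable M"
  using indep by (auto simp: indep_vars_def)

text \<open>Conditioning on two sample points leaves N - 2 independent ones, whose factors integrate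
  to a power. All later expectations over the sample (vacancies, pairs, ties, large distances) are
  instances.\<close>

lemma nn_integral_sample:
  fixes h :: "'a \<times> 'a \<Rightarrow> ennreal" and g :: "'a \<times> 'a \<times> 'a \<Rightarrow> ennreal"
  assumes ij: "i \<in> {1..N}" "j \<in> {1..N}" "i \<noteq> j"
    and h [measurable]: "h \<in> borel_measurable (law \<Otimes>\<^sub>M law)"
    and g [measurable]: "g \<in> borel_measurable (law \<Otimes>\<^sub>M law \<Otimes>\<^sub>M law)"
  shows "(\<integral>\<^sup>+\<omega>. h (X i \<omega>, X j \<omega>) * (\<Prod>k\<in>{1..N} - {i, j}. g (X i \<omega>, X j \<omega>, X k \<omega>)) \<partial>M)
    = (\<integral>\<^sup>+x. \<integral>\<^sup>+y. h (x, y) * (\<integral>\<^sup>+z. g (x, y, z) \<partial>law) ^ (N - 2) \<partial>law \<partial>law)"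
proof -
  let ?I = "{1..N}" and ?J = "{1..N} - {i, j}"
  interpret P: product_sigma_finite "\<lambda>_::nat. law"
    by standard
  let ?\<Phi> = "\<lambda>w. h (w i, w j) * (\<Prod>k\<in>?J. g (w i, w j, w k))"
  have I: "?I = insert i (insert j ?J)"
    using ij by auto
  have card: "card ?J = N - 2"
    using ij by (subst card_Diff_subset) auto
  have "indep_vars (\<lambda>_. borel) X ?I"
    by (rule indep_vars_subset[OF indep]) auto
  then have "distr M (\<Pi>\<^sub>M i\<in>?I. borel) (\<lambda>\<omega>. \<lambda>i\<in>?I. X i \<omega>) = (\<Pi>\<^sub>M i\<in>?I. distr M borel (X i))"
    using ij by (subst (asm) indep_vars_iff_distr_eq_PiM') auto
  also have "\<dots> = (\<Pi>\<^sub>M i\<in>?I. law)"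
    by (intro PiM_cong) (auto simp: distr_X)
  finally have distr: "distr M (\<Pi>\<^sub>M i\<in>?I. borel) (\<lambda>\<omega>. \<lambda>i\<in>?I. X i \<omega>) = (\<Pi>\<^sub>M i\<in>?I. law)" .
  have sets: "sets (\<Pi>\<^sub>M i\<in>?I. law) = sets (\<Pi>\<^sub>M i\<in>?I. (borel :: 'a measure))"
    by (intro sets_PiM_cong) auto
  have meas: "?\<Phi> \<in> borel_measurable (\<Pi>\<^sub>M i\<in>insert i (insert j ?J). law)"
    by measurable
  then have meas': "?\<Phi> \<in> borel_measurable (\<Pi>\<^sub>M i\<in>?I. (borel :: 'a measure))"
    unfolding I[symmetric] using measurable_cong_sets[OF sets refl] by blast
  have "(\<integral>\<^sup>+\<omega>. h (X i \<omega>, X j \<omega>) * (\<Prod>k\<in>?J. g (X i \<omega>, X j \<omega>, X k \<omega>)) \<partial>M)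
      = (\<integral>\<^sup>+\<omega>. ?\<Phi> (\<lambda>i\<in>?I. X i \<omega>) \<partial>M)"
    using ij by (intro nn_integral_cong arg_cong2[where f = "(*)"] prod.cong) auto
  also have "\<dots> = (\<integral>\<^sup>+w. ?\<Phi> w \<partial>distr M (\<Pi>\<^sub>M i\<in>?I. borel) (\<lambda>\<omega>. \<lambda>i\<in>?I. X i \<omega>))"
    using meas' by (subst nn_integral_distr) (auto intro!: measurable_restrict)
  also have "\<dots> = (\<integral>\<^sup>+w. ?\<Phi> w \<partial>(\<Pi>\<^sub>M i\<in>insert i (insert j ?J). law))"
    by (simp only: distr I[symmetric])
  also have "\<dots> = (\<integral>\<^sup>+x. (\<integral>\<^sup>+w. ?\<Phi> (w(i := x)) \<partial>(\<Pi>\<^sub>M i\<in>insert j ?J. law)) \<partial>law)"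
    using meas ij by (intro P.product_nn_integral_insert_rev) auto
  also have "\<dots> = (\<integral>\<^sup>+x. (\<integral>\<^sup>+y. (\<integral>\<^sup>+w. ?\<Phi> ((w(j := y))(i := x)) \<partial>(\<Pi>\<^sub>M i\<in>?J. law)) \<partial>law) \<partial>law)"
  proof (intro nn_integral_cong P.product_nn_integral_insert_rev)
    fix x
    have "(\<lambda>w. w(i := x)) \<in> (\<Pi>\<^sub>M i\<in>insert j ?J. law) \<rightarrow>\<^sub>M (\<Pi>\<^sub>M i\<in>insert i (insert j ?J). law)"
      by (rule measurable_fun_upd[where J = "insert j ?J"]) auto
    then show "(\<lambda>w. ?\<Phi> (w(i := x))) \<in> borel_measurable (\<Pi>\<^sub>M i\<in>insert j ?J. law)"
      using measurable_compose[OF _ meas] by blast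
  qed auto
  also have "\<dots> = (\<integral>\<^sup>+x. \<integral>\<^sup>+y. h (x, y) * (\<integral>\<^sup>+z. g (x, y, z) \<partial>law) ^ (N - 2) \<partial>law \<partial>law)"
  proof (intro nn_integral_cong)
    fix x y
    have "(\<integral>\<^sup>+w. ?\<Phi> ((w(j := y))(i := x)) \<partial>(\<Pi>\<^sub>M i\<in>?J. law))
        = (\<integral>\<^sup>+w. h (x, y) * (\<Prod>k\<in>?J. g (x, y, w k)) \<partial>(\<Pi>\<^sub>M i\<in>?J. law))"
      using ij by (intro nn_integral_cong arg_cong2[where f = "(*)"] prod.cong) auto
    also have "\<dots> = h (x, y) * (\<integral>\<^sup>+w. (\<Prod>k\<in>?J. g (x, y, w k)) \<partial>(\<Pi>\<^sub>M i\<in>?J. law))"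
      by (rule nn_integral_cmult) measurable
    also have "(\<integral>\<^sup>+w. (\<Prod>k\<in>?J. g (x, y, w k)) \<partial>(\<Pi>\<^sub>M i\<in>?J. law)) = (\<Prod>k\<in>?J. \<integral>\<^sup>+z. g (x, y, z) \<partial>law)"
      by (rule P.product_nn_integral_prod) auto
    also have "\<dots> = (\<integral>\<^sup>+z. g (x, y, z) \<partial>law) ^ (N - 2)"
      by (simp only: prod_constant card)
    finally show "(\<integral>\<^sup>+w. ?\<Phi> ((w(j := y))(i := x)) \<partial>(\<Pi>\<^sub>M i\<in>?J. law))
        = h (x, y) * (\<integral>\<^sup>+z. g (x, y, z) \<partial>law) ^ (N - 2)" .
  qed
  finally show ?thesis .
qed

text \<open>The indicator of a nearest neighbour distance above r, written as a condition on each
  other point rather than through \<open>Min\<close>. In this form it is a product over the other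
  points.\<close>

definition isolated :: "nat \<Rightarrow> nat \<Rightarrow> real \<Rightarrow> 'w \<Rightarrow> real" where
  "isolated N i r \<omega> = (if \<forall>k\<in>{1..N} - {i}. r < dist (X i \<omega>) (X k \<omega>) then 1 else 0)"

lemma isolated_measurable [measurable]:
  assumes [simp]: "i \<in> {1..N}"
  shows "isolated N i r \<in> borel_measurable M"
  unfolding isolated_def by measurable (use assms in auto)

lemma isolated_bounds: "0 \<le> isolated N i r \<omega>" "isolated N i r \<omega> \<le> 1"
  by (auto simp: isolated_def)

lemma expectation_isolated:
  assumes i: "i \<in> {1..N}" and "N \<ge> 2"
  shows "expectation (isolated N i r) = (\<integral>x. (1 - ball_prob x r) ^ (N - 1) \<partial>law)"
proof -
  \<comment> \<open>\<open>nn_integral_sample\<close> singles out two indices; any second one will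
    do, and its factor goes into \<open>?h\<close>, so the power N - 2 becomes N - 1.\<close>
  obtain j where j: "j \<in> {1..N}" "i \<noteq> j"
    using assms by (cases "i = 1") (auto intro: that[of 1] that[of 2])
  let ?h = "\<lambda>(x::'a, y). if r < dist x y then 1 else 0 :: ennreal"
  let ?g = "\<lambda>(x::'a, y::'a, z). if r < dist x z then 1 else 0 :: ennreal"
  have sp: "{1..N} - {i} = insert j ({1..N} - {i, j})"
    using j by auto
  have "(\<integral>\<^sup>+\<omega>. ennreal (isolated N i r \<omega>) \<partial>M)
      = (\<integral>\<^sup>+\<omega>. ?h (X i \<omega>, X j \<omega>) * (\<Prod>k\<in>{1..N} - {i, j}. ?g (X i \<omega>, X j \<omega>, X k \<omega>)) \<partial>M)"
    unfolding isolated_def sp by (intro nn_integral_cong) (auto simp: prod_indicator_eq)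
  also have "\<dots> = (\<integral>\<^sup>+x. \<integral>\<^sup>+y. ?h (x, y) * (\<integral>\<^sup>+z. ?g (x, y, z) \<partial>law) ^ (N - 2) \<partial>law \<partial>law)"
    by (rule nn_integral_sample[OF i j]) measurable
  also have "\<dots> = (\<integral>\<^sup>+x. ennreal ((1 - ball_prob x r) ^ (N - 1)) \<partial>law)"
  proof (intro nn_integral_cong)
    fix x
    have "(\<integral>\<^sup>+y. ?h (x, y) * (\<integral>\<^sup>+z. ?g (x, y, z) \<partial>law) ^ (N - 2) \<partial>law)
        = ennreal (1 - ball_prob x r) * ennreal (1 - ball_prob x r) ^ (N - 2)"
      by (simp add: nn_integral_outside_cball nn_integral_multc)
    also have "\<dots> = ennreal ((1 - ball_prob x r) ^ Suc (N - 2))"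
      by (simp add: ennreal_power ennreal_mult ball_prob_bounds)
    also have "Suc (N - 2) = N - 1"
      using \<open>N \<ge> 2\<close> by simp
    finally show "(\<integral>\<^sup>+y. ?h (x, y) * (\<integral>\<^sup>+z. ?g (x, y, z) \<partial>law) ^ (N - 2) \<partial>law) = ennreal ((1 - ball_prob x r) ^ (N - 1))" .
  qed
  finally have "(\<integral>\<^sup>+\<omega>. ennreal (isolated N i r \<omega>) \<partial>M) = (\<integral>\<^sup>+x. ennreal ((1 - ball_prob x r) ^ (N - 1)) \<partial>law)" .
  then show ?thesis
    using i by (subst (1 2) integral_eq_nn_integral) (auto simp: isolated_bounds ball_prob_bounds)
qed

lemma expectation_isolated_pair_le:
  assumes i: "i \<in> {1..N}" "j \<in> {1..N}" "i \<noteq> j"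
  shows "expectation (\<lambda>\<omega>. isolated N i r \<omega> * isolated N j r \<omega>)
    \<le> close_prob (2 * r) + (\<integral>x. exp (- (real (N - 2) * ball_prob x r)) \<partial>law)\<^sup>2"
proof -
  let ?g = "\<lambda>(x::'a, y, z). if r < dist x z \<and> r < dist y z then 1 else 0 :: ennreal"
  let ?e = "\<lambda>x. exp (- (real (N - 2) * ball_prob x r))"
  have ie: "integrable law ?e"
    by (rule integrable_law_bounded[of _ 1]) (auto simp: ball_prob_bounds)
  \<comment> \<open>The requirement that the points i and j are themselves more than r apart is
    dropped; only the N - 2 others are kept.\<close>
  have "(\<integral>\<^sup>+\<omega>. ennreal (isolated N i r \<omega> * isolated N j r \<omega>) \<partial>M)
      \<le> (\<integral>\<^sup>+\<omega>. 1 * (\<Prod>k\<in>{1..N} - {i, j}. ?g (X i \<omega>, X j \<omega>, X k \<omega>)) \<partial>M)"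
    unfolding isolated_def by (intro nn_integral_mono) (auto simp: prod_indicator_eq)
  also have "\<dots> = (\<integral>\<^sup>+x. \<integral>\<^sup>+y. 1 * (\<integral>\<^sup>+z. ?g (x, y, z) \<partial>law) ^ (N - 2) \<partial>law \<partial>law)"
    by (rule nn_integral_sample[OF i, of "\<lambda>_. 1"]) measurable
  also have "\<dots> \<le> (\<integral>\<^sup>+x. \<integral>\<^sup>+y. indicator (cball x (2 * r)) y + ennreal (?e x) * ennreal (?e y) \<partial>law \<partial>law)"
  proof (intro nn_integral_mono)
    fix x y
    have "(\<integral>\<^sup>+z. ?g (x, y, z) \<partial>law) ^ (N - 2)
        \<le> (if dist x y \<le> 2 * r then 1 else ennreal (exp (- ball_prob x r) * exp (- ball_prob y r))) ^ (N - 2)"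
      using nn_integral_outside_two_cballs[of r x y] by (intro power_mono) auto
    also have "\<dots> \<le> indicator (cball x (2 * r)) y + ennreal (?e x) * ennreal (?e y)"
      by (auto simp: ennreal_power power_mult_distrib indicator_def ennreal_mult simp flip: exp_of_nat_mult)
    finally show "1 * (\<integral>\<^sup>+z. ?g (x, y, z) \<partial>law) ^ (N - 2) \<le> indicator (cball x (2 * r)) y + ennreal (?e x) * ennreal (?e y)"
      by simp
  qed
  also have "\<dots> = (\<integral>\<^sup>+x. ennreal (ball_prob x (2 * r)) + ennreal (?e x) * (\<integral>\<^sup>+y. ennreal (?e y) \<partial>law) \<partial>law)"
  proof (intro nn_integral_cong)
    fix x :: 'a
    have [measurable]: "cball x (2 * r) \<in> sets borel"
      by simp
    have "(\<integral>\<^sup>+y. indicator (cball x (2 * r)) y \<partial>law) = ennreal (ball_prob x (2 * r))"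
      by (simp add: ball_prob_def law.emeasure_eq_measure)
    then show "(\<integral>\<^sup>+y. indicator (cball x (2 * r)) y + ennreal (?e x) * ennreal (?e y) \<partial>law)
        = ennreal (ball_prob x (2 * r)) + ennreal (?e x) * (\<integral>\<^sup>+y. ennreal (?e y) \<partial>law)"
      by (subst nn_integral_add) (auto simp: nn_integral_cmult)
  qed
  also have "\<dots> = (\<integral>\<^sup>+x. ennreal (ball_prob x (2 * r)) \<partial>law) + (\<integral>\<^sup>+x. ennreal (?e x) \<partial>law) * (\<integral>\<^sup>+y. ennreal (?e y) \<partial>law)"
    by (subst nn_integral_add) (auto simp: nn_integral_multc)
  also have "(\<integral>\<^sup>+x. ennreal (?e x) \<partial>law) = ennreal (\<integral>x. ?e x \<partial>law)"
    using ie by (rule nn_integral_eq_integral) auto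
  also have "(\<integral>\<^sup>+x. ennreal (ball_prob x (2 * r)) \<partial>law) = ennreal (close_prob (2 * r))"
    unfolding close_prob_def
    by (intro nn_integral_eq_integral integrable_law_bounded[of _ 1]) (auto simp: ball_prob_bounds)
  also have "ennreal (close_prob (2 * r)) + ennreal (\<integral>x. ?e x \<partial>law) * ennreal (\<integral>x. ?e x \<partial>law)
      = ennreal (close_prob (2 * r) + (\<integral>x. ?e x \<partial>law)\<^sup>2)"
    by (simp add: close_prob_nonneg power2_eq_square ennreal_plus ennreal_mult integral_nonneg_AE)
  finally have "(\<integral>\<^sup>+\<omega>. ennreal (isolated N i r \<omega> * isolated N j r \<omega>) \<partial>M)
      \<le> ennreal (close_prob (2 * r) + (\<integral>x. ?e x \<partial>law)\<^sup>2)" .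
  then show ?thesis
    using i by (subst integral_eq_nn_integral) (auto simp: isolated_bounds close_prob_nonneg intro!: enn2real_leI)
qed

definition isolated_mean :: "nat \<Rightarrow> real \<Rightarrow> 'w \<Rightarrow> real" where
  "isolated_mean N r \<omega> = (\<Sum>i=1..N. isolated N i r \<omega>) / real N"

lemma isolated_mean_bounds: "0 \<le> isolated_mean N r \<omega>" "isolated_mean N r \<omega> \<le> 1"
proof -
  have "(\<Sum>i=1..N. isolated N i r \<omega>) \<le> (\<Sum>i=1..N. 1)"
    by (intro sum_mono isolated_bounds)
  then show "isolated_mean N r \<omega> \<le> 1"
    by (auto simp: isolated_mean_def divide_le_eq_1)
qed (auto simp: isolated_mean_def isolated_bounds sum_nonneg)

lemma isolated_mean_measurable [measurable]: "isolated_mean N r \<in> borel_measurable M"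
  unfolding isolated_mean_def by measurable

lemma expectation_isolated_mean:
  assumes "N \<ge> 2"
  shows "expectation (isolated_mean N r) = (\<integral>x. (1 - ball_prob x r) ^ (N - 1) \<partial>law)"
proof -
  have "integrable M (isolated N i r)" if "i \<in> {1..N}" for i
    using that by (intro integrable_const_bound[of _ 1]) (auto simp: isolated_bounds)
  then have "expectation (isolated_mean N r) = (\<Sum>i=1..N. expectation (isolated N i r)) / real N"
    unfolding isolated_mean_def by (simp add: Bochner_Integration.integral_sum)
  also have "\<dots> = (\<Sum>i=1..N. (\<integral>x. (1 - ball_prob x r) ^ (N - 1) \<partial>law)) / real N"
    using assms by (intro arg_cong2[where f = "(/)"] sum.cong refl expectation_isolated)
  finally show ?thesis
    using assms by simp
qed

text \<open>Of the N^2 pairs in the expanded square, the N diagonal ones are bounded by 1 each,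
  giving 1 / N; the others obey the pair bound.\<close>

lemma expectation_isolated_mean_square_le:
  assumes "N \<ge> 2"
  shows "expectation (\<lambda>\<omega>. (isolated_mean N r \<omega>)\<^sup>2)
    \<le> 1 / real N + close_prob (2 * r) + (\<integral>x. exp (- (real (N - 2) * ball_prob x r)) \<partial>law)\<^sup>2"
proof -
  let ?J = "close_prob (2 * r) + (\<integral>x. exp (- (real (N - 2) * ball_prob x r)) \<partial>law)\<^sup>2"
  have J: "0 \<le> ?J"
    by (simp add: close_prob_nonneg)
  have int: "integrable M (\<lambda>\<omega>. isolated N i r \<omega> * isolated N j r \<omega>)" if "i \<in> {1..N}" "j \<in> {1..N}" for i j
    using that by (intro integrable_const_bound[of _ 1]) (auto simp: isolated_bounds mult_le_one)
  have "expectation (\<lambda>\<omega>. (isolated_mean N r \<omega>)\<^sup>2)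
      = expectation (\<lambda>\<omega>. (\<Sum>i=1..N. \<Sum>j=1..N. isolated N i r \<omega> * isolated N j r \<omega>) / (real N)\<^sup>2)"
    by (simp add: isolated_mean_def power_divide power2_eq_square sum_product)
  also have "\<dots> = (\<Sum>i=1..N. \<Sum>j=1..N. expectation (\<lambda>\<omega>. isolated N i r \<omega> * isolated N j r \<omega>)) / (real N)\<^sup>2"
  proof -
    have "expectation (\<lambda>\<omega>. \<Sum>i=1..N. \<Sum>j=1..N. isolated N i r \<omega> * isolated N j r \<omega>)
        = (\<Sum>i=1..N. expectation (\<lambda>\<omega>. \<Sum>j=1..N. isolated N i r \<omega> * isolated N j r \<omega>))"
      by (intro Bochner_Integration.integral_sum Bochner_Integration.integrable_sum int)
    also have "\<dots> = (\<Sum>i=1..N. \<Sum>j=1..N. expectation (\<lambda>\<omega>. isolated N i r \<omega> * isolated N j r \<omega>))"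
      by (intro sum.cong refl Bochner_Integration.integral_sum int)
    finally show ?thesis
      by simp
  qed
  also have "\<dots> \<le> (\<Sum>i=1..N. \<Sum>j=1..N. (if i = j then 1 else 0) + ?J) / (real N)\<^sup>2"
  proof (intro divide_right_mono sum_mono)
    fix i j assume ij: "i \<in> {1..N}" "j \<in> {1..N}"
    show "expectation (\<lambda>\<omega>. isolated N i r \<omega> * isolated N j r \<omega>) \<le> (if i = j then 1 else 0) + ?J"
    proof (cases "i = j")
      case True
      have "expectation (\<lambda>\<omega>. isolated N i r \<omega> * isolated N j r \<omega>) \<le> 1"
        using int[OF ij] by (intro integral_le_const) (auto simp: isolated_bounds mult_le_one)
      then show ?thesis
        using True J by simp
    next
      case False
      then show ?thesis
        using expectation_isolated_pair_le[OF ij False] by simp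
    qed
  qed auto
  also have "\<dots> = 1 / real N + ?J"
    using assms by (simp add: sum.distrib power2_eq_square field_simps)
  finally show ?thesis
    by simp
qed

text \<open>The mean enters with the factor - 2 c. Its exact value is therefore used, whereas an
  upper bound is enough for the second moment.\<close>

lemma expectation_isolated_mean_deviation_le:
  assumes "N \<ge> 2"
  shows "expectation (\<lambda>\<omega>. (isolated_mean N r \<omega> - c)\<^sup>2)
    \<le> 1 / real N + close_prob (2 * r) + (\<integral>x. exp (- (real (N - 2) * ball_prob x r)) \<partial>law)\<^sup>2
      - 2 * c * (\<integral>x. (1 - ball_prob x r) ^ (N - 1) \<partial>law) + c\<^sup>2"
proof -
  have i: "integrable M (isolated_mean N r)" "integrable M (\<lambda>\<omega>. (isolated_mean N r \<omega>)\<^sup>2)"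
    by (intro integrable_const_bound[of _ 1]; auto simp: isolated_mean_bounds power_le_one)+
  have "expectation (\<lambda>\<omega>. (isolated_mean N r \<omega> - c)\<^sup>2)
      = expectation (\<lambda>\<omega>. (isolated_mean N r \<omega>)\<^sup>2 - 2 * c * isolated_mean N r \<omega> + c\<^sup>2)"
    by (simp add: power2_diff algebra_simps)
  also have "\<dots> = expectation (\<lambda>\<omega>. (isolated_mean N r \<omega>)\<^sup>2) - 2 * c * expectation (isolated_mean N r) + c\<^sup>2"
    using i by (simp add: prob_space)
  finally show ?thesis
    using expectation_isolated_mean_square_le[OF assms, of r] expectation_isolated_mean[OF assms, of r] by simp
qed

end

section \<open>Large nearest neighbour distances\<close>

context lebesgue_prob_density
begin

definition log_excess :: "real \<Rightarrow> 'a \<Rightarrow> ennreal" where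
  "log_excess R x = (\<integral>\<^sup>+y. ennreal ((max 0 (ln (dist x y / R)))\<^sup>2) \<partial>law)"

lemma log_excess_measurable [measurable]: "log_excess R \<in> borel_measurable borel"
  unfolding log_excess_def by measurable

text \<open>Two truncations extract a plain second moment from \<open>K2_functional\<close>: above e
  the function G dominates the identity, and where the inner integral is at least 1 its power 1 +
  \<epsilon> dominates it. Both discarded parts are bounded.\<close>

lemma nn_integral_log_excess_finite:
  assumes K: "K2_functional f \<epsilon> < \<infinity>" and "0 < \<epsilon>" "0 < R"
  shows "(\<integral>\<^sup>+x. log_excess R x \<partial>law) < \<infinity>"
proof -
  define g :: "'a \<Rightarrow> 'a \<Rightarrow> real" where
    "g x y = (if exp 1 \<le> (ln (dist x y))\<^sup>2 then (ln (dist x y))\<^sup>2 else 0)" for x y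
  have [measurable]: "case_prod g \<in> borel_measurable (borel \<Otimes>\<^sub>M borel)"
    unfolding g_def by measurable
  have g_nonneg: "0 \<le> g x y" for x y
    by (simp add: g_def)
  define w where "w x = (\<integral>\<^sup>+y. ennreal (g x y) \<partial>law)" for x
  define v where "v x = (if 1 \<le> w x then w x else 0)" for x
  have [measurable]: "w \<in> borel_measurable borel"
    unfolding w_def by measurable
  have [measurable]: "v \<in> borel_measurable borel"
    unfolding v_def by measurable
  let ?W = "\<lambda>x. \<integral>\<^sup>+y. G_fun ((log_dist x y)\<^sup>2) * ennreal (f y) \<partial>lborel"
  have wW: "w x \<le> ?W x" for x
    unfolding w_def g_def using log_square_le_G_fun[of x]
    by (subst nn_integral_law) (auto intro!: nn_integral_mono mult_right_mono)
  have vW: "v x \<le> ennreal_powr (?W x) (1 + \<epsilon>)" for x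
  proof (cases "1 \<le> w x")
    case True
    then have "w x \<le> ennreal_powr (w x) (1 + \<epsilon>)"
      using \<open>0 < \<epsilon>\<close> by (intro ennreal_le_powr) auto
    also have "\<dots> \<le> ennreal_powr (?W x) (1 + \<epsilon>)"
      using \<open>0 < \<epsilon>\<close> by (intro ennreal_powr_mono wW) auto
    finally show ?thesis
      using True by (simp add: v_def)
  qed (simp add: v_def)
  have "(\<integral>\<^sup>+x. v x \<partial>law) \<le> K2_functional f \<epsilon>"
    unfolding K2_functional_def
    by (subst nn_integral_law) (auto intro!: nn_integral_mono mult_right_mono vW)
  then have v: "(\<integral>\<^sup>+x. v x \<partial>law) < \<infinity>"
    using K by (rule le_less_trans)
  \<comment> \<open>From (ln s - ln R)^2 \<le> 2 (ln s)^2 + 2 (ln R)^2, with (ln s)^2 < e whenever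
    \<open>g\<close> is cut to 0.\<close>
  let ?c = "2 * exp 1 + 2 * (ln R)\<^sup>2"
  have le: "log_excess R x \<le> ennreal ?c + 2 * (1 + v x)" for x
  proof -
    have "(max 0 (ln (dist x y / R)))\<^sup>2 \<le> ?c + 2 * g x y" for y
      using power2_max_ln_divide_le[OF zero_le_dist \<open>0 < R\<close>, of x y] exp_gt_zero[of "1::real"]
      by (cases "exp 1 \<le> (ln (dist x y))\<^sup>2"; simp only: g_def if_True if_False; linarith)
    then have "log_excess R x \<le> (\<integral>\<^sup>+y. ennreal (?c + 2 * g x y) \<partial>law)"
      unfolding log_excess_def by (intro nn_integral_mono ennreal_leI)
    also have "\<dots> = (\<integral>\<^sup>+y. ennreal ?c + 2 * ennreal (g x y) \<partial>law)"
      by (intro nn_integral_cong) (simp add: g_nonneg ennreal_mult flip: ennreal_numeral)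
    also have "\<dots> = ennreal ?c + 2 * w x"
      unfolding w_def by (subst nn_integral_add) (auto simp: nn_integral_cmult law.emeasure_space_1[simplified])
    also have "w x \<le> 1 + v x"
      by (auto simp: v_def)
    finally show ?thesis
      by (simp add: mult_left_mono add_left_mono)
  qed
  have "(\<integral>\<^sup>+x. log_excess R x \<partial>law) \<le> (\<integral>\<^sup>+x. ennreal ?c + 2 * (1 + v x) \<partial>law)"
    by (intro nn_integral_mono le)
  also have "\<dots> = ennreal ?c + 2 * (1 + (\<integral>\<^sup>+x. v x \<partial>law))"
    by (simp add: nn_integral_add nn_integral_cmult law.emeasure_space_1[simplified])
  also have "\<dots> < \<infinity>"
    using v by (simp add: ennreal_mult_less_top)
  finally show ?thesis .
qed

text \<open>Where the ball has positive mass its vacancy probability tends to 0;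
  \<open>log_excess R\<close> itself is the integrable majorant.\<close>

lemma log_excess_vacancy_tendsto_0:
  assumes fin: "(\<integral>\<^sup>+x. log_excess R x \<partial>law) < \<infinity>"
    and pos: "AE x in law. 0 < ball_prob x R"
  shows "(\<lambda>n. \<integral>\<^sup>+x. log_excess R x * ennreal ((1 - ball_prob x R) ^ n) \<partial>law) \<longlonglongrightarrow> 0"
proof -
  have "(\<lambda>n. \<integral>\<^sup>+x. log_excess R x * ennreal ((1 - ball_prob x R) ^ n) \<partial>law) \<longlonglongrightarrow> (\<integral>\<^sup>+x. 0 \<partial>law)"
  proof (rule nn_integral_dominated_convergence[where w = "log_excess R"])
    show "AE x in law. log_excess R x * ennreal ((1 - ball_prob x R) ^ n) \<le> log_excess R x" for n
    proof (intro AE_I2)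
      fix x
      have "ennreal ((1 - ball_prob x R) ^ n) \<le> 1"
        using ball_prob_bounds[of x R] by (simp add: power_le_one)
      then show "log_excess R x * ennreal ((1 - ball_prob x R) ^ n) \<le> log_excess R x"
        using mult_left_mono[of _ 1 "log_excess R x"] by simp
    qed
    have "AE x in law. log_excess R x \<noteq> \<infinity>"
      using fin by (intro nn_integral_noteq_infinite) auto
    with pos show "AE x in law. (\<lambda>n. log_excess R x * ennreal ((1 - ball_prob x R) ^ n)) \<longlonglongrightarrow> 0"
    proof eventually_elim
      case (elim x)
      have "(\<lambda>n. (1 - ball_prob x R) ^ n) \<longlonglongrightarrow> 0"
        using elim ball_prob_bounds[of x R] by (intro LIMSEQ_power_zero) auto
      then have "(\<lambda>n. ennreal ((1 - ball_prob x R) ^ n)) \<longlonglongrightarrow> ennreal 0"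
        by (rule tendsto_ennrealI)
      from ennreal_tendsto_cmult[OF _ this, of "log_excess R x"]
      show ?case
        using elim by (simp add: less_top)
    qed
  qed (use fin in auto)
  then show ?thesis
    by simp
qed

end

context iid_sample
begin

text \<open>On a tie the convention \<open>ln 0 = 0\<close> would break the link between logarithm
  and level sets; ties are null because the law has no atoms.\<close>

lemma AE_no_ties: "AE \<omega> in M. \<forall>i\<in>{1..N}. \<forall>j\<in>{1..N}. i \<noteq> j \<longrightarrow> X i \<omega> \<noteq> X j \<omega>"
proof -
  have "AE \<omega> in M. X i \<omega> \<noteq> X j \<omega>" if ij: "i \<in> {1..N}" "j \<in> {1..N}" "i \<noteq> j" for i j
  proof -
    let ?h = "\<lambda>(x::'a, y). if dist x y = 0 then 1 else 0 :: ennreal"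
    have [measurable]: "?h \<in> borel_measurable (law \<Otimes>\<^sub>M law)"
      by measurable
    have "(\<integral>\<^sup>+\<omega>. ?h (X i \<omega>, X j \<omega>) * (\<Prod>k\<in>{1..N} - {i, j}. 1) \<partial>M)
        = (\<integral>\<^sup>+x. \<integral>\<^sup>+y. ?h (x, y) * (\<integral>\<^sup>+z. 1 \<partial>law) ^ (N - 2) \<partial>law \<partial>law)"
      by (rule nn_integral_sample[OF ij, of ?h "\<lambda>_. 1"]) measurable
    also have "\<dots> = (\<integral>\<^sup>+x. \<integral>\<^sup>+y. indicator {x} y \<partial>law \<partial>law)"
      by (intro nn_integral_cong) (auto simp: law.emeasure_space_1[simplified] indicator_def)
    also have "\<dots> = 0"
      by (simp add: law_singleton)
    finally have "(\<integral>\<^sup>+\<omega>. (if dist (X i \<omega>) (X j \<omega>) = 0 then 1 else 0) \<partial>M) = 0"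
      by simp
    then have "AE \<omega> in M. (if dist (X i \<omega>) (X j \<omega>) = 0 then 1 else 0 :: ennreal) = 0"
      using ij by (subst (asm) nn_integral_0_iff_AE) auto
    then show ?thesis
      by eventually_elim (auto split: if_splits)
  qed
  then show ?thesis
    by (auto simp: AE_ball_countable)
qed

abbreviation sample_nn_dist :: "nat \<Rightarrow> nat \<Rightarrow> 'w \<Rightarrow> real" where
  "sample_nn_dist N i \<omega> \<equiv> nn_dist N (\<lambda>k. X k \<omega>) i"

lemma nn_dist_gr_iff:
  assumes "i \<in> {1..N}" "N \<ge> 2"
  shows "r < sample_nn_dist N i \<omega> \<longleftrightarrow> (\<forall>k\<in>{1..N} - {i}. r < dist (X i \<omega>) (X k \<omega>))"
  unfolding nn_dist_def using others_nonempty[OF assms(2)] by (subst Min_gr_iff) auto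

lemma isolated_eq:
  assumes "i \<in> {1..N}" "N \<ge> 2"
  shows "isolated N i r \<omega> = (if r < sample_nn_dist N i \<omega> then 1 else 0)"
  by (simp add: isolated_def nn_dist_gr_iff[OF assms])

lemma nn_dist_measurable [measurable]:
  assumes "i \<in> {1..N}"
  shows "sample_nn_dist N i \<in> borel_measurable M"
  unfolding nn_dist_def using assms by (intro borel_measurable_Min) auto

text \<open>Fix any other index j. If the nearest neighbour is farther than R, its distance is at
  most that of j and the remaining N - 2 points avoid the ball of radius R. Given the i-th point,
  these two facts concern independent variables, so the bound factorises.\<close>

lemma nn_integral_nn_dist_excess_le:
  assumes i: "i \<in> {1..N}" and N: "N \<ge> 2" and "0 < R"
  shows "(\<integral>\<^sup>+\<omega>. ennreal ((max 0 (ln (sample_nn_dist N i \<omega> / R)))\<^sup>2) \<partial>M)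
    \<le> (\<integral>\<^sup>+x. log_excess R x * ennreal ((1 - ball_prob x R) ^ (N - 2)) \<partial>law)"
proof -
  obtain j where "j \<in> {1..N} - {i}"
    using others_nonempty[OF N] by blast
  then have j: "j \<in> {1..N}" "i \<noteq> j"
    by auto
  let ?h = "\<lambda>(x::'a, y). ennreal ((max 0 (ln (dist x y / R)))\<^sup>2)"
  let ?g = "\<lambda>(x::'a, y::'a, z). if R < dist x z then 1 else 0 :: ennreal"
  have "(\<integral>\<^sup>+\<omega>. ennreal ((max 0 (ln (sample_nn_dist N i \<omega> / R)))\<^sup>2) \<partial>M)
      \<le> (\<integral>\<^sup>+\<omega>. ?h (X i \<omega>, X j \<omega>) * (\<Prod>k\<in>{1..N} - {i, j}. ?g (X i \<omega>, X j \<omega>, X k \<omega>)) \<partial>M)"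
  proof (intro nn_integral_mono)
    fix \<omega>
    let ?\<rho> = "sample_nn_dist N i \<omega>"
    show "ennreal ((max 0 (ln (?\<rho> / R)))\<^sup>2) \<le> ?h (X i \<omega>, X j \<omega>) * (\<Prod>k\<in>{1..N} - {i, j}. ?g (X i \<omega>, X j \<omega>, X k \<omega>))"
    proof (cases "R < ?\<rho>")
      case True
      then have far: "\<forall>k\<in>{1..N} - {i, j}. R < dist (X i \<omega>) (X k \<omega>)"
        using nn_dist_gr_iff[OF i N] by auto
      have "?\<rho> \<le> dist (X i \<omega>) (X j \<omega>)"
        unfolding nn_dist_def using j by (intro Min_le) auto
      then have "ln (?\<rho> / R) \<le> ln (dist (X i \<omega>) (X j \<omega>) / R)"
        using True \<open>0 < R\<close> by (intro ln_mono divide_right_mono) auto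
      then have "(max 0 (ln (?\<rho> / R)))\<^sup>2 \<le> (max 0 (ln (dist (X i \<omega>) (X j \<omega>) / R)))\<^sup>2"
        by (intro power_mono max.mono) auto
      moreover have "(\<Prod>k\<in>{1..N} - {i, j}. ?g (X i \<omega>, X j \<omega>, X k \<omega>)) = 1"
        using far by (simp add: prod_indicator_eq)
      ultimately show ?thesis
        by (simp add: ennreal_leI)
    next
      case False
      have "max 0 (ln (?\<rho> / R)) = 0"
      proof (cases "0 < ?\<rho>")
        case True
        then show ?thesis
          using False \<open>0 < R\<close> by (simp add: max_def)
      next
        \<comment> \<open>The distance is 0 here, and \<open>ln 0 = 0\<close> makes the positive
          part vanish.\<close>
        case nonpos: False
        have "0 \<le> ?\<rho>"
          unfolding nn_dist_def using others_nonempty[OF N] by (subst Min_ge_iff) auto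
        then show ?thesis
          using nonpos by simp
      qed
      then show ?thesis
        by simp
    qed
  qed
  also have "\<dots> = (\<integral>\<^sup>+x. \<integral>\<^sup>+y. ?h (x, y) * (\<integral>\<^sup>+z. ?g (x, y, z) \<partial>law) ^ (N - 2) \<partial>law \<partial>law)"
    by (rule nn_integral_sample[OF i j]) measurable
  also have "\<dots> = (\<integral>\<^sup>+x. log_excess R x * ennreal ((1 - ball_prob x R) ^ (N - 2)) \<partial>law)"
    unfolding log_excess_def
    by (intro nn_integral_cong)
      (simp add: nn_integral_outside_cball nn_integral_multc ennreal_power ball_prob_bounds)
  finally show ?thesis .
qed

section \<open>Splitting the estimate at radius R\<close>

definition sample_radius :: "nat \<Rightarrow> real \<Rightarrow> real" where
  "sample_radius N t = ball_radius (exp t / (real N - 1))"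

lemma sample_radius_measurable [measurable]: "sample_radius N \<in> borel_measurable borel"
  unfolding sample_radius_def by measurable

lemma sample_radius_props:
  assumes "N \<ge> 2"
  shows "0 < sample_radius N t" "real (N - 1) * ball_vol (sample_radius N t) = exp t"
  using assms by (auto simp: sample_radius_def ball_radius_pos ball_vol_ball_radius of_nat_diff)

text \<open>At s = nearest neighbour distance this is \<open>ln Z\<^sub>i\<close> of the overview;
  at s = R it is the level up to which \<open>sample_radius N t\<close> stays below R.\<close>

definition log_ball_count :: "nat \<Rightarrow> real \<Rightarrow> real" where
  "log_ball_count N s = real DIM('a) * ln s + ln (unit_ball_vol DIM('a)) + ln (real N - 1)"

lemma log_ball_count_eq:
  assumes "N \<ge> 2" "0 < s"
  shows "log_ball_count N s = ln (real (N - 1) * ball_vol s)"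
  using assms unit_ball_vol_pos[of "real DIM('a)", THEN less_imp_neq]
  by (simp add: log_ball_count_def ball_vol_def ln_mult ln_realpow of_nat_diff)

lemma sample_radius_less_iff:
  assumes "N \<ge> 2" "0 < s"
  shows "sample_radius N t < s \<longleftrightarrow> t < log_ball_count N s"
proof -
  have "sample_radius N t < s \<longleftrightarrow> real (N - 1) * ball_vol (sample_radius N t) < real (N - 1) * ball_vol s"
    using assms sample_radius_props(1)[OF assms(1)]
    by (subst mult_less_cancel_left_pos) (auto simp: ball_vol_less_iff)
  also have "\<dots> \<longleftrightarrow> exp t < real (N - 1) * ball_vol s"
    using sample_radius_props[OF assms(1)] by simp
  also have "\<dots> \<longleftrightarrow> t < log_ball_count N s"
    unfolding log_ball_count_eq[OF assms]
    using ln_less_cancel_iff[of "exp t" "real (N - 1) * ball_vol s"] assms by simp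
  finally show ?thesis .
qed

lemma KL_estimate_eq:
  assumes "N \<ge> 2" and pos: "\<And>i. i \<in> {1..N} \<Longrightarrow> 0 < sample_nn_dist N i \<omega>"
  shows "KL_estimate N (\<lambda>i. X i \<omega>) = euler_mascheroni
    + (\<Sum>i=1..N. log_ball_count N (sample_nn_dist N i \<omega>)) / real N"
proof -
  have "ln (mean_nn_dist N (\<lambda>i. X i \<omega>)) = ln (\<Prod>i=1..N. sample_nn_dist N i \<omega>) / real N"
    unfolding mean_nn_dist_def using assms by (intro ln_root prod_pos) auto
  also have "ln (\<Prod>i=1..N. sample_nn_dist N i \<omega>) = (\<Sum>i=1..N. ln (sample_nn_dist N i \<omega>))"
  proof (rule ln_prod)
    fix i assume "i \<in> {1..N}"
    from pos[OF this] show "sample_nn_dist N i \<omega> \<noteq> 0"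
      by simp
  qed simp
  finally show ?thesis
    using assms by (simp add: KL_estimate_def log_ball_count_def sum.distrib sum_distrib_left[symmetric] add_divide_distrib)
qed

text \<open>With L = \<open>log_ball_count N R\<close>, each \<open>ln Z\<^sub>i\<close> is its
  minimum with L plus d times the positive part of ln(distance / R). The truncated parts average to
  an integral of the empirical tail over t < L; the integral for H - \<gamma> is cut at the same L,
  and \<gamma> cancels.\<close>

lemma KL_estimate_decomposition:
  assumes N: "N \<ge> 2" and "0 < R" and L: "0 \<le> log_ball_count N R"
    and F: "has_bochner_integral lborel (\<lambda>t. exp_transform (exp t) - indicator {..<0} t) (H - euler_mascheroni)"
    and pos: "\<And>i. i \<in> {1..N} \<Longrightarrow> 0 < sample_nn_dist N i \<omega>"
  shows "KL_estimate N (\<lambda>i. X i \<omega>) - H =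
      (\<integral>t. indicator {..<log_ball_count N R} t
        * (isolated_mean N (sample_radius N t) \<omega> - exp_transform (exp t)) \<partial>lborel)
      - (\<integral>t. indicator {log_ball_count N R..} t * (exp_transform (exp t) - indicator {..<0} t) \<partial>lborel)
      + real DIM('a) * ((\<Sum>i=1..N. max 0 (ln (sample_nn_dist N i \<omega> / R))) / real N)"
proof -
  let ?L = "log_ball_count N R"
  let ?z = "\<lambda>i. log_ball_count N (sample_nn_dist N i \<omega>)"
  let ?F = "\<lambda>t. exp_transform (exp t) - indicator {..<0} t"
  have "has_bochner_integral lborel
      (\<lambda>t. (\<Sum>i=1..N. indicator {..<?L} t * (indicator {..<?z i} t - indicator {..<0} t)) / real N)
      ((\<Sum>i=1..N. min (?z i) ?L) / real N)"
    using L by (intro has_bochner_integral_divide_zero has_bochner_integral_sum has_bochner_integral_layer)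
  moreover have "(\<Sum>i=1..N. indicator {..<?L} t * (indicator {..<?z i} t - indicator {..<0} t)) / real N
      = indicator {..<?L} t * (isolated_mean N (sample_radius N t) \<omega> - indicator {..<0} t)" for t
  proof -
    have "isolated N i (sample_radius N t) \<omega> = indicator {..<?z i} t" if "i \<in> {1..N}" for i
      using that pos[OF that] N by (simp add: isolated_eq sample_radius_less_iff indicator_def)
    then have "isolated_mean N (sample_radius N t) \<omega> = (\<Sum>i=1..N. indicator {..<?z i} t) / real N"
      unfolding isolated_mean_def by (intro arg_cong2[where f = "(/)"] sum.cong refl)
    then show ?thesis
      using N by (simp add: sum_distrib_left[symmetric] sum_subtractf field_simps)
  qed
  ultimately have 1: "has_bochner_integral lborel
      (\<lambda>t. indicator {..<?L} t * (isolated_mean N (sample_radius N t) \<omega> - indicator {..<0} t))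
      ((\<Sum>i=1..N. min (?z i) ?L) / real N)"
    by simp
  have Fi: "integrable lborel ?F" and Fv: "(\<integral>t. ?F t \<partial>lborel) = H - euler_mascheroni"
    using F by (auto simp: has_bochner_integral_iff)
  have i2: "integrable lborel (\<lambda>t. indicator {..<?L} t * ?F t)" "integrable lborel (\<lambda>t. indicator {?L..} t * ?F t)"
    using integrable_mult_indicator[of "{..<?L}", OF _ Fi] integrable_mult_indicator[of "{?L..}", OF _ Fi] by auto
  have split: "(\<integral>t. ?F t \<partial>lborel) = (\<integral>t. indicator {..<?L} t * ?F t \<partial>lborel) + (\<integral>t. indicator {?L..} t * ?F t \<partial>lborel)"
  proof -
    have "(\<integral>t. ?F t \<partial>lborel) = (\<integral>t. indicator {..<?L} t * ?F t + indicator {?L..} t * ?F t \<partial>lborel)"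
      by (intro Bochner_Integration.integral_cong) (auto simp: indicator_def)
    then show ?thesis
      by (simp only: Bochner_Integration.integral_add[OF i2])
  qed
  have eq: "indicator {..<?L} t * (isolated_mean N (sample_radius N t) \<omega> - indicator {..<0} t) - indicator {..<?L} t * ?F t
      = indicator {..<?L} t * (isolated_mean N (sample_radius N t) \<omega> - exp_transform (exp t))" for t
    by (simp add: algebra_simps)
  have 2: "has_bochner_integral lborel
      (\<lambda>t. indicator {..<?L} t * (isolated_mean N (sample_radius N t) \<omega> - exp_transform (exp t)))
      ((\<Sum>i=1..N. min (?z i) ?L) / real N - (\<integral>t. indicator {..<?L} t * ?F t \<partial>lborel))"
    using has_bochner_integral_diff[OF 1 has_bochner_integral_integrable[OF i2(1)]] by (simp only: eq)
  \<comment> \<open>The difference of two values of \<open>log_ball_count N\<close> is d times a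
    logarithm of a ratio; N and the unit ball volume cancel.\<close>
  have z: "?z i = min (?z i) ?L + real DIM('a) * max 0 (ln (sample_nn_dist N i \<omega> / R))" if "i \<in> {1..N}" for i
  proof -
    let ?l = "ln (sample_nn_dist N i \<omega> / R)"
    have d: "?z i - ?L = real DIM('a) * ?l"
      using pos[OF that] \<open>0 < R\<close> by (simp add: log_ball_count_def ln_div algebra_simps)
    show ?thesis
    proof (cases "0 \<le> ?l")
      case True
      then have "0 \<le> real DIM('a) * ?l"
        by simp
      then have "min (?z i) ?L = ?L" "max 0 ?l = ?l"
        using d True by linarith+
      then show ?thesis
        using d by simp
    next
      case False
      then have "real DIM('a) * ?l < 0"
        by (intro mult_pos_neg) auto
      then have "min (?z i) ?L = ?z i" "max 0 ?l = 0"
        using d False by linarith+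
      then show ?thesis
        by simp
    qed
  qed
  have "(\<Sum>i=1..N. ?z i) = (\<Sum>i=1..N. min (?z i) ?L + real DIM('a) * max 0 (ln (sample_nn_dist N i \<omega> / R)))"
    using z by (intro sum.cong refl)
  also have "\<dots> = (\<Sum>i=1..N. min (?z i) ?L) + real DIM('a) * (\<Sum>i=1..N. max 0 (ln (sample_nn_dist N i \<omega> / R)))"
    by (simp add: sum.distrib sum_distrib_left)
  finally have 3: "(\<Sum>i=1..N. ?z i) / real N = (\<Sum>i=1..N. min (?z i) ?L) / real N
      + real DIM('a) * ((\<Sum>i=1..N. max 0 (ln (sample_nn_dist N i \<omega> / R))) / real N)"
    by (simp add: add_divide_distrib)
  show "KL_estimate N (\<lambda>i. X i \<omega>) - H =
      (\<integral>t. indicator {..<?L} t * (isolated_mean N (sample_radius N t) \<omega> - exp_transform (exp t)) \<partial>lborel)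
      - (\<integral>t. indicator {?L..} t * ?F t \<partial>lborel)
      + real DIM('a) * ((\<Sum>i=1..N. max 0 (ln (sample_nn_dist N i \<omega> / R))) / real N)"
    using 2 3 split Fv KL_estimate_eq[OF N pos] by (simp add: has_bochner_integral_iff)
qed

end

section \<open>Consistency\<close>

text \<open>Cauchy-Schwarz after splitting off exp(- a |t| / 2), whose square has integral 2 / a. If
  \<open>g\<close> is not integrable, the left side is 0 by the default of the Bochner
  integral.\<close>

lemma ennreal_integral_square_le:
  fixes g :: "real \<Rightarrow> real"
  assumes "a > 0" and [measurable]: "g \<in> borel_measurable borel"
  shows "ennreal ((\<integral>t. g t \<partial>lborel)\<^sup>2) \<le> ennreal (2 / a) * (\<integral>\<^sup>+t. ennreal (exp (a * \<bar>t\<bar>) * (g t)\<^sup>2) \<partial>lborel)"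
proof (cases "integrable lborel g")
  case True
  have "ennreal ((\<integral>t. g t \<partial>lborel)\<^sup>2) = (ennreal (norm (\<integral>t. g t \<partial>lborel)))\<^sup>2"
    by (simp add: ennreal_power)
  also have "\<dots> \<le> (\<integral>\<^sup>+t. ennreal (norm (g t)) \<partial>lborel)\<^sup>2"
    using True by (intro power_mono integral_norm_bound_ennreal) auto
  also have "(\<integral>\<^sup>+t. ennreal (norm (g t)) \<partial>lborel)
      = (\<integral>\<^sup>+t. ennreal (exp (- (a * \<bar>t\<bar>) / 2)) * ennreal (exp (a * \<bar>t\<bar> / 2) * \<bar>g t\<bar>) \<partial>lborel)"
    by (intro nn_integral_cong) (simp add: mult.assoc[symmetric] flip: ennreal_mult exp_add)
  also have "\<dots>\<^sup>2 \<le> (\<integral>\<^sup>+t. (ennreal (exp (- (a * \<bar>t\<bar>) / 2)))\<^sup>2 \<partial>lborel)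
      * (\<integral>\<^sup>+t. (ennreal (exp (a * \<bar>t\<bar> / 2) * \<bar>g t\<bar>))\<^sup>2 \<partial>lborel)"
    by (rule Cauchy_Schwarz_nn_integral) measurable
  also have "(\<integral>\<^sup>+t. (ennreal (exp (- (a * \<bar>t\<bar>) / 2)))\<^sup>2 \<partial>lborel) = (\<integral>\<^sup>+t. ennreal (exp (- (a * \<bar>t\<bar>))) \<partial>lborel)"
    by (intro nn_integral_cong) (simp add: ennreal_power flip: exp_double)
  also have "\<dots> = ennreal (2 / a)"
    using has_bochner_integral_exp_minus_abs[OF \<open>a > 0\<close>]
    by (subst nn_integral_eq_integral) (auto simp: has_bochner_integral_iff)
  also have "(\<integral>\<^sup>+t. (ennreal (exp (a * \<bar>t\<bar> / 2) * \<bar>g t\<bar>))\<^sup>2 \<partial>lborel) = (\<integral>\<^sup>+t. ennreal (exp (a * \<bar>t\<bar>) * (g t)\<^sup>2) \<partial>lborel)"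
    by (intro nn_integral_cong) (simp add: ennreal_power power_mult_distrib flip: exp_double)
  finally show ?thesis .
qed (simp add: not_integrable_integral_eq)

locale kl_sample = iid_sample f M X
  for f :: "'a::euclidean_space \<Rightarrow> real" and M :: "'w measure" and X :: "nat \<Rightarrow> 'w \<Rightarrow> 'a" +
  fixes \<epsilon>\<^sub>0 \<epsilon>\<^sub>1 \<epsilon>\<^sub>2 R\<^sub>1 R\<^sub>2 :: real
  assumes pos: "0 < \<epsilon>\<^sub>0" "0 < \<epsilon>\<^sub>1" "0 < \<epsilon>\<^sub>2" "0 < R\<^sub>1" "0 < R\<^sub>2"
    and K_finite: "K2_functional f \<epsilon>\<^sub>0 < \<infinity>"
    and Q_finite: "Q_functional f \<epsilon>\<^sub>1 R\<^sub>1 < \<infinity>"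
    and T_finite: "T_functional f \<epsilon>\<^sub>2 R\<^sub>2 < \<infinity>"
begin

text \<open>At most 1 for the fractional power inequalities, and at most both given exponents so
  that Q and T control moments of this order.\<close>

definition \<delta> :: real where "\<delta> = min 1 (min \<epsilon>\<^sub>1 \<epsilon>\<^sub>2)"

definition R :: real where "R = min R\<^sub>1 R\<^sub>2"

definition C :: real where
  "C = (1 + enn2real (Q_functional f \<epsilon>\<^sub>1 R\<^sub>1)) + (1 + enn2real (T_functional f \<epsilon>\<^sub>2 R\<^sub>2))"

lemma \<delta>_props: "0 < \<delta>" "\<delta> \<le> 1" "\<delta> \<le> \<epsilon>\<^sub>1" "\<delta> \<le> \<epsilon>\<^sub>2"
  using pos by (auto simp: \<delta>_def)

lemma R_props: "0 < R" "R \<le> R\<^sub>1" "R \<le> R\<^sub>2"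
  using pos by (auto simp: R_def)

lemma C_ge: "1 + enn2real (Q_functional f \<epsilon>\<^sub>1 R\<^sub>1) \<le> C" "1 + enn2real (T_functional f \<epsilon>\<^sub>2 R\<^sub>2) \<le> C" "0 \<le> C"
  by (auto simp: C_def)

lemma exp_transform_decay:
  shows "0 \<le> t \<Longrightarrow> exp_transform (exp t) \<le> C * exp (- (\<delta> * \<bar>t\<bar>))"
    and "t \<le> 0 \<Longrightarrow> 1 - exp_transform (exp t) \<le> C * exp (- (\<delta> * \<bar>t\<bar>))"
proof -
  note b = exp_transform_tail_bounds[OF Q_finite pos(2,4) \<delta>_props(3) T_finite pos(3,5) \<delta>_props(4,1,2), of "exp t"]
  show "exp_transform (exp t) \<le> C * exp (- (\<delta> * \<bar>t\<bar>))" if "0 \<le> t"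
  proof -
    have "exp_transform (exp t) \<le> (1 + enn2real (T_functional f \<epsilon>\<^sub>2 R\<^sub>2)) * exp t powr - \<delta>"
      using b by simp
    also have "\<dots> \<le> C * exp t powr - \<delta>"
      using C_ge by (intro mult_right_mono) auto
    finally show ?thesis
      using that by (simp add: exp_powr_real mult.commute)
  qed
  show "1 - exp_transform (exp t) \<le> C * exp (- (\<delta> * \<bar>t\<bar>))" if "t \<le> 0"
  proof -
    have "1 - exp_transform (exp t) \<le> (1 + enn2real (Q_functional f \<epsilon>\<^sub>1 R\<^sub>1)) * exp t powr \<delta>"
      using b by simp
    also have "\<dots> \<le> C * exp t powr \<delta>"
      using C_ge by (intro mult_right_mono) auto
    finally show ?thesis
      using that by (simp add: exp_powr_real mult.commute)
  qed
qed

lemmas entropy = shannon_entropy_exp_transform[OF \<delta>_props(1) exp_transform_decay]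

section \<open>The error below the cutoff\<close>

definition deviation :: "nat \<Rightarrow> real \<Rightarrow> real" where
  "deviation N t = expectation (\<lambda>\<omega>. (isolated_mean N (sample_radius N t) \<omega> - exp_transform (exp t))\<^sup>2)"

lemma abs_deviation_le_one: "\<bar>isolated_mean N r \<omega> - exp_transform (exp t)\<bar> \<le> 1"
  using isolated_mean_bounds[of N r \<omega>] exp_transform_bounds[of "exp t"] by auto

lemma deviation_square_le:
  "(isolated_mean N r \<omega> - exp_transform (exp t))\<^sup>2 \<le> \<bar>isolated_mean N r \<omega> - exp_transform (exp t)\<bar>"
  using mult_left_mono[OF abs_deviation_le_one[of N r \<omega> t]
    abs_ge_zero[of "isolated_mean N r \<omega> - exp_transform (exp t)"]]
  by (simp add: power2_eq_square)

lemma integrable_isolated_mean: "integrable M (isolated_mean N r)"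
  by (intro integrable_const_bound[of _ 1]) (auto simp: isolated_mean_bounds)

lemma integrable_deviation: "integrable M (\<lambda>\<omega>. (isolated_mean N r \<omega> - exp_transform (exp t))\<^sup>2)"
  using abs_deviation_le_one[of N r _ t] by (intro integrable_const_bound[of _ 1]) (auto simp: abs_square_le_1)

lemma deviation_nonneg: "0 \<le> deviation N t"
  unfolding deviation_def by (intro integral_nonneg_AE) auto

text \<open>The difference is at most 1 in absolute value, so its square is at most the difference
  itself and first moments suffice. For t \<ge> 0 both tails are small, for t < 0 both complements;
  each contributes one \<open>C\<close>. The cutoff on t keeps the radius below R.\<close>

lemma deviation_le:
  assumes N: "N \<ge> 2" and t: "t < log_ball_count N R"
  shows "deviation N t \<le> 2 * C * exp (- (\<delta> * \<bar>t\<bar>))"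
proof -
  let ?r = "sample_radius N t"
  let ?F = "exp_transform (exp t)"
  have r: "0 < ?r" "?r \<le> R\<^sub>1" "?r \<le> R\<^sub>2" "real (N - 1) * ball_vol ?r = exp t"
    using sample_radius_props[OF N, of t] sample_radius_less_iff[OF N R_props(1), of t] t R_props by auto
  have m: "expectation (isolated_mean N ?r) = (\<integral>x. (1 - ball_prob x ?r) ^ (N - 1) \<partial>law)"
    by (rule expectation_isolated_mean[OF N])
  show ?thesis
  proof (cases "0 \<le> t")
    case True
    have "deviation N t \<le> expectation (\<lambda>\<omega>. isolated_mean N ?r \<omega> + ?F)"
      unfolding deviation_def
    proof (intro integral_mono integrable_deviation)
      fix \<omega>
      show "(isolated_mean N ?r \<omega> - ?F)\<^sup>2 \<le> isolated_mean N ?r \<omega> + ?F"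
        using deviation_square_le[of N ?r \<omega> t] isolated_mean_bounds[of N ?r \<omega>] exp_transform_bounds[of "exp t"] by auto
    qed (use integrable_isolated_mean in auto)
    also have "\<dots> = expectation (isolated_mean N ?r) + ?F"
      using integrable_isolated_mean[of N ?r] by (simp add: prob_space)
    also have "expectation (isolated_mean N ?r) \<le> (1 + enn2real (T_functional f \<epsilon>\<^sub>2 R\<^sub>2)) * exp t powr - \<delta>"
      using vacancy_prob_le[OF T_finite pos(3) \<delta>_props(1,2,4) r(1,3), of "N - 1"] N r(4) by (simp add: m)
    also have "\<dots> \<le> C * exp t powr - \<delta>"
      using C_ge by (intro mult_right_mono) auto
    finally show ?thesis
      using True exp_transform_decay(1)[OF True] by (simp add: exp_powr_real algebra_simps)
  next
    case False
    have "deviation N t \<le> expectation (\<lambda>\<omega>. (1 - isolated_mean N ?r \<omega>) + (1 - ?F))"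
      unfolding deviation_def
    proof (intro integral_mono integrable_deviation)
      fix \<omega>
      show "(isolated_mean N ?r \<omega> - ?F)\<^sup>2 \<le> (1 - isolated_mean N ?r \<omega>) + (1 - ?F)"
        using deviation_square_le[of N ?r \<omega> t] isolated_mean_bounds[of N ?r \<omega>] exp_transform_bounds[of "exp t"] by auto
    qed (use integrable_isolated_mean in auto)
    also have "\<dots> = (1 - expectation (isolated_mean N ?r)) + (1 - ?F)"
      using integrable_isolated_mean[of N ?r] by (simp add: prob_space)
    also have "1 - expectation (isolated_mean N ?r) \<le> (1 + enn2real (Q_functional f \<epsilon>\<^sub>1 R\<^sub>1)) * exp t powr \<delta>"
      using occupied_prob_le[OF Q_finite pos(2) \<delta>_props(1,2,3) r(1,2), of "N - 1"] r(4) by (simp add: m)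
    also have "\<dots> \<le> C * exp t powr \<delta>"
      using C_ge by (intro mult_right_mono) auto
    finally show ?thesis
      using False exp_transform_decay(2)[of t] by (simp add: exp_powr_real algebra_simps)
  qed
qed

lemma deviation_tendsto_0: "(\<lambda>N. deviation N t) \<longlonglongrightarrow> 0"
proof -
  let ?c = "exp_transform (exp t)"
  let ?r = "\<lambda>n. ball_radius (exp t / real n)"
  let ?b = "\<lambda>n. 1 / real (Suc n) + close_prob (2 * ?r n)
      + (\<integral>x. exp (- ((real n - 1) * ball_prob x (?r n))) \<partial>law)\<^sup>2
      - 2 * ?c * (\<integral>x. (1 - ball_prob x (?r n)) ^ n \<partial>law) + ?c\<^sup>2"
  have "(\<lambda>n. deviation (Suc n) t) \<longlonglongrightarrow> 0"
  proof (rule tendsto_sandwich[OF _ _ tendsto_const])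
    show "eventually (\<lambda>n. 0 \<le> deviation (Suc n) t) sequentially"
      by (simp add: deviation_nonneg)
    show "eventually (\<lambda>n. deviation (Suc n) t \<le> ?b n) sequentially"
    proof (intro eventually_sequentiallyI[of 1])
      fix n :: nat assume n: "1 \<le> n"
      \<comment> \<open>N = n + 1, so N - 2 matches the n - 1 in \<open>vacancy_exp_tendsto\<close>;
        natural subtraction requires n \<ge> 1.\<close>
      have "real (Suc n - 2) = real n - 1"
        using n by (simp add: of_nat_diff)
      moreover have "sample_radius (Suc n) t = ?r n"
        by (simp add: sample_radius_def)
      ultimately show "deviation (Suc n) t \<le> ?b n"
        using expectation_isolated_mean_deviation_le[of "Suc n" "?r n" ?c] n by (simp add: deviation_def)
    qed
    have "(\<lambda>n. exp t / real n) \<longlonglongrightarrow> 0"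
      by real_asymp
    then have "(\<lambda>n. 2 * ?r n) \<longlonglongrightarrow> 2 * 0"
      by (intro tendsto_mult tendsto_const ball_radius_tendsto_0) auto
    then have "(\<lambda>n. close_prob (2 * ?r n)) \<longlonglongrightarrow> 0"
      by (intro close_prob_tendsto_0) simp
    moreover have "(\<lambda>n. 1 / real (Suc n)) \<longlonglongrightarrow> 0"
      by real_asymp
    \<comment> \<open>The second moment bound, the cross term and the square tend to c^2, - 2 c^2
      and c^2, which cancel.\<close>
    ultimately have "?b \<longlonglongrightarrow> 0 + 0 + ?c\<^sup>2 - 2 * ?c * ?c + ?c\<^sup>2"
      by (intro tendsto_add tendsto_diff tendsto_mult tendsto_power tendsto_const vacancy_exp_tendsto) auto
    then show "?b \<longlonglongrightarrow> 0"
      by (simp add: power2_eq_square)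
  qed
  then show ?thesis
    by (subst filterlim_sequentially_Suc[symmetric])
qed

definition bulk_error :: "nat \<Rightarrow> 'w \<Rightarrow> real" where
  "bulk_error N \<omega> = (\<integral>t. indicator {..<log_ball_count N R} t
    * (isolated_mean N (sample_radius N t) \<omega> - exp_transform (exp t)) \<partial>lborel)"

lemma isolated_mean_sample_radius_measurable [measurable]:
  "(\<lambda>(\<omega>, t). isolated_mean N (sample_radius N t) \<omega>) \<in> borel_measurable (M \<Otimes>\<^sub>M borel)"
proof -
  have "(\<lambda>z. isolated N i (sample_radius N (snd z)) (fst z)) \<in> borel_measurable (M \<Otimes>\<^sub>M borel)"
    if i: "i \<in> {1..N}" for i
  proof -
    have [measurable]: "X k \<in> borel_measurable M" if "k \<in> insert i ({1..N} - {i})" for k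
      using that i by auto
    have "Measurable.pred (M \<Otimes>\<^sub>M borel) (\<lambda>z. \<forall>k\<in>{1..N} - {i}. sample_radius N (snd z) < dist (X i (fst z)) (X k (fst z)))"
    proof (intro pred_intros_finite)
      fix k assume k: "k \<in> {1..N} - {i}"
      have [measurable]: "X k \<in> borel_measurable M" "X i \<in> borel_measurable M"
        using i k by auto
      show "Measurable.pred (M \<Otimes>\<^sub>M borel) (\<lambda>z. sample_radius N (snd z) < dist (X i (fst z)) (X k (fst z)))"
        by measurable
    qed simp
    then show ?thesis
      unfolding isolated_def by (intro measurable_If) auto
  qed
  then show ?thesis
    unfolding isolated_mean_def by (auto simp: case_prod_beta)
qed

lemma bulk_error_measurable [measurable]: "bulk_error N \<in> borel_measurable M"
  unfolding bulk_error_def by measurable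

text \<open>The weight rate \<delta> / 2 spends half of the decay exp(- \<delta> |t|) of
  \<open>deviation\<close> and leaves the other half integrable; 4 / \<delta> is 2 / (\<delta> /
  2).\<close>

lemma nn_integral_bulk_error_le:
  "(\<integral>\<^sup>+\<omega>. ennreal ((bulk_error N \<omega>)\<^sup>2) \<partial>M) \<le> ennreal (4 / \<delta>)
    * (\<integral>\<^sup>+t. indicator {..<log_ball_count N R} t * ennreal (exp (\<delta> / 2 * \<bar>t\<bar>) * deviation N t) \<partial>lborel)"
proof -
  interpret P: pair_sigma_finite M "lborel :: real measure"
    by standard
  let ?L = "log_ball_count N R"
  let ?D = "\<lambda>\<omega> t. isolated_mean N (sample_radius N t) \<omega> - exp_transform (exp t)"
  let ?G = "\<lambda>\<omega> t. ennreal (exp (\<delta> / 2 * \<bar>t\<bar>) * (indicator {..<?L} t * ?D \<omega> t)\<^sup>2)"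
  have G: "case_prod ?G \<in> borel_measurable (M \<Otimes>\<^sub>M lborel)"
    by measurable
  have D: "(\<lambda>t. ?D \<omega> t) \<in> borel_measurable borel" if "\<omega> \<in> space M" for \<omega>
  proof -
    have [measurable]: "(\<lambda>t. isolated_mean N (sample_radius N t) \<omega>) \<in> borel_measurable borel"
      using measurable_Pair2[OF isolated_mean_sample_radius_measurable[of N] that] by simp
    show ?thesis
      by measurable
  qed
  have "(\<integral>\<^sup>+\<omega>. ennreal ((bulk_error N \<omega>)\<^sup>2) \<partial>M) \<le> (\<integral>\<^sup>+\<omega>. ennreal (4 / \<delta>) * (\<integral>\<^sup>+t. ?G \<omega> t \<partial>lborel) \<partial>M)"
  proof (intro nn_integral_mono)
    fix \<omega> assume "\<omega> \<in> space M"
    note [measurable] = D[OF this]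
    have "(\<lambda>t. indicator {..<?L} t * ?D \<omega> t) \<in> borel_measurable borel"
      by measurable
    from ennreal_integral_square_le[OF _ this, of "\<delta> / 2"]
    show "ennreal ((bulk_error N \<omega>)\<^sup>2) \<le> ennreal (4 / \<delta>) * (\<integral>\<^sup>+t. ?G \<omega> t \<partial>lborel)"
      using \<delta>_props by (simp add: bulk_error_def)
  qed
  also have "\<dots> = ennreal (4 / \<delta>) * (\<integral>\<^sup>+\<omega>. (\<integral>\<^sup>+t. ?G \<omega> t \<partial>lborel) \<partial>M)"
    using G by (intro nn_integral_cmult) measurable
  also have "(\<integral>\<^sup>+\<omega>. (\<integral>\<^sup>+t. ?G \<omega> t \<partial>lborel) \<partial>M) = (\<integral>\<^sup>+t. (\<integral>\<^sup>+\<omega>. ?G \<omega> t \<partial>M) \<partial>lborel)"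
    using P.Fubini'[OF G] by simp
  also have "\<dots> = (\<integral>\<^sup>+t. indicator {..<?L} t * ennreal (exp (\<delta> / 2 * \<bar>t\<bar>) * deviation N t) \<partial>lborel)"
  proof (intro nn_integral_cong)
    fix t :: real
    have "(\<integral>\<^sup>+\<omega>. ?G \<omega> t \<partial>M)
        = (\<integral>\<^sup>+\<omega>. indicator {..<?L} t * ennreal (exp (\<delta> / 2 * \<bar>t\<bar>)) * ennreal ((?D \<omega> t)\<^sup>2) \<partial>M)"
      by (intro nn_integral_cong) (auto simp: indicator_def ennreal_mult)
    also have "\<dots> = indicator {..<?L} t * ennreal (exp (\<delta> / 2 * \<bar>t\<bar>)) * (\<integral>\<^sup>+\<omega>. ennreal ((?D \<omega> t)\<^sup>2) \<partial>M)"
      by (intro nn_integral_cmult) measurable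
    also have "(\<integral>\<^sup>+\<omega>. ennreal ((?D \<omega> t)\<^sup>2) \<partial>M) = ennreal (deviation N t)"
      unfolding deviation_def by (intro nn_integral_eq_integral integrable_deviation) auto
    finally show "(\<integral>\<^sup>+\<omega>. ?G \<omega> t \<partial>M) = indicator {..<?L} t * ennreal (exp (\<delta> / 2 * \<bar>t\<bar>) * deviation N t)"
      by (simp add: ennreal_mult deviation_nonneg mult.assoc)
  qed
  finally show ?thesis .
qed

lemma deviation_measurable [measurable]: "deviation N \<in> borel_measurable borel"
proof -
  have "(\<lambda>(t, \<omega>). (isolated_mean N (sample_radius N t) \<omega> - exp_transform (exp t))\<^sup>2) \<in> borel_measurable (borel \<Otimes>\<^sub>M M)"
    by (subst measurable_pair_swap_iff) (simp add: case_prod_beta)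
  then show ?thesis
    unfolding deviation_def by (rule borel_measurable_lebesgue_integral)
qed

lemma bulk_error_tendsto_0: "(\<lambda>N. \<integral>\<^sup>+\<omega>. ennreal ((bulk_error N \<omega>)\<^sup>2) \<partial>M) \<longlonglongrightarrow> 0"
proof -
  let ?u = "\<lambda>N t. indicator {..<log_ball_count N R} t * ennreal (exp (\<delta> / 2 * \<bar>t\<bar>) * deviation N t)"
  \<comment> \<open>The shift by 2 makes \<open>deviation_le\<close> available for every
    index.\<close>
  have "(\<lambda>n. \<integral>\<^sup>+t. ?u (n + 2) t \<partial>lborel) \<longlonglongrightarrow> (\<integral>\<^sup>+t. 0 \<partial>(lborel :: real measure))"
  proof (rule nn_integral_dominated_convergence[where w = "\<lambda>t. ennreal (2 * C * exp (- (\<delta> / 2 * \<bar>t\<bar>)))"])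
    show "AE t in lborel. ?u (n + 2) t \<le> ennreal (2 * C * exp (- (\<delta> / 2 * \<bar>t\<bar>)))" for n
    proof (intro AE_I2)
      fix t :: real
      show "?u (n + 2) t \<le> ennreal (2 * C * exp (- (\<delta> / 2 * \<bar>t\<bar>)))"
      proof (cases "t < log_ball_count (n + 2) R")
        case True
        have "exp (\<delta> / 2 * \<bar>t\<bar>) * deviation (n + 2) t \<le> exp (\<delta> / 2 * \<bar>t\<bar>) * (2 * C * exp (- (\<delta> * \<bar>t\<bar>)))"
          using True by (intro mult_left_mono deviation_le) auto
        also have "\<dots> = 2 * C * exp (\<delta> / 2 * \<bar>t\<bar> + - (\<delta> * \<bar>t\<bar>))"
          by (simp only: exp_add) simp
        also have "\<delta> / 2 * \<bar>t\<bar> + - (\<delta> * \<bar>t\<bar>) = - (\<delta> / 2 * \<bar>t\<bar>)"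
          by simp
        finally show ?thesis
          using True by (simp add: ennreal_leI)
      qed simp
    qed
    have "has_bochner_integral lborel (\<lambda>t. 2 * C * exp (- (\<delta> / 2 * \<bar>t\<bar>))) (2 * C * (2 / (\<delta> / 2)))"
      using \<delta>_props by (intro has_bochner_integral_mult_right has_bochner_integral_exp_minus_abs) auto
    then show "(\<integral>\<^sup>+t. ennreal (2 * C * exp (- (\<delta> / 2 * \<bar>t\<bar>))) \<partial>lborel) < \<infinity>"
      using C_ge by (subst nn_integral_eq_integral) (auto simp: has_bochner_integral_iff)
    show "AE t in lborel. (\<lambda>n. ?u (n + 2) t) \<longlonglongrightarrow> 0"
    proof (intro AE_I2)
      fix t :: real
      have "(\<lambda>n. exp (\<delta> / 2 * \<bar>t\<bar>) * deviation (n + 2) t) \<longlonglongrightarrow> exp (\<delta> / 2 * \<bar>t\<bar>) * 0"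
        using LIMSEQ_ignore_initial_segment[OF deviation_tendsto_0, of 2] by (intro tendsto_mult tendsto_const)
      then have lim: "(\<lambda>n. ennreal (exp (\<delta> / 2 * \<bar>t\<bar>) * deviation (n + 2) t)) \<longlonglongrightarrow> 0"
        by (intro tendsto_ennrealI[where x = 0, simplified]) simp
      show "(\<lambda>n. ?u (n + 2) t) \<longlonglongrightarrow> 0"
        by (rule tendsto_sandwich[OF _ _ tendsto_const lim]) (auto simp: indicator_def)
    qed
  qed measurable
  then have "(\<lambda>n. \<integral>\<^sup>+t. ?u (n + 2) t \<partial>lborel) \<longlonglongrightarrow> 0"
    by simp
  then have "(\<lambda>n. ennreal (4 / \<delta>) * (\<integral>\<^sup>+t. ?u (n + 2) t \<partial>lborel)) \<longlonglongrightarrow> ennreal (4 / \<delta>) * 0"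
    by (intro ennreal_tendsto_cmult) auto
  then have lim: "(\<lambda>n. ennreal (4 / \<delta>) * (\<integral>\<^sup>+t. ?u (n + 2) t \<partial>lborel)) \<longlonglongrightarrow> 0"
    by simp
  have "(\<lambda>n. \<integral>\<^sup>+\<omega>. ennreal ((bulk_error (n + 2) \<omega>)\<^sup>2) \<partial>M) \<longlonglongrightarrow> 0"
  proof (rule tendsto_sandwich[OF _ _ tendsto_const lim])
    show "eventually (\<lambda>n. (\<integral>\<^sup>+\<omega>. ennreal ((bulk_error (n + 2) \<omega>)\<^sup>2) \<partial>M)
        \<le> ennreal (4 / \<delta>) * (\<integral>\<^sup>+t. ?u (n + 2) t \<partial>lborel)) sequentially"
      by (intro always_eventually allI nn_integral_bulk_error_le)
  qed simp
  then show ?thesis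
    by (rule LIMSEQ_offset)
qed

section \<open>The errors above the cutoff\<close>

definition bias_tail :: "nat \<Rightarrow> real" where
  "bias_tail N = (\<integral>t. indicator {log_ball_count N R..} t * (exp_transform (exp t) - indicator {..<0} t) \<partial>lborel)"

lemma log_ball_count_at_top: "filterlim (\<lambda>N. log_ball_count N s) at_top sequentially"
  unfolding log_ball_count_def by real_asymp

lemma bias_tail_tendsto_0: "bias_tail \<longlonglongrightarrow> 0"
proof -
  let ?F = "\<lambda>t. exp_transform (exp t) - indicator {..<0} t"
  have i: "integrable lborel ?F"
    using entropy(2) by (auto simp: has_bochner_integral_iff)
  have "(\<lambda>N. \<integral>t. indicator {log_ball_count N R..} t * ?F t \<partial>lborel) \<longlonglongrightarrow> (\<integral>t. 0 \<partial>(lborel :: real measure))"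
  proof (rule integral_dominated_convergence[where w = "\<lambda>t. \<bar>?F t\<bar>"])
    show "AE t in lborel. (\<lambda>N. indicator {log_ball_count N R..} t * ?F t) \<longlonglongrightarrow> 0"
    proof (intro AE_I2 tendsto_eventually)
      fix t :: real
      have "eventually (\<lambda>N. t < log_ball_count N R) sequentially"
        using log_ball_count_at_top by (simp add: filterlim_at_top_dense)
      then show "eventually (\<lambda>N. indicator {log_ball_count N R..} t * ?F t = 0) sequentially"
        by eventually_elim auto
    qed
    show "AE t in lborel. norm (indicator {log_ball_count N R..} t * ?F t) \<le> \<bar>?F t\<bar>" for N
      by (intro AE_I2) (auto simp: indicator_def)
  qed (use i in auto)
  then show ?thesis
    by (simp add: bias_tail_def[abs_def])
qed

definition tail_error :: "nat \<Rightarrow> 'w \<Rightarrow> real" where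
  "tail_error N \<omega> = (\<Sum>i=1..N. max 0 (ln (sample_nn_dist N i \<omega> / R))) / real N"

lemma tail_error_measurable [measurable]: "tail_error N \<in> borel_measurable M"
  unfolding tail_error_def by measurable

text \<open>The square of a mean is at most the mean of the squares, so no correlations between
  sample points enter, and every summand has the same bound.\<close>

lemma nn_integral_tail_error_le:
  assumes N: "N \<ge> 2"
  shows "(\<integral>\<^sup>+\<omega>. ennreal ((tail_error N \<omega>)\<^sup>2) \<partial>M)
    \<le> (\<integral>\<^sup>+x. log_excess R x * ennreal ((1 - ball_prob x R) ^ (N - 2)) \<partial>law)" (is "_ \<le> ?B")
proof -
  let ?b = "\<lambda>i \<omega>. max 0 (ln (sample_nn_dist N i \<omega> / R))"
  have le: "(tail_error N \<omega>)\<^sup>2 \<le> (\<Sum>i=1..N. 1 / real N * (?b i \<omega>)\<^sup>2)" for \<omega>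
  proof -
    have "(tail_error N \<omega>)\<^sup>2 = (\<Sum>i=1..N. ?b i \<omega>)\<^sup>2 / (real N)\<^sup>2"
      by (simp add: tail_error_def power_divide)
    also have "\<dots> \<le> (real N * (\<Sum>i=1..N. (?b i \<omega>)\<^sup>2)) / (real N)\<^sup>2"
      using sum_squared_le_sum_of_squares[of "\<lambda>i. ?b i \<omega>" "{1..N}"]
      by (intro divide_right_mono) (auto simp: mult.commute)
    also have "\<dots> = 1 / real N * (\<Sum>i=1..N. (?b i \<omega>)\<^sup>2)"
      using N by (simp add: power2_eq_square)
    finally show ?thesis
      by (simp only: sum_distrib_left)
  qed
  have "(\<integral>\<^sup>+\<omega>. ennreal ((tail_error N \<omega>)\<^sup>2) \<partial>M)
      \<le> (\<integral>\<^sup>+\<omega>. (\<Sum>i=1..N. ennreal (1 / real N) * ennreal ((?b i \<omega>)\<^sup>2)) \<partial>M)"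
  proof (intro nn_integral_mono)
    fix \<omega>
    have "ennreal ((tail_error N \<omega>)\<^sup>2) \<le> ennreal (\<Sum>i=1..N. 1 / real N * (?b i \<omega>)\<^sup>2)"
      by (rule ennreal_leI[OF le])
    also have "\<dots> = (\<Sum>i=1..N. ennreal (1 / real N) * ennreal ((?b i \<omega>)\<^sup>2))"
    proof -
      have "ennreal (\<Sum>i=1..N. 1 / real N * (?b i \<omega>)\<^sup>2) = (\<Sum>i=1..N. ennreal (1 / real N * (?b i \<omega>)\<^sup>2))"
        by (rule sum_ennreal[symmetric]) auto
      also have "\<dots> = (\<Sum>i=1..N. ennreal (1 / real N) * ennreal ((?b i \<omega>)\<^sup>2))"
        by (intro sum.cong refl ennreal_mult) auto
      finally show ?thesis .
    qed
    finally show "ennreal ((tail_error N \<omega>)\<^sup>2) \<le> (\<Sum>i=1..N. ennreal (1 / real N) * ennreal ((?b i \<omega>)\<^sup>2))" .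
  qed
  also have "\<dots> = (\<Sum>i=1..N. ennreal (1 / real N) * (\<integral>\<^sup>+\<omega>. ennreal ((?b i \<omega>)\<^sup>2) \<partial>M))"
    by (subst nn_integral_sum) (auto intro!: sum.cong nn_integral_cmult)
  also have "\<dots> \<le> (\<Sum>i=1..N. ennreal (1 / real N) * ?B)"
    using N R_props by (intro sum_mono mult_left_mono nn_integral_nn_dist_excess_le) auto
  also have "\<dots> = (of_nat N * ennreal (1 / real N)) * ?B"
    by (simp add: mult.assoc)
  also have "of_nat N * ennreal (1 / real N) = 1"
    using N by (simp add: ennreal_of_nat_eq_real_of_nat flip: ennreal_mult ennreal_1)
  finally show ?thesis
    by simp
qed

lemma tail_error_tendsto_0: "(\<lambda>N. \<integral>\<^sup>+\<omega>. ennreal ((tail_error N \<omega>)\<^sup>2) \<partial>M) \<longlonglongrightarrow> 0"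
proof -
  have "AE x in law. 0 < ball_prob x R"
    using AE_ball_avg_pos[OF T_finite R_props(1,3) pos(3)]
  proof eventually_elim
    case (elim x)
    then show ?case
      using ball_vol_pos[OF R_props(1)] by (simp add: ball_avg_def zero_less_divide_iff)
  qed
  then have lim: "(\<lambda>n. \<integral>\<^sup>+x. log_excess R x * ennreal ((1 - ball_prob x R) ^ n) \<partial>law) \<longlonglongrightarrow> 0"
    by (intro log_excess_vacancy_tendsto_0 nn_integral_log_excess_finite[OF K_finite pos(1) R_props(1)])
  have "(\<lambda>n. \<integral>\<^sup>+\<omega>. ennreal ((tail_error (n + 2) \<omega>)\<^sup>2) \<partial>M) \<longlonglongrightarrow> 0"
  proof (rule tendsto_sandwich[OF _ _ tendsto_const lim])
    show "eventually (\<lambda>n. (\<integral>\<^sup>+\<omega>. ennreal ((tail_error (n + 2) \<omega>)\<^sup>2) \<partial>M)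
        \<le> (\<integral>\<^sup>+x. log_excess R x * ennreal ((1 - ball_prob x R) ^ n) \<partial>law)) sequentially"
      using nn_integral_tail_error_le[of "_ + 2"] by (intro always_eventually allI) simp
  qed auto
  then show ?thesis
    by (rule LIMSEQ_offset)
qed

text \<open>The nonnegative integral is used because a Bochner integral of a non-integrable square
  would be 0 by default.\<close>

theorem KL_estimate_L2_consistent:
  "(\<lambda>N. \<integral>\<^sup>+\<omega>. ennreal ((KL_estimate N (\<lambda>i. X i \<omega>) - shannon_entropy f)\<^sup>2) \<partial>M) \<longlonglongrightarrow> 0"
proof (rule tendsto_sandwich[OF _ _ tendsto_const])
  let ?d = "real DIM('a)"
  let ?A = "\<lambda>N. \<integral>\<^sup>+\<omega>. ennreal ((bulk_error N \<omega>)\<^sup>2) \<partial>M"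
  let ?B = "\<lambda>N. \<integral>\<^sup>+\<omega>. ennreal ((tail_error N \<omega>)\<^sup>2) \<partial>M"
  have "eventually (\<lambda>N. 0 < log_ball_count N R) sequentially"
    using log_ball_count_at_top by (simp add: filterlim_at_top_dense)
  with eventually_ge_at_top[of 2]
  show "eventually (\<lambda>N. (\<integral>\<^sup>+\<omega>. ennreal ((KL_estimate N (\<lambda>i. X i \<omega>) - shannon_entropy f)\<^sup>2) \<partial>M)
      \<le> 3 * ?A N + ennreal (3 * (bias_tail N)\<^sup>2) + ennreal (3 * ?d\<^sup>2) * ?B N) sequentially"
  proof eventually_elim
    case (elim N)
    have "(\<integral>\<^sup>+\<omega>. ennreal ((KL_estimate N (\<lambda>i. X i \<omega>) - shannon_entropy f)\<^sup>2) \<partial>M)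
        \<le> (\<integral>\<^sup>+\<omega>. 3 * ennreal ((bulk_error N \<omega>)\<^sup>2) + ennreal (3 * (bias_tail N)\<^sup>2)
            + ennreal (3 * ?d\<^sup>2) * ennreal ((tail_error N \<omega>)\<^sup>2) \<partial>M)"
    proof (rule nn_integral_mono_AE)
      show "AE \<omega> in M. ennreal ((KL_estimate N (\<lambda>i. X i \<omega>) - shannon_entropy f)\<^sup>2)
        \<le> 3 * ennreal ((bulk_error N \<omega>)\<^sup>2) + ennreal (3 * (bias_tail N)\<^sup>2)
            + ennreal (3 * ?d\<^sup>2) * ennreal ((tail_error N \<omega>)\<^sup>2)"
        using AE_no_ties[of N]
      proof eventually_elim
        case (elim \<omega>)
        have nn: "0 < sample_nn_dist N i \<omega>" if "i \<in> {1..N}" for i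
          using elim that \<open>2 \<le> N\<close> by (subst nn_dist_gr_iff) auto
        have e: "KL_estimate N (\<lambda>i. X i \<omega>) - shannon_entropy f = bulk_error N \<omega> - bias_tail N + ?d * tail_error N \<omega>"
          unfolding bulk_error_def bias_tail_def tail_error_def
          using KL_estimate_decomposition[OF \<open>2 \<le> N\<close> R_props(1) less_imp_le entropy(2) nn] \<open>0 < log_ball_count N R\<close>
          by blast
        \<comment> \<open>The right side minus the left is the sum of the three squares
          supplied.\<close>
        have sq: "(a - b + c)\<^sup>2 \<le> 3 * a\<^sup>2 + 3 * b\<^sup>2 + 3 * c\<^sup>2" for a b c :: real
          using zero_le_power2[of "a + b"] zero_le_power2[of "a - c"] zero_le_power2[of "b + c"]
          by (simp add: power2_eq_square algebra_simps)
        have "(KL_estimate N (\<lambda>i. X i \<omega>) - shannon_entropy f)\<^sup>2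
            \<le> 3 * (bulk_error N \<omega>)\<^sup>2 + 3 * (bias_tail N)\<^sup>2 + 3 * ?d\<^sup>2 * (tail_error N \<omega>)\<^sup>2"
          unfolding e using sq[of "bulk_error N \<omega>" "bias_tail N" "?d * tail_error N \<omega>"]
          by (simp add: power_mult_distrib mult.assoc)
        from ennreal_leI[OF this] show ?case
          by (simp add: ennreal_mult ennreal_plus)
      qed
    qed
    also have "\<dots> = 3 * ?A N + ennreal (3 * (bias_tail N)\<^sup>2) + ennreal (3 * ?d\<^sup>2) * ?B N"
      by (simp add: nn_integral_add nn_integral_cmult emeasure_space_1)
    finally show ?case .
  qed
  have "(\<lambda>N. 3 * (bias_tail N)\<^sup>2) \<longlonglongrightarrow> 3 * 0\<^sup>2"
    by (intro tendsto_intros bias_tail_tendsto_0)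
  then have "(\<lambda>N. ennreal (3 * (bias_tail N)\<^sup>2)) \<longlonglongrightarrow> ennreal 0"
    by (intro tendsto_ennrealI) simp
  moreover have "(\<lambda>N. 3 * ?A N) \<longlonglongrightarrow> 3 * 0"
    by (intro ennreal_tendsto_cmult bulk_error_tendsto_0) simp
  moreover have "(\<lambda>N. ennreal (3 * ?d\<^sup>2) * ?B N) \<longlonglongrightarrow> ennreal (3 * ?d\<^sup>2) * 0"
    by (intro ennreal_tendsto_cmult tail_error_tendsto_0) simp
  ultimately have "(\<lambda>N. 3 * ?A N + ennreal (3 * (bias_tail N)\<^sup>2) + ennreal (3 * ?d\<^sup>2) * ?B N)
      \<longlonglongrightarrow> 3 * 0 + ennreal 0 + ennreal (3 * ?d\<^sup>2) * 0"
    by (intro tendsto_add)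
  then show "(\<lambda>N. 3 * ?A N + ennreal (3 * (bias_tail N)\<^sup>2) + ennreal (3 * ?d\<^sup>2) * ?B N) \<longlonglongrightarrow> 0"
    by simp
qed simp

end

text \<open>The first conjunct rules out that \<open>shannon_entropy f\<close> is merely the default
  value 0 of a non-integrable function.\<close>

theorem theorem2:
  fixes M :: "'w measure"
    and \<xi> :: "'w \<Rightarrow> 'a::euclidean_space"
    and X :: "nat \<Rightarrow> 'w \<Rightarrow> 'a"
    and f :: "'a \<Rightarrow> real"
    and \<epsilon>\<^sub>0 \<epsilon>\<^sub>1 \<epsilon>\<^sub>2 R\<^sub>1 R\<^sub>2 :: real
  assumes "prob_space M" and "complete_measure M"
    and "\<And>x. f x \<ge> 0"
    and "distributed M lborel \<xi> (\<lambda>x. ennreal (f x))"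
    and "prob_space.indep_vars M (\<lambda>_. borel) X {1..}"
    and "\<And>i. i \<ge> 1 \<Longrightarrow> distr M borel (X i) = distr M borel \<xi>"
    and "\<epsilon>\<^sub>0 > 0" and "\<epsilon>\<^sub>1 > 0" and "\<epsilon>\<^sub>2 > 0" and "R\<^sub>1 > 0" and "R\<^sub>2 > 0"
    and "K2_functional f \<epsilon>\<^sub>0 < \<infinity>"
    and "Q_functional f \<epsilon>\<^sub>1 R\<^sub>1 < \<infinity>"
    and "T_functional f \<epsilon>\<^sub>2 R\<^sub>2 < \<infinity>"
  shows "integrable lborel (\<lambda>x. f x * ln (f x)) \<and>
    (\<lambda>N. \<integral>\<^sup>+\<omega>. ennreal ((KL_estimate N (\<lambda>i. X i \<omega>) - shannon_entropy f)\<^sup>2) \<partial>M) \<longlonglongrightarrow> 0"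
proof -
  interpret prob_space M by fact
  have \<xi>: "\<xi> \<in> borel_measurable M" and fe: "(\<lambda>x. ennreal (f x)) \<in> borel_measurable borel"
    and law: "distr M lborel \<xi> = density lborel (\<lambda>x. ennreal (f x))"
    using assms(4) by (auto simp: distributed_def)
  \<comment> \<open>\<open>distributed\<close> gives measurability only of the
    \<open>ennreal\<close> version; f is recovered from it because f is nonnegative.\<close>
  have "(\<lambda>x. enn2real (ennreal (f x))) \<in> borel_measurable borel"
    using fe by measurable
  then have f: "f \<in> borel_measurable borel"
    by (simp add: assms(3))
  have "emeasure (distr M lborel \<xi>) UNIV = 1"
    using \<xi> by (subst emeasure_distr) (auto simp: emeasure_space_1)
  then have nn: "(\<integral>\<^sup>+x. ennreal (f x) \<partial>lborel) = 1"
    using fe by (simp add: law emeasure_density)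
  interpret lebesgue_prob_density f
    by unfold_locales (use f assms(3) nn in auto)
  have "distr M borel \<xi> = law"
    unfolding law_def law[symmetric] by (rule distr_cong) auto
  then interpret kl_sample f M X \<epsilon>\<^sub>0 \<epsilon>\<^sub>1 \<epsilon>\<^sub>2 R\<^sub>1 R\<^sub>2
    by unfold_locales (use assms in auto)
  show ?thesis
    using entropy(1) KL_estimate_L2_consistent by blast
qed

end
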